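(* Let $q=2^k$ be a power of $2$, $F=\mathbb{F}_q$, $G=\mathrm{SL}_2(F)$ acting by conjugation on the space $V$ of trace-zero $2\times 2$ matrices over $F$, $R=S(V^* )=F[x_1,x_2,x_3]$, and $\Omega=R\otimes\Lambda(V^* )$, with $f_1,f_2,f_3\in R^G$ and $\omega\in\Omega^1$ as defined in the context. (a) Suppose $q>2$. Then a minimal generating set for $\Omega^G$ as an $F$-algebra is given by $$\{f_1,\ f_2,\ f_3,\ \mathrm{d}f_1,\ \mathrm{d}f_2,\ \omega,\ f_2^{-1}\,\mathrm{d}f_1\wedge \mathrm{d}f_2,\ f_2^{-1}\,\mathrm{d}f_1\wedge\omega,\ f_2^{-1}\,\mathrm{d}f_2\wedge\omega,\ \mathrm{d}x_1\wedge \mathrm{d}x_2\wedge \mathrm{d}x_3\}.$$ (b) Suppose $q=2$. Then a minimal generating set for $\Omega^G$ as an $F$-algebra is given by $$\{f_1,\ f_2,\ f_3,\ \mathrm{d}f_1,\ \mathrm{d}f_2,\ \mathrm{d}f_3,\ f_2^{-1}\,\mathrm{d}f_1\wedge \mathrm{d}f_2\}.$$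
   Context: Let $F=\mathbb{F}_q$, let $V$ be the $F$-vector space of $2\times 2$ matrices of trace zero, with basis $v_1=\begin{pmatrix}0&-1\\0&0\end{pmatrix}$, $v_2=\begin{pmatrix}1&0\\0&-1\end{pmatrix}$, $v_3=\begin{pmatrix}0&0\\1&0\end{pmatrix}$, and let $x_1,x_2,x_3$ be the dual basis of $V^*$. $\mathrm{SL}_2(F)$ acts on $V$ by $g\cdot v=gvg^{-1}$ with kernel $\{\pm I\}$; $G=\mathrm{SL}_2(F)/\{\pm I\}$, which is $\mathrm{SL}_2(F)$ when $q$ is even. $G$ acts on $V^*$ by $(g\cdot f)(v)=f(g^{-1}\cdot v)$, and on $R=S(V^* )=F[x_1,x_2,x_3]$ by algebra automorphisms; $R^G$ is the ring of invariants. $\Omega=\bigoplus_{i=0}^3\Omega^i$ with $\Omega^i=R\otimes\Lambda^i(V^* )$ is the algebra of differential forms, with multiplication the exterior product extended $R$-linearly, and the diagonal $G$-action $g\cdot(f\otimes w)=(g\cdot f)\otimes(g\cdot w)$. The $R$-basis of $\Omega^1$ corresponding to $x_1,x_2,x_3$ is written $\mathrm{d}x_1,\mathrm{d}x_2,\mathrm{d}x_3$, and for $f\in R$, $\mathrm{d}f=\sum_j \frac{\partial f}{\partial x_j}\mathrm{d}x_j$. $\Omega^G$ is the (bigraded) algebra of $G$-fixed points. A generating set is minimal if no element of it can be omitted. Polynomials: $f_1=x_1x_3-x_2^2$; $f_2=x_1^qx_3+x_1x_3^q-2x_2^{q+1}$ (so $f_2=x_1^qx_3+x_1x_3^q$ for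 $q$ even). Fix an irreducible quadratic $g(x)=x^2-\gamma x-\delta\in F[x]$ and let $$\tilde f_3=\prod_{\alpha\in F,\ \beta\in F^*}\left(x_1-\frac{2\alpha-\gamma}{\beta}x_2+\frac{g(\alpha)}{\beta^2}x_3\right);$$ $f_3\in R^G$ is the element with $f_3^2=\tilde f_3$ (it is known that such an element exists), of degree $\frac12q(q-1)$. For $q$ even, $$\omega=(x_2^qx_3+x_2x_3^q)\,\mathrm{d}x_1+(x_1^qx_3+x_1x_3^q)\,\mathrm{d}x_2+(x_1^qx_2+x_1x_2^q)\,\mathrm{d}x_3\in\Omega^1 .$$ For $\eta\in\Omega$, $f_2^{-1}\eta$ denotes the unique $\xi\in\Omega$ with $f_2\xi=\eta$ (the forms so written are divisible by $f_2$ in $\Omega$). *)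

theory Defs
  imports
    "HOL-Analysis.Determinants"
    "HOL-Computational_Algebra.Polynomial"
    "HOL-Library.Poly_Mapping"
begin

text \<open>
  A form is given by its coefficients with respect to the basis of the products
  \<open>dx i\<^sub>1 \<and> \<dots> \<and> dx i\<^sub>k\<close>, \<open>i\<^sub>1 < \<dots> < i\<^sub>k\<close>, indexed by the subsets \<open>{i\<^sub>1, \<dots>, i\<^sub>k}\<close> of the index type.
  The multiplication \<open>*\<close> of the ring instance below is the exterior product.
\<close>

typedef (overloaded) ('i, 'r) form = "UNIV :: ('i set \<Rightarrow> 'r) set"
  morphisms form_coeff Form ..

setup_lifting type_definition_form

lemma form_eqI: "(\<And>S. form_coeff f S = form_coeff g S) \<Longrightarrow> f = g"
  by (metis ext form_coeff_inject)

text \<open>The sign of the permutation sorting the concatenation of the increasing lists of \<open>A\<close> and \<open>B\<close>.\<close>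

definition shuffle_sign :: "'i::linorder set \<Rightarrow> 'i set \<Rightarrow> 'r::comm_ring_1"
  where "shuffle_sign A B = (- 1) ^ card {(i, j). i \<in> A \<and> j \<in> B \<and> j < i}"

lemma shuffle_sign_empty [simp]: "shuffle_sign {} B = 1" "shuffle_sign A {} = 1"
  by (simp_all add: shuffle_sign_def)

lemma shuffle_sign_Un_left:
  fixes A :: "'i::{finite,linorder} set"
  assumes "A \<inter> B = {}"
  shows "shuffle_sign (A \<union> B) C = shuffle_sign A C * shuffle_sign B C"
proof -
  have "{(i, j). i \<in> A \<union> B \<and> j \<in> C \<and> j < i}
      = {(i, j). i \<in> A \<and> j \<in> C \<and> j < i} \<union> {(i, j). i \<in> B \<and> j \<in> C \<and> j < i}" by auto
  moreover have "{(i, j). i \<in> A \<and> j \<in> C \<and> j < i} \<inter> {(i, j). i \<in> B \<and> j \<in> C \<and> j < i} = {}"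
    using assms by auto
  ultimately show ?thesis
    unfolding shuffle_sign_def by (simp add: card_Un_disjoint power_add)
qed

lemma shuffle_sign_Un_right:
  fixes A :: "'i::{finite,linorder} set"
  assumes "B \<inter> C = {}"
  shows "shuffle_sign A (B \<union> C) = shuffle_sign A B * shuffle_sign A C"
proof -
  have "{(i, j). i \<in> A \<and> j \<in> B \<union> C \<and> j < i}
      = {(i, j). i \<in> A \<and> j \<in> B \<and> j < i} \<union> {(i, j). i \<in> A \<and> j \<in> C \<and> j < i}" by auto
  moreover have "{(i, j). i \<in> A \<and> j \<in> B \<and> j < i} \<inter> {(i, j). i \<in> A \<and> j \<in> C \<and> j < i} = {}"
    using assms by auto
  ultimately show ?thesis
    unfolding shuffle_sign_def by (simp add: card_Un_disjoint power_add)
qed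

instantiation form :: ("{finite,linorder}", comm_ring_1) ring_1
begin

lift_definition zero_form :: "('a, 'b) form" is "\<lambda>_. 0" .

lift_definition one_form :: "('a, 'b) form" is "\<lambda>S. if S = {} then 1 else 0" .

lift_definition plus_form :: "('a, 'b) form \<Rightarrow> ('a, 'b) form \<Rightarrow> ('a, 'b) form"
  is "\<lambda>f g S. f S + g S" .

lift_definition minus_form :: "('a, 'b) form \<Rightarrow> ('a, 'b) form \<Rightarrow> ('a, 'b) form"
  is "\<lambda>f g S. f S - g S" .

lift_definition uminus_form :: "('a, 'b) form \<Rightarrow> ('a, 'b) form"
  is "\<lambda>f S. - f S" .

lift_definition times_form :: "('a, 'b) form \<Rightarrow> ('a, 'b) form \<Rightarrow> ('a, 'b) form"
  is "\<lambda>f g S. \<Sum>A\<in>Pow S. shuffle_sign A (S - A) * f A * g (S - A)" .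

instance
proof
  fix a b c :: "('a, 'b) form"
  show "a + b + c = a + (b + c)" by transfer (simp add: add.assoc)
  show "a + b = b + a" by transfer (simp add: add.commute)
  show "0 + a = a" by transfer simp
  show "- a + a = 0" by transfer simp
  show "a - b = a + - b" by transfer simp
  show "(0 :: ('a, 'b) form) \<noteq> 1"
    by transfer (auto dest: fun_cong [where x = "{}"])
  show "(a + b) * c = a * c + b * c"
    by transfer (simp add: algebra_simps sum.distrib)
  show "a * (b + c) = a * b + a * c"
    by transfer (simp add: algebra_simps sum.distrib)
  show "1 * a = a"
  proof (transfer, rule ext)
    fix a :: "'a set \<Rightarrow> 'b" and S :: "'a set"
    have "(\<Sum>A\<in>Pow S. shuffle_sign A (S - A) * (if A = {} then 1 else 0) * a (S - A))
        = (\<Sum>A\<in>Pow S. if A = {} then a S else 0)"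
      by (rule sum.cong) auto
    then show "(\<Sum>A\<in>Pow S. shuffle_sign A (S - A) * (if A = {} then 1 else 0) * a (S - A)) = a S"
      by (simp add: sum.delta)
  qed
  show "a * 1 = a"
  proof (transfer, rule ext)
    fix a :: "'a set \<Rightarrow> 'b" and S :: "'a set"
    have "(\<Sum>A\<in>Pow S. shuffle_sign A (S - A) * a A * (if S - A = {} then 1 else 0))
        = (\<Sum>A\<in>Pow S. if A = S then a S else 0)"
      by (rule sum.cong) auto
    then show "(\<Sum>A\<in>Pow S. shuffle_sign A (S - A) * a A * (if S - A = {} then 1 else 0)) = a S"
      by (simp add: sum.delta)
  qed
  show "a * b * c = a * (b * c)"
  proof (transfer, rule ext)
    fix f g h :: "'a set \<Rightarrow> 'b" and S :: "'a set"
    let ?s = "shuffle_sign :: 'a set \<Rightarrow> 'a set \<Rightarrow> 'b"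
    let ?l = "\<lambda>T A. ?s T (S - T) * (?s A (T - A) * f A * g (T - A)) * h (S - T)"
    let ?r = "\<lambda>A B. ?s A (S - A) * f A * (?s B (S - A - B) * g B * h (S - A - B))"
    have "(\<Sum>T\<in>Pow S. ?s T (S - T) * (\<Sum>A\<in>Pow T. ?s A (T - A) * f A * g (T - A)) * h (S - T))
        = (\<Sum>(T, A)\<in>Sigma (Pow S) Pow. ?l T A)"
      by (simp add: sum.Sigma sum_distrib_left sum_distrib_right)
    also have "\<dots> = (\<Sum>(A, B)\<in>Sigma (Pow S) (\<lambda>A. Pow (S - A)). ?r A B)"
    proof (rule sum.reindex_bij_witness [where
          j = "\<lambda>(T, A). (A, T - A)" and i = "\<lambda>(A, B). (A \<union> B, A)"], goal_cases)
      case (5 x)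
      obtain T A where x: "x = (T, A)" "T \<subseteq> S" "A \<subseteq> T" using 5 by auto
      have 1: "S - A = (T - A) \<union> (S - T)" "S - A - (T - A) = S - T" "T = A \<union> (T - A)"
        using x by auto
      have "?s A (S - A) = ?s A (T - A) * ?s A (S - T)"
        unfolding 1(1) by (rule shuffle_sign_Un_right) auto
      moreover have "?s T (S - T) = ?s A (S - T) * ?s (T - A) (S - T)"
        using shuffle_sign_Un_left [of A "T - A" "S - T"] 1(3) by fastforce
      ultimately show ?case using x 1(2) by (simp add: algebra_simps)
    qed auto
    also have "\<dots> = (\<Sum>A\<in>Pow S. ?s A (S - A) * f A *
        (\<Sum>B\<in>Pow (S - A). ?s B (S - A - B) * g B * h (S - A - B)))"
      by (simp add: sum.Sigma sum_distrib_left)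
    finally show "(\<Sum>T\<in>Pow S. ?s T (S - T) * (\<Sum>A\<in>Pow T. ?s A (T - A) * f A * g (T - A)) * h (S - T))
        = (\<Sum>A\<in>Pow S. ?s A (S - A) * f A *
        (\<Sum>B\<in>Pow (S - A). ?s B (S - A - B) * g B * h (S - A - B)))" .
  qed
qed

end

lift_definition scalar :: "'r::zero \<Rightarrow> ('i, 'r) form"
  is "\<lambda>r S. if S = {} then r else 0" .

lift_definition dx :: "'i \<Rightarrow> ('i, 'r::zero_neq_one) form"
  is "\<lambda>i S. if S = {i} then 1 else 0" .

lemma dx_square: "dx i * dx i = (0 :: ('i::{finite,linorder}, 'r::comm_ring_1) form)"
proof (transfer, rule ext)
  fix i :: 'i and S :: "'i set"
  show "(\<Sum>A\<in>Pow S. shuffle_sign A (S - A) * (if A = {i} then 1 else 0) *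
      (if S - A = {i} then 1 else 0)) = (0 :: 'r)"
    by (rule sum.neutral) auto
qed

lemma dx_anticommute:
  assumes "i \<noteq> j"
  shows "dx i * dx j = - (dx j * dx i :: ('i::{finite,linorder}, 'r::comm_ring_1) form)"
proof (rule form_eqI)
  have prod: "form_coeff (dx k * dx l :: ('i, 'r) form) S
      = (if S = {k, l} then shuffle_sign {k} {l} else 0)" if "k \<noteq> l" for k l S
  proof -
    have "form_coeff (dx k * dx l :: ('i, 'r) form) S
        = (\<Sum>A\<in>Pow S. if A = {k} \<and> S = {k, l} then shuffle_sign {k} {l} else 0)"
      using that unfolding times_form.rep_eq dx.rep_eq
      by (intro sum.cong) auto
    then show ?thesis by (cases "S = {k, l}") (simp_all add: sum.delta)
  qed
  have "shuffle_sign {k} {l} = (if l < k then - 1 else 1 :: 'r)" for k l :: 'i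
  proof -
    have "{(i, j). i \<in> {k} \<and> j \<in> {l} \<and> j < i} = (if l < k then {(k, l)} else {})" by auto
    then show ?thesis by (simp add: shuffle_sign_def)
  qed
  then show "form_coeff (dx i * dx j :: ('i, 'r) form) S
      = form_coeff (- (dx j * dx i) :: ('i, 'r) form) S" for S
    using assms by (auto simp: prod uminus_form.rep_eq insert_commute)
qed

text \<open>
  In the index type \<open>3\<close> the numeral \<open>3\<close> denotes \<open>0\<close>, so its order is \<open>3 < 1 < 2\<close>. This only affects which
  signed representatives \<open>form_coeff\<close> uses as basis.
\<close>

type_synonym 'a mpoly3 = "(3 \<Rightarrow>\<^sub>0 nat) \<Rightarrow>\<^sub>0 'a"

type_synonym 'a dform = "(3, 'a mpoly3) form"

definition Const :: "'a::zero \<Rightarrow> 'a mpoly3"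
  where "Const c = Poly_Mapping.single 0 c"

definition X :: "3 \<Rightarrow> 'a::zero_neq_one mpoly3"
  where "X i = Poly_Mapping.single (Poly_Mapping.single i 1) 1"

definition poly_subst :: "('a::comm_ring_1 \<Rightarrow> 'b::comm_ring_1) \<Rightarrow> (3 \<Rightarrow> 'b) \<Rightarrow> 'a mpoly3 \<Rightarrow> 'b"
  where "poly_subst c y p = (\<Sum>m\<in>Poly_Mapping.keys p.
    c (Poly_Mapping.lookup p m) * (\<Prod>i\<in>UNIV. y i ^ Poly_Mapping.lookup m i))"

definition partial :: "3 \<Rightarrow> 'a::comm_ring_1 mpoly3 \<Rightarrow> 'a mpoly3"
  where "partial j p = (\<Sum>m\<in>Poly_Mapping.keys p.
    Poly_Mapping.single (m - Poly_Mapping.single j 1)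
      (of_nat (Poly_Mapping.lookup m j) * Poly_Mapping.lookup p m))"

definition d :: "'a::comm_ring_1 mpoly3 \<Rightarrow> 'a dform"
  where "d f = (\<Sum>j\<in>UNIV. scalar (partial j f) * dx j)"

text \<open>Over a field, a quotient by a nonzero \<open>f\<close> is unique whenever it exists.\<close>

definition form_div :: "'a::comm_ring_1 mpoly3 \<Rightarrow> 'a dform \<Rightarrow> 'a dform"
  where "form_div f \<eta> = (THE \<xi>. scalar f * \<xi> = \<eta>)"

definition SL2 :: "('a::field^2^2) set"
  where "SL2 = {g. det g = 1}"

definition conj_act :: "'a::field^2^2 \<Rightarrow> 'a^2^2 \<Rightarrow> 'a^2^2"
  where "conj_act g v = g ** v ** matrix_inv g"

definition mat22 :: "'a \<Rightarrow> 'a \<Rightarrow> 'a \<Rightarrow> 'a \<Rightarrow> 'a^2^2"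
  where "mat22 a b c e = (\<chi> i j. if i = 1 then (if j = 1 then a else b) else (if j = 1 then c else e))"

definition basis_V :: "3 \<Rightarrow> 'a::field^2^2"
  where "basis_V i =
    (if i = 1 then mat22 0 (- 1) 0 0 else if i = 2 then mat22 1 0 0 (- 1) else mat22 0 0 1 0)"

definition coord_V :: "3 \<Rightarrow> 'a::field^2^2 \<Rightarrow> 'a"
  where "coord_V i v = (if i = 1 then - (v$1$2) else if i = 2 then v$1$1 else v$2$1)"

lemma coord_V_dual: "coord_V i (basis_V j) = (if i = j then 1 else 0)"
  using exhaust_3 [of i] exhaust_3 [of j] by (auto simp: coord_V_def basis_V_def mat22_def)

lemma coord_V_expand:
  assumes "trace v = 0"
  shows "v = (\<chi> r s. \<Sum>i\<in>UNIV. coord_V i v * basis_V i $ r $ s)"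
proof -
  have "v$2$2 = - (v$1$1)"
    using assms by (simp add: trace_def sum_2 eq_neg_iff_add_eq_0 add.commute)
  then show ?thesis
    by (simp add: vec_eq_iff forall_2 sum_3 coord_V_def basis_V_def mat22_def)
qed

text \<open>The coefficient of \<open>x\<^sub>j\<close> in \<open>g \<cdot> x\<^sub>i\<close>, where \<open>(g \<cdot> x\<^sub>i) v = x\<^sub>i (g\<^sup>-\<^sup>1 \<cdot> v)\<close>.\<close>

definition dual_coeff :: "'a::field^2^2 \<Rightarrow> 3 \<Rightarrow> 3 \<Rightarrow> 'a"
  where "dual_coeff g i j = coord_V i (conj_act (matrix_inv g) (basis_V j))"

definition act_poly :: "'a::field^2^2 \<Rightarrow> 'a mpoly3 \<Rightarrow> 'a mpoly3"
  where "act_poly g = poly_subst Const (\<lambda>i. \<Sum>j\<in>UNIV. Const (dual_coeff g i j) * X j)"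

definition act_form :: "'a::field^2^2 \<Rightarrow> 'a dform \<Rightarrow> 'a dform"
  where "act_form g \<eta> = (\<Sum>S\<in>UNIV. scalar (act_poly g (form_coeff \<eta> S)) *
    prod_list (map (\<lambda>i. \<Sum>j\<in>UNIV. scalar (Const (dual_coeff g i j)) * dx j) (sorted_list_of_set S)))"

text \<open>
  As \<open>\<pm> I\<close> acts trivially, the invariants of \<open>SL\<^sub>2(F) / {\<pm> I}\<close> are those of \<open>SL\<^sub>2(F)\<close>.
\<close>

definition invariant_polys :: "'a::field mpoly3 set"
  where "invariant_polys = {f. \<forall>g\<in>SL2. act_poly g f = f}"

definition invariant_forms :: "'a::field dform set"
  where "invariant_forms = {\<eta>. \<forall>g\<in>SL2. act_form g \<eta> = \<eta>}"

inductive_set algebra_span :: "'a::field dform set \<Rightarrow> 'a dform set" for S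
  where
    const: "scalar (Const c) \<in> algebra_span S"
  | gen: "\<eta> \<in> S \<Longrightarrow> \<eta> \<in> algebra_span S"
  | add: "\<eta> \<in> algebra_span S \<Longrightarrow> \<theta> \<in> algebra_span S \<Longrightarrow> \<eta> + \<theta> \<in> algebra_span S"
  | mult: "\<eta> \<in> algebra_span S \<Longrightarrow> \<theta> \<in> algebra_span S \<Longrightarrow> \<eta> * \<theta> \<in> algebra_span S"

definition minimal_generating_set :: "'a::field dform set \<Rightarrow> 'a dform set \<Rightarrow> bool"
  where "minimal_generating_set S A \<longleftrightarrow>
    algebra_span S = A \<and> (\<forall>\<eta>\<in>S. algebra_span (S - {\<eta>}) \<noteq> A)"

definition f1 :: "'a::{field,finite} mpoly3"
  where "f1 = X 1 * X 3 - X 2 ^ 2"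

definition f2 :: "'a::{field,finite} mpoly3"
  where "f2 = X 1 ^ CARD('a) * X 3 + X 1 * X 3 ^ CARD('a) - 2 * X 2 ^ (CARD('a) + 1)"

definition f3_tilde :: "'a::{field,finite} \<Rightarrow> 'a \<Rightarrow> 'a mpoly3"
  where "f3_tilde \<gamma> \<delta> = (\<Prod>\<alpha>\<in>UNIV. \<Prod>\<beta>\<in>UNIV - {0}.
    X 1 - Const ((2 * \<alpha> - \<gamma>) / \<beta>) * X 2 + Const (poly [:- \<delta>, - \<gamma>, 1:] \<alpha> / \<beta>\<^sup>2) * X 3)"

text \<open>
  The description determines \<open>f3\<close> uniquely only in characteristic \<open>2\<close>, where square roots are unique.
\<close>

definition f3 :: "'a::{field,finite} \<Rightarrow> 'a \<Rightarrow> 'a mpoly3"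
  where "f3 \<gamma> \<delta> = (THE f. f \<in> invariant_polys \<and> f\<^sup>2 = f3_tilde \<gamma> \<delta>)"

definition omega :: "'a::{field,finite} dform"
  where "omega =
      scalar (X 2 ^ CARD('a) * X 3 + X 2 * X 3 ^ CARD('a)) * dx 1
    + scalar (X 1 ^ CARD('a) * X 3 + X 1 * X 3 ^ CARD('a)) * dx 2
    + scalar (X 1 ^ CARD('a) * X 2 + X 1 * X 2 ^ CARD('a)) * dx 3"

end

theory Submission
  imports Defs
begin

text \<open>
  In characteristic \<open>2\<close> exterior multiplication is commutative, and \<open>g\<^sup>-\<^sup>1 = ((a, b), (c, e))\<close> acts by
  \<open>x\<^sub>1 \<mapsto> a\<^sup>2x\<^sub>1 + b\<^sup>2x\<^sub>3\<close>, \<open>x\<^sub>2 \<mapsto> x\<^sub>2 + acx\<^sub>1 + bex\<^sub>3\<close>, \<open>x\<^sub>3 \<mapsto> c\<^sup>2x\<^sub>1 + e\<^sup>2x\<^sub>3\<close>. As \<open>f2\<close> is the product of the linear forms in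
  \<open>x\<^sub>1, x\<^sub>3\<close> up to scalars, and these are permuted transitively, an invariant divisible by \<open>x\<^sub>1\<close> is
  divisible by \<open>f2\<close>.

  Polynomials: the restriction of an invariant to \<open>x\<^sub>1 = 0\<close> is a polynomial in \<open>x\<^sub>2\<^sup>2\<close> and
  \<open>x\<^sub>2\<^sup>N + x\<^sub>3\<^sup>N\<close> with \<open>N = q(q - 1)/2\<close>, the restrictions of \<open>f1\<close> and \<open>f3\<close>. Subtracting the
  corresponding polynomial in \<open>f1, f3\<close> leaves a multiple of \<open>f2\<close>, and induction on the degree shows that
  the ring of invariants is generated by \<open>f1, f2, f3\<close>.

  Forms: \<open>d f1, d f2, \<omega>\<close> and the three quotients of their products by \<open>f2\<close> are dual bases up to the factor
  \<open>f2\<close>, so the coefficients of an invariant form are wedge products with basis elements divided by \<open>f2\<close>.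
  That these products are divisible by \<open>x\<^sub>1\<close>, hence by \<open>f2\<close>, follows by comparing a form modulo \<open>x\<^sub>1\<close> with its
  image under the transvections fixing \<open>x\<^sub>1\<close>; this needs two nonzero parameters, that is \<open>q > 2\<close>. For
  \<open>q = 2\<close> the form \<open>d f3\<close> has constant coefficients and replaces \<open>\<omega>\<close>.
\<close>

subsection \<open>Evaluation homomorphisms\<close>

text \<open>The transvections fixing \<open>x\<^sub>1\<close> act trivially modulo
  \<open>x\<^sub>1\<close>, so restricted to \<open>x\<^sub>1 = 0\<close> they impose no visible
  condition; only the diagonal matrices do. Their constraint is recovered from higher order in
  \<open>x\<^sub>1\<close>: on \<open>x\<^sub>1 = s\<^sup>2\<close> the transvections become
  \<open>q\<close> roots \<open>w = t s\<close> of one polynomial in \<open>w\<close>, and a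
  comparison modulo \<open>x\<^sub>1\<^sup>2\<close> removes the odd powers of
  \<open>x\<^sub>2\<close>. This explains the factors of \<open>N\<close>: \<open>q/2\<close> comes
  from the transvections, \<open>q - 1\<close> from the diagonal matrices.

  The square root of \<open>f3_tilde\<close> is made explicit. Up to constants its factors are
  \<open>a x\<^sub>1 + x\<^sub>2 + c x\<^sub>3\<close> with
  \<open>a Z\<^sup>2 + Z T + c T\<^sup>2\<close> an irreducible binary quadratic form, each
  occurring twice; linear substitutions of determinant one permute these forms, whence the
  invariance.

  Minimality uses no count of degrees. Each generator is separated from the others by a property
  that is closed under sums and products, holds for constants and for all other generators, and
  fails for the generator itself.\<close>

lemma single_induct [case_names zero add]:
  fixes p :: "'b \<Rightarrow>\<^sub>0 'a::comm_monoid_add"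
  assumes "P 0" "\<And>p m r. P p \<Longrightarrow> P (p + Poly_Mapping.single m r)"
  shows "P p"
proof (induction p rule: update_induct)
  case (update f a b)
  have "Poly_Mapping.update a b f = f + Poly_Mapping.single a b"
    using update(1) by (intro poly_mapping_eqI)
      (auto simp: lookup_update lookup_add lookup_single in_keys_iff when_def)
  then show ?case using update(3) assms(2) by simp
qed (use assms in simp)

lemma X_power: "X i ^ n = (Poly_Mapping.single (Poly_Mapping.single i n) 1 :: 'a::comm_ring_1 mpoly3)"
  by (induction n) (simp_all add: X_def mult_single flip: single_add)

lemma mpoly_induct [case_names const add mult X]:
  fixes p :: "'a::comm_ring_1 mpoly3"
  assumes const: "\<And>c. P (Const c)"
    and add: "\<And>p q. P p \<Longrightarrow> P q \<Longrightarrow> P (p + q)"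
    and mult: "\<And>p q. P p \<Longrightarrow> P q \<Longrightarrow> P (p * q)"
    and X: "\<And>i. P (X i)"
  shows "P p"
proof -
  have pow: "P (p ^ n)" if "P p" for p n
    by (induction n) (use that const [of 1] in \<open>auto intro: mult simp: Const_def\<close>)
  have mono: "P (Poly_Mapping.single m 1)" for m :: "3 \<Rightarrow>\<^sub>0 nat"
  proof -
    have "m = Poly_Mapping.single 1 (Poly_Mapping.lookup m 1) + Poly_Mapping.single 2 (Poly_Mapping.lookup m 2)
        + Poly_Mapping.single 3 (Poly_Mapping.lookup m 3)" (is "_ = ?m")
    proof (rule poly_mapping_eqI)
      fix i show "Poly_Mapping.lookup m i = Poly_Mapping.lookup ?m i"
        using exhaust_3 [of i] by (auto simp: lookup_add lookup_single when_def)
    qed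
    then have "Poly_Mapping.single m 1
        = X 1 ^ Poly_Mapping.lookup m 1 * X 2 ^ Poly_Mapping.lookup m 2 * (X 3 ^ Poly_Mapping.lookup m 3 :: 'a mpoly3)"
      by (simp add: X_power mult_single)
    then show ?thesis by (simp add: pow mult X)
  qed
  have single: "P (Poly_Mapping.single m c)" for m c
    using mult [OF const [of c] mono [of m]] by (simp add: Const_def mult_single)
  show ?thesis
    by (induction p rule: single_induct) (use assms(1) [of 0] in \<open>simp_all add: Const_def add single\<close>)
qed

text \<open>Substitution is needed with three targets: \<open>mpoly3\<close> itself, polynomials in
  a further variable over \<open>mpoly3\<close>, and univariate polynomials over the field. The
  coefficient map is a parameter so that one set of rules serves all three.\<close>

locale ring_hom_like =
  fixes c :: "'a::comm_ring_1 \<Rightarrow> 'b::comm_ring_1"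
  assumes zero [simp]: "c 0 = 0" and one [simp]: "c 1 = 1"
    and add: "c (x + y) = c x + c y" and mult: "c (x * y) = c x * c y"
begin

lemma poly_subst_superset:
  assumes "finite K" "Poly_Mapping.keys p \<subseteq> K"
  shows "poly_subst c y p = (\<Sum>m\<in>K. c (Poly_Mapping.lookup p m) * (\<Prod>i\<in>UNIV. y i ^ Poly_Mapping.lookup m i))"
  unfolding poly_subst_def using assms by (intro sum.mono_neutral_left) (auto simp: in_keys_iff)

lemma poly_subst_add: "poly_subst c y (p + q) = poly_subst c y p + poly_subst c y q"
proof -
  let ?K = "Poly_Mapping.keys p \<union> Poly_Mapping.keys q"
  have "Poly_Mapping.keys (p + q) \<subseteq> ?K" by (rule keys_add)
  then show ?thesis
    by (simp add: poly_subst_superset [of ?K] lookup_add add distrib_right sum.distrib)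
qed

lemma poly_subst_single:
  "poly_subst c y (Poly_Mapping.single m r) = c r * (\<Prod>i\<in>UNIV. y i ^ Poly_Mapping.lookup m i)"
  by (subst poly_subst_superset [of "{m}"]) auto

lemma poly_subst_Const [simp]: "poly_subst c y (Const r) = c r"
  by (simp add: Const_def poly_subst_single)

lemma poly_subst_0 [simp]: "poly_subst c y 0 = 0"
  by (simp add: poly_subst_def)

lemma poly_subst_1 [simp]: "poly_subst c y 1 = 1"
  using poly_subst_Const [of y 1] by (simp add: Const_def)

lemma poly_subst_X [simp]: "poly_subst c y (X i) = y i"
proof -
  have "(\<Prod>j\<in>UNIV. y j ^ Poly_Mapping.lookup (Poly_Mapping.single i 1) j) = (\<Prod>j\<in>UNIV. if j = i then y j else 1)"
    by (rule prod.cong) (auto simp: lookup_single when_def)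
  then show ?thesis by (simp add: X_def poly_subst_single)
qed

lemma poly_subst_mult: "poly_subst c y (p * q) = poly_subst c y p * poly_subst c y q"
proof (induction p rule: single_induct)
  case (add p m r)
  have "poly_subst c y (Poly_Mapping.single m r * q)
      = poly_subst c y (Poly_Mapping.single m r) * poly_subst c y q"
    by (induction q rule: single_induct)
      (simp_all add: poly_subst_add poly_subst_single mult_single distrib_left mult lookup_add
        power_add prod.distrib mult_ac)
  then show ?case using add.IH by (simp add: distrib_right poly_subst_add)
qed simp

lemma poly_subst_uminus: "poly_subst c y (- p) = - poly_subst c y p"
  using poly_subst_add [of y p "- p"] by (simp add: eq_neg_iff_add_eq_0 add.commute)

lemma poly_subst_diff: "poly_subst c y (p - q) = poly_subst c y p - poly_subst c y q"
  using poly_subst_add [of y p "- q"] by (simp add: poly_subst_uminus)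

lemma poly_subst_power: "poly_subst c y (p ^ n) = poly_subst c y p ^ n"
  by (induction n) (simp_all add: poly_subst_mult)

lemma poly_subst_sum: "poly_subst c y (sum f A) = (\<Sum>a\<in>A. poly_subst c y (f a))"
  by (induction A rule: infinite_finite_induct) (simp_all add: poly_subst_add)

lemma poly_subst_prod: "poly_subst c y (prod f A) = (\<Prod>a\<in>A. poly_subst c y (f a))"
  by (induction A rule: infinite_finite_induct) (simp_all add: poly_subst_mult)

lemmas poly_subst_simps = poly_subst_add poly_subst_mult poly_subst_diff poly_subst_uminus
  poly_subst_power poly_subst_sum poly_subst_prod

text \<open>Congruence modulo \<open>z\<close> is compatible with sums and products. It is applied
  with \<open>z\<close> a power of \<open>X 1\<close>, another linear form, or a power of the extra
  polynomial variable.\<close>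

lemma dvd_poly_subst_diff:
  assumes "\<And>i. z dvd y i - y' i"
  shows "z dvd poly_subst c y p - poly_subst c y' p"
proof (induction p rule: mpoly_induct)
  case (add p q)
  then have "z dvd (poly_subst c y p - poly_subst c y' p) + (poly_subst c y q - poly_subst c y' q)"
    by (rule dvd_add)
  then show ?case by (simp add: poly_subst_simps algebra_simps)
next
  case (mult p q)
  have "z dvd (poly_subst c y p - poly_subst c y' p) * poly_subst c y q
      + poly_subst c y' p * (poly_subst c y q - poly_subst c y' q)"
    using mult by (intro dvd_add dvd_mult dvd_mult2)
  then show ?case by (simp add: poly_subst_simps algebra_simps)
qed (use assms in simp_all)

end

lemma Const_0 [simp]: "Const 0 = 0" and Const_1 [simp]: "Const 1 = 1"
  by (simp_all add: Const_def)

lemma Const_add: "Const (x + y) = Const x + Const y"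
  by (simp add: Const_def single_add)

lemma Const_mult: "Const (x * y) = Const x * Const (y::'a::comm_ring_1)"
  by (simp add: Const_def mult_single)

lemma Const_power: "Const (x ^ n) = Const (x::'a::comm_ring_1) ^ n"
  by (induction n) (simp_all add: Const_mult)

lemma Const_prod: "Const (prod f A) = (\<Prod>a\<in>A. Const (f a :: 'a::comm_ring_1))"
  by (induction A rule: infinite_finite_induct) (simp_all add: Const_mult)

lemma Const_eq_iff [simp]: "Const x = Const y \<longleftrightarrow> x = y"
  by (metis Const_def lookup_single_eq)

lemma Const_eq_0_iff [simp]: "Const x = 0 \<longleftrightarrow> x = 0"
  using Const_eq_iff [of x 0] by simp

interpretation Const: ring_hom_like "Const :: 'a::comm_ring_1 \<Rightarrow> 'a mpoly3"
  by unfold_locales (simp_all add: Const_add Const_mult)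

interpretation cpoly: ring_hom_like "\<lambda>c::'a::comm_ring_1. [:Const c:] :: 'a mpoly3 poly"
  by unfold_locales (simp_all add: Const_add Const_mult one_pCons)

interpretation upoly: ring_hom_like "\<lambda>c::'a::comm_ring_1. [:c:] :: 'a poly"
  by unfold_locales (simp_all add: one_pCons)

lemma (in ring_hom_like) poly_subst_comp:
  "poly_subst c y (poly_subst Const z p) = poly_subst c (\<lambda>i. poly_subst c y (z i)) p"
  by (induction p rule: mpoly_induct) (simp_all add: poly_subst_simps Const.poly_subst_simps)

lemma poly_subst_Const_X [simp]: "poly_subst Const X p = p"
  by (induction p rule: mpoly_induct) (simp_all add: Const.poly_subst_simps)

lemma poly_subst_cong: "(\<And>i. y i = z i) \<Longrightarrow> poly_subst c y p = poly_subst c z p"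
  by (simp add: poly_subst_def)

definition vec3 :: "'b \<Rightarrow> 'b \<Rightarrow> 'b \<Rightarrow> 3 \<Rightarrow> 'b"
  where "vec3 u v w i = (if i = 1 then u else if i = 2 then v else w)"

lemma vec3_simps [simp]: "vec3 u v w 1 = u" "vec3 u v w 2 = v" "vec3 u v w 3 = w" "vec3 u v w 0 = w"
  by (simp_all add: vec3_def)

lemma vec3_eta: "vec3 (h 1) (h 2) (h 3) = h"
  using exhaust_3 by (auto simp: vec3_def fun_eq_iff)

abbreviation sub :: "'a::comm_ring_1 mpoly3 \<Rightarrow> 'a mpoly3 \<Rightarrow> 'a mpoly3 \<Rightarrow> 'a mpoly3 \<Rightarrow> 'a mpoly3"
  where "sub u v w \<equiv> poly_subst Const (vec3 u v w)"

lemma sub_comp: "sub u v w (sub u' v' w' p) = sub (sub u v w u') (sub u v w v') (sub u v w w') p"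
proof -
  have "(\<lambda>i. sub u v w (vec3 u' v' w' i)) = vec3 (sub u v w u') (sub u v w v') (sub u v w w')"
    by (auto simp: vec3_def)
  then show ?thesis by (simp add: Const.poly_subst_comp)
qed

lemma sub_id: "sub (X 1) (X 2) (X 3) p = p"
  by (simp add: vec3_eta)

lemma sub_dvd:
  assumes "z dvd u - u'" "z dvd v - v'" "z dvd w - w'"
  shows "z dvd sub u v w p - sub u' v' w' p"
  by (rule Const.dvd_poly_subst_diff) (use assms in \<open>simp add: vec3_def\<close>)

lemma X_neq_0 [simp]: "X i \<noteq> (0 :: 'a::comm_ring_1 mpoly3)"
  by (metis X_def single_zero inj_single zero_neq_one lookup_single_eq lookup_zero)

lemma X1_dvd_iff: "X 1 dvd p \<longleftrightarrow> sub 0 (X 2) (X 3) p = 0"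
proof
  assume "X 1 dvd p"
  then show "sub 0 (X 2) (X 3) p = 0" by (auto simp: dvd_def Const.poly_subst_simps)
next
  assume "sub 0 (X 2) (X 3) p = 0"
  moreover have "X 1 dvd sub (X 1) (X 2) (X 3) p - sub 0 (X 2) (X 3) p"
    by (rule sub_dvd) auto
  ultimately show "X 1 dvd p" by (simp add: sub_id)
qed

subsection \<open>Forms in characteristic two\<close>

lemma char_two_simps:
  assumes "(1::'b::comm_ring_1) + 1 = 0"
  shows "x + x = (0::'b)" "x + (x + y) = (y::'b)" "- x = (x::'b)" "x - y = (x + y::'b)"
proof -
  show *: "x + x = (0::'b)" for x
  proof -
    have "x + x = x * (1 + 1)" by (simp only: distrib_left mult_1_right)
    then show ?thesis by (simp only: assms mult_zero_right)
  qed
  show "x + (x + y) = (y::'b)" by (simp only: add.assoc [symmetric] * add_0_left)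
  show **: "- x = (x::'b)" for x by (rule minus_unique [OF *])
  show "x - y = (x + y::'b)" by (simp only: diff_conv_add_uminus **)
qed

text \<open>The basis of \<open>form_coeff\<close> agrees with the products \<open>dx i dx j\<close>, \<open>i < j\<close>, of the usual order only up to sign,
  which does not matter in characteristic \<open>2\<close>.\<close>

definition form8 :: "'r \<Rightarrow> 'r \<Rightarrow> 'r \<Rightarrow> 'r \<Rightarrow> 'r \<Rightarrow> 'r \<Rightarrow> 'r \<Rightarrow> 'r \<Rightarrow> (3, 'r) form" where
  "form8 a0 a1 a2 a3 a12 a13 a23 a123 = Form (\<lambda>S.
     if S = {} then a0 else if S = {1} then a1 else if S = {2} then a2 else if S = {3} then a3
     else if S = {1,2} then a12 else if S = {1,3} then a13 else if S = {2,3} then a23 else a123)"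

lemma set3_cases: "(S::3 set) \<in> {{}, {1}, {2}, {3}, {1,2}, {1,3}, {2,3}, {1,2,3}}"
proof -
  have *: "S = (if 1 \<in> S then {1} else {}) \<union> (if 2 \<in> S then {2} else {}) \<union> (if 3 \<in> S then {3} else {})"
    (is "S = ?T")
  proof (rule set_eqI)
    fix x show "x \<in> S \<longleftrightarrow> x \<in> ?T"
      using exhaust_3 [of x] by auto
  qed
  show ?thesis
    by (subst *, cases "1 \<in> S"; cases "2 \<in> S"; cases "3 \<in> S"; simp add: insert_commute)
qed

lemma UNIV_set3: "(UNIV :: 3 set set) = {{}, {1}, {2}, {3}, {1,2}, {1,3}, {2,3}, {1,2,3}}"
  by (rule UNIV_eq_I) (rule set3_cases)

lemma set3_neq: "{1,2} \<noteq> {1,3::3}" "{1,2} \<noteq> {2,3::3}" "{1,3} \<noteq> {2,3::3}"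
   "{1,2} \<noteq> {1,2,3::3}" "{1,3} \<noteq> {1,2,3::3}" "{2,3} \<noteq> {1,2,3::3}"
   "{1,2} \<noteq> {1::3}" "{1,2} \<noteq> {2::3}" "{1,2} \<noteq> {3::3}" "{1,3} \<noteq> {1::3}" "{1,3} \<noteq> {2::3}" "{1,3} \<noteq> {3::3}"
   "{2,3} \<noteq> {1::3}" "{2,3} \<noteq> {2::3}" "{2,3} \<noteq> {3::3}"
   "{1,2,3} \<noteq> {1::3}" "{1,2,3} \<noteq> {2::3}" "{1,2,3} \<noteq> {3::3}"
  by (simp_all add: set_eq_subset)

lemmas set3_neqs = set3_neq set3_neq [symmetric]

lemma form_coeff_form8 [simp]:
  "form_coeff (form8 a0 a1 a2 a3 a12 a13 a23 a123) {} = a0"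
  "form_coeff (form8 a0 a1 a2 a3 a12 a13 a23 a123) {1} = a1"
  "form_coeff (form8 a0 a1 a2 a3 a12 a13 a23 a123) {2} = a2"
  "form_coeff (form8 a0 a1 a2 a3 a12 a13 a23 a123) {3} = a3"
  "form_coeff (form8 a0 a1 a2 a3 a12 a13 a23 a123) {1,2} = a12"
  "form_coeff (form8 a0 a1 a2 a3 a12 a13 a23 a123) {1,3} = a13"
  "form_coeff (form8 a0 a1 a2 a3 a12 a13 a23 a123) {2,3} = a23"
  "form_coeff (form8 a0 a1 a2 a3 a12 a13 a23 a123) {1,2,3} = a123"
  by (simp_all add: form8_def Form_inverse set3_neqs)

lemma form8_eqI:
  assumes "form_coeff f {} = form_coeff g {}" "form_coeff f {1} = form_coeff g {1}"
    "form_coeff f {2} = form_coeff g {2}" "form_coeff f {3} = form_coeff g {3}"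
    "form_coeff f {1,2} = form_coeff g {1,2}" "form_coeff f {1,3} = form_coeff g {1,3}"
    "form_coeff f {2,3} = form_coeff g {2,3}" "form_coeff f {1,2,3} = form_coeff g {1,2,3}"
  shows "f = (g :: (3, 'r) form)"
proof (rule form_eqI)
  fix S show "form_coeff f S = form_coeff g S"
    using set3_cases [of S] assms by auto
qed

lemma form8_eta: "form8 (form_coeff f {}) (form_coeff f {1}) (form_coeff f {2}) (form_coeff f {3})
   (form_coeff f {1,2}) (form_coeff f {1,3}) (form_coeff f {2,3}) (form_coeff f {1,2,3}) = f"
  by (rule form8_eqI) simp_all

lemma form8_cases:
  obtains a0 a1 a2 a3 a12 a13 a23 a123 where "f = form8 a0 a1 a2 a3 a12 a13 a23 a123"
  using form8_eta [of f] by metis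

lemma form8_eq_iff [simp]: "form8 a0 a1 a2 a3 a12 a13 a23 a123 = form8 b0 b1 b2 b3 b12 b13 b23 b123
   \<longleftrightarrow> a0 = b0 \<and> a1 = b1 \<and> a2 = b2 \<and> a3 = b3 \<and> a12 = b12 \<and> a13 = b13 \<and> a23 = b23 \<and> a123 = b123"
  by (metis form_coeff_form8)

lemma form8_add: "form8 a0 a1 a2 a3 a12 a13 a23 a123 + form8 b0 b1 b2 b3 b12 b13 b23 b123
   = (form8 (a0 + b0) (a1 + b1) (a2 + b2) (a3 + b3) (a12 + b12) (a13 + b13) (a23 + b23) (a123 + b123) :: (3, 'r::comm_ring_1) form)"
  by (rule form8_eqI) (simp_all add: plus_form.rep_eq)

lemma scalar_form8: "scalar p = form8 p 0 0 0 0 0 0 0"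
  and one_form8: "1 = form8 (1::'r::comm_ring_1) 0 0 0 0 0 0 0"
  and zero_form8: "0 = form8 (0::'r) 0 0 0 0 0 0 0"
  and dx_form8: "dx 1 = form8 0 (1::'r) 0 0 0 0 0 0" "dx 2 = form8 0 0 (1::'r) 0 0 0 0 0"
    "dx 3 = form8 0 0 0 (1::'r) 0 0 0 0"
  by (rule form8_eqI; simp add: scalar.rep_eq one_form.rep_eq zero_form.rep_eq dx.rep_eq set3_neqs)+

lemma Pow3I:
  assumes "\<forall>S\<in>{{}, {1}, {2}, {3}, {1,2}, {1,3}, {2,3}, {1,2,3::3}}. S \<subseteq> A \<longleftrightarrow> S \<in> B"
  shows "Pow A = B"
proof (rule set_eqI)
  fix S show "S \<in> Pow A \<longleftrightarrow> S \<in> B" using bspec [OF assms set3_cases [of S]] by simp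
qed

lemma Pow3: "Pow {1::3} = {{}, {1}}" "Pow {2::3} = {{}, {2}}" "Pow {3::3} = {{}, {3}}"
  "Pow {1,2::3} = {{}, {1}, {2}, {1,2}}" "Pow {1,3::3} = {{}, {1}, {3}, {1,3}}"
  "Pow {2,3::3} = {{}, {2}, {3}, {2,3}}"
  "Pow {1,2,3::3} = {{}, {1}, {2}, {3}, {1,2}, {1,3}, {2,3}, {1,2,3}}"
  by (rule Pow3I, simp add: set3_neqs)+

lemma form8_mult:
  fixes a0 :: "'r::comm_ring_1"
  assumes "(1::'r) + 1 = 0"
  shows "form8 a0 a1 a2 a3 a12 a13 a23 a123 * form8 b0 b1 b2 b3 b12 b13 b23 b123
   = form8 (a0 * b0) (a0 * b1 + a1 * b0) (a0 * b2 + a2 * b0) (a0 * b3 + a3 * b0)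
       (a0 * b12 + a1 * b2 + a2 * b1 + a12 * b0)
       (a0 * b13 + a1 * b3 + a3 * b1 + a13 * b0)
       (a0 * b23 + a2 * b3 + a3 * b2 + a23 * b0)
       (a0 * b123 + a1 * b23 + a2 * b13 + a3 * b12 + a12 * b3 + a13 * b2 + a23 * b1 + a123 * b0)"
proof -
  \<comment> \<open>Every sign is a power of \<open>-1 = 1\<close>, so the unusual order of the
    index type has no influence.\<close>
  have "shuffle_sign A B = (1::'r)" for A B :: "3 set"
    by (simp only: shuffle_sign_def char_two_simps(3) [OF assms] power_one)
  then have *: "form_coeff (f * g) S = (\<Sum>A\<in>Pow S. form_coeff f A * form_coeff g (S - A))"
    for f g :: "(3, 'r) form" and S
    by (simp add: times_form.rep_eq)
  have d: "{1,2,3} - {1} = {2,3::3}" "{1,2,3} - {2} = {1,3::3}" "{1,2,3} - {3} = {1,2::3}"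
    "{1,2,3} - {1,2} = {3::3}" "{1,2,3} - {1,3} = {2::3}" "{1,2,3} - {2,3} = {1::3}"
    "{1,2} - {1} = {2::3}" "{1,2} - {2} = {1::3}" "{1,3} - {1} = {3::3}" "{1,3} - {3} = {1::3}"
    "{2,3} - {2} = {3::3}" "{2,3} - {3} = {2::3}"
    by auto
  show ?thesis
    by (rule form8_eqI; simp only: * Pow3)
      (simp_all add: d set3_neqs add.assoc)
qed

lemma less_3 [simp]: "(1::3) < 2" "(3::3) < 1" "(3::3) < 2"
  by (simp_all add: less_bit1_def bit1.Rep_numeral bit1.Rep_1 bit1.Rep_0)

lemma sorted_list_of_set3:
  "sorted_list_of_set {1::3, 2} = [1, 2]" "sorted_list_of_set {1::3, 3} = [3, 1]"
  "sorted_list_of_set {2::3, 3} = [3, 2]" "sorted_list_of_set {1::3, 2, 3} = [3, 1, 2]"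
  using less_3 by (simp_all add: less_imp_le not_le)

text \<open>Multiplication by a nonzero \<open>x\<close> permutes the nonzero elements, so their
  product \<open>?P\<close> equals \<open>x ^ (CARD('a) - 1) * ?P\<close>.\<close>

lemma power_card_eq: "(x::'a::{field,finite}) ^ CARD('a) = x"
proof (cases "x = 0")
  case False
  let ?P = "\<Prod>y\<in>UNIV - {0::'a}. y"
  have "?P = (\<Prod>y\<in>UNIV - {0}. x * y)"
    by (rule prod.reindex_bij_witness [where j = "\<lambda>y. y / x" and i = "\<lambda>y. x * y"]) (use False in auto)
  also have "\<dots> = x ^ (CARD('a) - 1) * ?P"
    by (simp add: prod.distrib card_Diff_subset)
  finally have "x ^ (CARD('a) - 1) = 1" by simp
  then show ?thesis
    by (metis Suc_diff_1 mult.right_neutral power_Suc zero_less_card_finite)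
qed (simp add: power_0_left)

lemma matrix_inv_eqI:
  fixes A B :: "'a::comm_semiring_1^'n^'n"
  assumes "A ** B = mat 1" "B ** A = mat 1"
  shows "matrix_inv A = B"
  unfolding matrix_inv_def
proof (rule some_equality)
  fix C assume "A ** C = mat 1 \<and> C ** A = mat 1"
  then show "C = B"
    by (metis assms(2) matrix_mul_assoc matrix_mul_lid matrix_mul_rid)
qed (use assms in simp)

text \<open>This and the next identity are the coefficients at \<open>{1,3}\<close> and
  \<open>{1,2,3}\<close> in \<open>act8_mult\<close>. With the minors of the substitution matrix
  left unreduced, they hold without any condition on the determinant and can be checked by
  expansion.\<close>

lemma exterior_mult_13:
  fixes a b c e :: "'b::comm_ring_1"
  assumes c2: "\<And>x::'b. x + x = 0" "\<And>x y::'b. x + (x + y) = y"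
  shows "(a * a * (b * e) + b * b * (a * c)) * (a0 * b12 + a1 * b2 + a2 * b1 + a12 * b0)
  + (c * c * (b * b) + e * e * (a * a)) *  (a0 * b13 + a1 * b3 + a3 * b1 + a13 * b0)
  + (c * c * (b * e) + e * e * (a * c)) * (a0 * b23 + a2 * b3 + a3 * b2 + a23 * b0)
  = a0 * ((a * a * (b * e) + b * b * (a * c)) * b12 + (c * c * (b * b) + e * e * (a * a)) * b13 + (c * c * (b * e) + e * e * (a * c)) * b23)
   + (a * a * a1 + a * c * a2 + c * c * a3) * (b * b * b1 + b * e * b2 + e * e * b3)
   + (b * b * a1 + b * e * a2 + e * e * a3) * (a * a * b1 + a * c * b2 + c * c * b3)
   + ((a * a * (b * e) + b * b * (a * c)) * a12 + (c * c * (b * b) + e * e * (a * a)) * a13 + (c * c * (b * e) + e * e * (a * c)) * a23) * b0"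
  by (simp only: distrib_left distrib_right mult_ac add_ac add_0_left add_0_right c2)

lemma exterior_mult_123:
  fixes a b c e :: "'b::comm_ring_1"
  assumes c2: "\<And>x::'b. x + x = 0" "\<And>x y::'b. x + (x + y) = y"
  shows "(c * c * (b * b) + e * e * (a * a)) * (a0 * b123 + a1 * b23 + a2 * b13 + a3 * b12 + a12 * b3 + a13 * b2 + a23 * b1 + a123 * b0)
  = a0 * ((c * c * (b * b) + e * e * (a * a)) * b123) + (a * a * a1 + a * c * a2 + c * c * a3) * (b * b * b12 + e * e * b23)
  + a2 * ((a * a * (b * e) + b * b * (a * c)) * b12 + (c * c * (b * b) + e * e * (a * a)) * b13 + (c * c * (b * e) + e * e * (a * c)) * b23)
  + (b * b * a1 + b * e * a2 + e * e * a3) * (a * a * b12 + c * c * b23)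
  + (a * a * a12 + c * c * a23) * (b * b * b1 + b * e * b2 + e * e * b3)
  + ((a * a * (b * e) + b * b * (a * c)) * a12 + (c * c * (b * b) + e * e * (a * a)) * a13 + (c * c * (b * e) + e * e * (a * c)) * a23) * b2
  + (b * b * a12 + e * e * a23) * (a * a * b1 + a * c * b2 + c * c * b3) + ((c * c * (b * b) + e * e * (a * a)) * a123) * b0"
  by (simp only: distrib_left distrib_right mult_ac add_ac add_0_left add_0_right c2)

section \<open>The action of SL2 in coordinates\<close>

locale even_q =
  fixes \<gamma> \<delta> :: "'a::{field,finite}" and k :: nat
  assumes card: "CARD('a) = 2 ^ k"
    and irr: "irreducible [:- \<delta>, - \<gamma>, 1:]"
begin

lemma two_eq_0: "(1::'a) + 1 = 0"
proof -
  have "k \<noteq> 0"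
  proof
    assume "k = 0"
    then have "card {0, 1::'a} \<le> 1" using card card_mono [of UNIV "{0, 1::'a}"] by simp
    then show False by simp
  qed
  \<comment> \<open>The exponent is even as \<open>k \<noteq> 0\<close>, while every field element
    is its own power of exponent \<open>CARD('a)\<close>; hence \<open>-1 = 1\<close>.\<close>
  then have "(- 1) ^ CARD('a) = (1::'a)" by (simp add: card)
  then show ?thesis
    using power_card_eq [of "- 1 :: 'a"] by (metis add.right_inverse)
qed

lemma two_eq_0_mpoly: "(1::'a mpoly3) + 1 = 0"
  using two_eq_0 by (metis Const_1 Const_0 Const_add)

lemma two_eq_0_poly: "(1::'a mpoly3 poly) + 1 = 0"
  by (simp only: one_pCons add_pCons two_eq_0_mpoly add_0_left pCons_0_0)

lemmas c2a = char_two_simps [OF two_eq_0]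
lemmas c2 = char_two_simps [OF two_eq_0_mpoly]
lemmas c2_norm = distrib_left distrib_right mult_ac add_ac add_0_left add_0_right c2
lemmas form8_mult = form8_mult [OF two_eq_0_mpoly]

definition act4 :: "'a \<Rightarrow> 'a \<Rightarrow> 'a \<Rightarrow> 'a \<Rightarrow> 'a mpoly3 \<Rightarrow> 'a mpoly3" where
  "act4 a b c e = sub (Const (a * a) * X 1 + Const (b * b) * X 3)
     (Const (a * c) * X 1 + X 2 + Const (b * e) * X 3) (Const (c * c) * X 1 + Const (e * e) * X 3)"

text \<open>The factors \<open>a * b\<close>, \<open>1\<close>, \<open>c * e\<close> at
  \<open>{1,3}\<close> are 2x2 minors of the matrix of \<open>act4\<close>, already reduced by
  \<open>a * e + b * c = 1\<close>; likewise the factor at \<open>{1,2,3}\<close> is its determinant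
  \<open>1\<close>.\<close>

definition act8 :: "'a \<Rightarrow> 'a \<Rightarrow> 'a \<Rightarrow> 'a \<Rightarrow> 'a dform \<Rightarrow> 'a dform" where
  "act8 a b c e \<eta> = (let r = (\<lambda>S. act4 a b c e (form_coeff \<eta> S)) in
     form8 (r {}) (Const (a * a) * r {1} + Const (a * c) * r {2} + Const (c * c) * r {3})
       (r {2}) (Const (b * b) * r {1} + Const (b * e) * r {2} + Const (e * e) * r {3})
       (Const (a * a) * r {1,2} + Const (c * c) * r {2,3})
       (Const (a * b) * r {1,2} + r {1,3} + Const (c * e) * r {2,3})
       (Const (b * b) * r {1,2} + Const (e * e) * r {2,3}) (r {1,2,3}))"

lemma matrix_inv_SL2:
  assumes "det (h :: 'a^2^2) = 1"
  shows "matrix_inv h = mat22 (h$2$2) (h$1$2) (h$2$1) (h$1$1)"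
proof (rule matrix_inv_eqI)
  have *: "h$1$1 * h$2$2 + h$1$2 * h$2$1 = 1" using assms by (simp add: det_2 c2a)
  show "h ** mat22 (h$2$2) (h$1$2) (h$2$1) (h$1$1) = mat 1"
    "mat22 (h$2$2) (h$1$2) (h$2$1) (h$1$1) ** h = mat 1"
    using * by (simp_all add: mat22_def matrix_matrix_mult_def mat_def vec_eq_iff forall_2 sum_2
        mult_ac add_ac c2a)
qed

lemma Const_det:
  assumes "a * e + b * c = (1::'a)"
  shows "Const a * Const e + Const b * Const c = 1"
  using assms by (metis Const_add Const_mult Const_1)

lemma minors:
  assumes "a * e + b * c = (1::'a)"
  shows "Const a * Const a * (Const b * Const e) + Const b * Const b * (Const a * Const c) = Const a * Const b"
    "Const c * Const c * (Const b * Const e) + Const e * Const e * (Const a * Const c) = Const c * Const e"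
    "Const c * Const c * (Const b * Const b) + Const e * Const e * (Const a * Const a) = 1"
proof -
  have "Const a * Const a * (Const b * Const e) + Const b * Const b * (Const a * Const c)
      = Const a * Const b * (Const a * Const e + Const b * Const c)"
    "Const c * Const c * (Const b * Const e) + Const e * Const e * (Const a * Const c)
      = Const c * Const e * (Const a * Const e + Const b * Const c)"
    "Const c * Const c * (Const b * Const b) + Const e * Const e * (Const a * Const a)
      = (Const a * Const e + Const b * Const c) * (Const a * Const e + Const b * Const c)"
    by (simp_all only: c2_norm)
  then show "Const a * Const a * (Const b * Const e) + Const b * Const b * (Const a * Const c) = Const a * Const b"
    "Const c * Const c * (Const b * Const e) + Const e * Const e * (Const a * Const c) = Const c * Const e"
    "Const c * Const c * (Const b * Const b) + Const e * Const e * (Const a * Const a) = 1"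
    unfolding Const_det [OF assms] by simp_all
qed

lemma act_SL2:
  fixes g :: "'a^2^2"
  assumes h: "det h = 1" "matrix_inv g = h"
  shows "act_poly g = act4 (h$1$1) (h$1$2) (h$2$1) (h$2$2)"
    and "act_form g = act8 (h$1$1) (h$1$2) (h$2$1) (h$2$2)"
proof -
  define a b c e where abce: "a = h$1$1" "b = h$1$2" "c = h$2$1" "e = h$2$2"
  have det: "a * e + b * c = 1" using h by (simp add: det_2 c2a abce)
  have "conj_act h v $ 1 $ 2 = a * a * v$1$2 + a * b * (v$1$1 + v$2$2) + b * b * v$2$1"
    "conj_act h v $ 1 $ 1 = a * e * v$1$1 + b * e * v$2$1 + a * c * v$1$2 + b * c * v$2$2"
    "conj_act h v $ 2 $ 1 = c * c * v$1$2 + c * e * (v$1$1 + v$2$2) + e * e * v$2$1" for v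
    by (simp_all add: conj_act_def matrix_inv_SL2 h abce mat22_def matrix_matrix_mult_def sum_2
        algebra_simps)
  then have coeff: "dual_coeff g i j = (if i = 1 then vec3 (a * a) 0 (b * b)
      else if i = 2 then vec3 (a * c) 1 (b * e) else vec3 (c * c) 0 (e * e)) j" for i j
    using exhaust_3 [of i] exhaust_3 [of j] det
    by (auto simp: dual_coeff_def h coord_V_def basis_V_def mat22_def c2a)
  have lin: "(\<Sum>j\<in>UNIV. Const (dual_coeff g i j) * X j) = vec3
      (Const (a * a) * X 1 + Const (b * b) * X 3)
      (Const (a * c) * X 1 + X 2 + Const (b * e) * X 3) (Const (c * c) * X 1 + Const (e * e) * X 3) i" for i
    using exhaust_3 [of i] by (auto simp: coeff sum_3)
  show *: "act_poly g = act4 (h$1$1) (h$1$2) (h$2$1) (h$2$2)"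
    by (simp add: act_poly_def act4_def lin vec3_eta flip: abce)
  have dlin: "(\<Sum>j\<in>UNIV. scalar (Const (dual_coeff g i j)) * dx j) = vec3
      (form8 0 (Const (a * a)) 0 (Const (b * b)) 0 0 0 0)
      (form8 0 (Const (a * c)) 1 (Const (b * e)) 0 0 0 0)
      (form8 0 (Const (c * c)) 0 (Const (e * e)) 0 0 0 0) i" for i
    using exhaust_3 [of i]
    by (auto simp: coeff sum_3 scalar_form8 dx_form8 form8_mult form8_add)
  show "act_form g = act8 (h$1$1) (h$1$2) (h$2$1) (h$2$2)"
  proof
    fix \<eta> :: "'a dform"
    obtain a0 a1 a2 a3 a12 a13 a23 a123 where \<eta>: "\<eta> = form8 a0 a1 a2 a3 a12 a13 a23 a123"
      by (rule form8_cases)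
    show "act_form g \<eta> = act8 (h$1$1) (h$1$2) (h$2$1) (h$2$2) \<eta>"
      unfolding act_form_def act8_def UNIV_set3 * \<eta> abce[symmetric] dlin
      by (simp add: set3_neqs sorted_list_of_set3 scalar_form8 one_form8 form8_mult form8_add Let_def Const_mult minors [OF det])
  qed
qed

lemma act4_simps:
  "act4 a b c e (p + r) = act4 a b c e p + act4 a b c e r"
  "act4 a b c e (p * r) = act4 a b c e p * act4 a b c e r"
  "act4 a b c e (p ^ n) = act4 a b c e p ^ n"
  "act4 a b c e (Const x) = Const x"
  "act4 a b c e 0 = 0" "act4 a b c e 1 = 1"
  "act4 a b c e (prod h A) = (\<Prod>x\<in>A. act4 a b c e (h x))"
  by (simp_all add: act4_def Const.poly_subst_simps)

lemma act4_X:
  "act4 a b c e (X 1) = Const (a * a) * X 1 + Const (b * b) * X 3"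
  "act4 a b c e (X 2) = Const (a * c) * X 1 + X 2 + Const (b * e) * X 3"
  "act4 a b c e (X 3) = Const (c * c) * X 1 + Const (e * e) * X 3"
  by (simp_all add: act4_def)

text \<open>Inversion permutes \<open>SL2\<close>, so one may quantify over the entries of the
  inverse, in which the action has its simple form. \<open>P\<close> takes both actions to serve
  polynomials and forms alike.\<close>

lemma SL2_param:
  "(\<forall>g\<in>SL2. P (act_poly g) (act_form g)) \<longleftrightarrow> (\<forall>a b c e. a * e + b * c = 1 \<longrightarrow> P (act4 a b c e) (act8 a b c e))"
proof safe
  fix a b c e :: 'a
  assume *: "\<forall>g\<in>SL2. P (act_poly g) (act_form g)" and det: "a * e + b * c = 1"
  let ?h = "mat22 a b c e" and ?g = "mat22 e b c a"
  have "det ?g = 1" "det ?h = 1" using det by (simp_all add: det_2 mat22_def c2a mult.commute)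
  moreover have "matrix_inv ?g = ?h"
    using matrix_inv_SL2 [of ?g] \<open>det ?g = 1\<close> by (simp add: mat22_def)
  ultimately show "P (act4 a b c e) (act8 a b c e)"
    using bspec [OF *, of ?g] act_SL2 [of ?h ?g] by (simp only: SL2_def mem_Collect_eq) (simp add: mat22_def)
next
  fix g :: "'a^2^2"
  assume *: "\<forall>a b c e. a * e + b * c = 1 \<longrightarrow> P (act4 a b c e) (act8 a b c e)" and "g \<in> SL2"
  then have g: "det g = 1" by (simp add: SL2_def)
  let ?h = "matrix_inv g"
  have "det ?h = 1"
    using g by (simp add: matrix_inv_SL2 det_2 mat22_def mult.commute)
  moreover have "?h$1$1 * ?h$2$2 + ?h$1$2 * ?h$2$1 = 1"
    using \<open>det ?h = 1\<close> by (simp add: det_2 c2a)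
  ultimately show "P (act_poly g) (act_form g)"
    using * act_SL2 [of ?h g] by simp
qed

lemma invariant_polys_iff:
  "p \<in> invariant_polys \<longleftrightarrow> (\<forall>a b c e. a * e + b * c = (1::'a) \<longrightarrow> act4 a b c e p = p)"
  unfolding invariant_polys_def using SL2_param [of "\<lambda>x y. x p = p"] by simp

lemma invariant_forms_iff:
  "\<eta> \<in> invariant_forms \<longleftrightarrow> (\<forall>a b c e. a * e + b * c = (1::'a) \<longrightarrow> act8 a b c e \<eta> = \<eta>)"
  unfolding invariant_forms_def using SL2_param [of "\<lambda>x y. y \<eta> = \<eta>"] by simp

lemma act8_form8: "act8 a b c e (form8 a0 a1 a2 a3 a12 a13 a23 a123) =
  form8 (act4 a b c e a0)
    (Const (a * a) * act4 a b c e a1 + Const (a * c) * act4 a b c e a2 + Const (c * c) * act4 a b c e a3)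
    (act4 a b c e a2)
    (Const (b * b) * act4 a b c e a1 + Const (b * e) * act4 a b c e a2 + Const (e * e) * act4 a b c e a3)
    (Const (a * a) * act4 a b c e a12 + Const (c * c) * act4 a b c e a23)
    (Const (a * b) * act4 a b c e a12 + act4 a b c e a13 + Const (c * e) * act4 a b c e a23)
    (Const (b * b) * act4 a b c e a12 + Const (e * e) * act4 a b c e a23) (act4 a b c e a123)"
  by (simp add: act8_def)

text \<open>The minors are put back in unreduced form, the shape in which
  \<open>exterior_mult_13\<close> and \<open>exterior_mult_123\<close> apply.\<close>

lemma act8_minors:
  assumes "a * e + b * c = 1"
  shows "act8 a b c e (form8 a0 a1 a2 a3 a12 a13 a23 a123) =
  form8 (act4 a b c e a0)
    (Const (a * a) * act4 a b c e a1 + Const (a * c) * act4 a b c e a2 + Const (c * c) * act4 a b c e a3)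
    (act4 a b c e a2)
    (Const (b * b) * act4 a b c e a1 + Const (b * e) * act4 a b c e a2 + Const (e * e) * act4 a b c e a3)
    (Const (a * a) * act4 a b c e a12 + Const (c * c) * act4 a b c e a23)
    ((Const a * Const a * (Const b * Const e) + Const b * Const b * (Const a * Const c)) * act4 a b c e a12
      + (Const c * Const c * (Const b * Const b) + Const e * Const e * (Const a * Const a)) * act4 a b c e a13
      + (Const c * Const c * (Const b * Const e) + Const e * Const e * (Const a * Const c)) * act4 a b c e a23)
    (Const (b * b) * act4 a b c e a12 + Const (e * e) * act4 a b c e a23)
    ((Const c * Const c * (Const b * Const b) + Const e * Const e * (Const a * Const a)) * act4 a b c e a123)"
  unfolding minors [OF assms] act8_form8 by (simp add: Const_mult)

lemma act8_add: "act8 a b c e (\<eta> + \<theta>) = act8 a b c e \<eta> + act8 a b c e \<theta>"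
  by (rule form8_cases [of \<eta>], rule form8_cases [of \<theta>])
    (simp add: form8_add act8_form8 act4_simps algebra_simps)

lemma act8_mult:
  assumes "a * e + b * c = (1::'a)"
  shows "act8 a b c e (\<eta> * \<theta>) = act8 a b c e \<eta> * act8 a b c e \<theta>"
proof -
  obtain a0 a1 a2 a3 a12 a13 a23 a123 where \<eta>: "\<eta> = form8 a0 a1 a2 a3 a12 a13 a23 a123"
    by (rule form8_cases)
  obtain b0 b1 b2 b3 b12 b13 b23 b123 where \<theta>: "\<theta> = form8 b0 b1 b2 b3 b12 b13 b23 b123"
    by (rule form8_cases)
  show ?thesis
    unfolding \<eta> \<theta> form8_mult act8_minors [OF assms] act4_simps form8_eq_iff Const_mult
      exterior_mult_13 [OF c2(1,2)] exterior_mult_123 [OF c2(1,2)]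
    by (intro conjI refl) (simp_all only: c2_norm)
qed

end

subsection \<open>The polynomials f1 and f2\<close>

lemma frobenius_two:
  assumes "(1::'b::comm_ring_1) + 1 = 0"
  shows "(x + y :: 'b) ^ 2 ^ n = x ^ 2 ^ n + y ^ 2 ^ n"
proof (induction n)
  case (Suc n)
  have "(x + y) ^ 2 ^ Suc n = (x ^ 2 ^ n + y ^ 2 ^ n) * (x ^ 2 ^ n + y ^ 2 ^ n)"
    by (simp only: power_Suc mult_2 power_add Suc.IH)
  also have "\<dots> = x ^ 2 ^ Suc n + y ^ 2 ^ Suc n"
    by (simp only: power_Suc mult_2 power_add distrib_left distrib_right mult_ac add_ac
        add_0_left add_0_right char_two_simps [OF assms])
  finally show ?case .
qed simp

lemma partial_superset:
  assumes "finite K" "Poly_Mapping.keys p \<subseteq> K"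
  shows "partial j p = (\<Sum>m\<in>K. Poly_Mapping.single (m - Poly_Mapping.single j 1)
      (of_nat (Poly_Mapping.lookup m j) * Poly_Mapping.lookup p m))"
  unfolding partial_def using assms by (intro sum.mono_neutral_left) (auto simp: in_keys_iff)

lemma partial_add: "partial j (p + r) = partial j p + partial j r"
proof -
  let ?K = "Poly_Mapping.keys p \<union> Poly_Mapping.keys r"
  have "Poly_Mapping.keys (p + r) \<subseteq> ?K" by (rule keys_add)
  then show ?thesis
    by (simp add: partial_superset [of ?K] lookup_add distrib_left single_add sum.distrib)
qed

lemma partial_single: "partial j (Poly_Mapping.single m c)
    = Poly_Mapping.single (m - Poly_Mapping.single j 1) (of_nat (Poly_Mapping.lookup m j) * c)"
  by (subst partial_superset [of "{m}"]) auto

lemma X_power_mult: "X i ^ m * X j ^ n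
    = (Poly_Mapping.single (Poly_Mapping.single i m + Poly_Mapping.single j n) 1 :: 'a::comm_ring_1 mpoly3)"
  by (simp add: X_power mult_single)

text \<open>Both sides are monic of degree \<open>CARD('a)\<close> and vanish at the elements
  \<open>Const t * v\<close>, which are distinct because \<open>v \<noteq> 0\<close>.\<close>

lemma prod_linear_poly:
  fixes v :: "'a::{field,finite} mpoly3"
  assumes "v \<noteq> 0" and two: "(1::'a mpoly3) + 1 = 0"
  shows "(\<Prod>s\<in>UNIV. [:Const s * v, 1:]) = monom 1 CARD('a) + monom (v ^ (CARD('a) - 1)) 1"
    (is "?P = ?R")
proof (rule poly_eqI_degree_lead_coeff)
  let ?A = "range (\<lambda>s::'a. Const s * v)"
  have inj: "inj (\<lambda>s::'a. Const s * v)" using assms(1) by (auto intro: injI)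
  have q: "CARD('a) \<ge> 2"
    using card_mono [of "UNIV::'a set" "{0, 1}"] by simp
  show "CARD('a) \<le> card ?A" by (simp add: card_image inj)
  have dP: "degree ?P = CARD('a)"
    by (subst degree_prod_eq_sum_degree) auto
  then show "degree ?P \<le> CARD('a)" by simp
  have "coeff ?P CARD('a) = 1"
    unfolding dP [symmetric] lead_coeff_prod by simp
  then show "coeff ?P CARD('a) = coeff ?R CARD('a)" using q by simp
  show "degree ?R \<le> CARD('a)"
    by (rule degree_add_le) (use q in \<open>auto intro: order_trans [OF degree_monom_le]\<close>)
  fix z assume "z \<in> ?A"
  then obtain t where z: "z = Const t * v" by auto
  have "poly ?P z = 0"
    by (auto simp: poly_prod z intro!: prod_zero bexI [of _ t] char_two_simps(1) [OF two])
  moreover have "poly ?R z = 0"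
  proof -
    have "z ^ CARD('a) = Const t * v ^ CARD('a)"
      by (simp add: z power_mult_distrib power_card_eq flip: Const_power)
    moreover have "v ^ CARD('a) = v ^ (CARD('a) - 1) * v"
      by (metis Suc_diff_1 power_Suc2 zero_less_card_finite)
    ultimately show ?thesis
      by (simp add: poly_monom z mult_ac char_two_simps(1) [OF two])
  qed
  ultimately show "poly ?P z = poly ?R z" by simp
qed

context even_q
begin

definition q :: nat where "q = 2 ^ k"

lemma card_q: "CARD('a) = q"
  by (simp add: q_def card)

lemma q_ge_2: "q \<ge> 2"
  unfolding card_q [symmetric]
  using card_mono [of "UNIV::'a set" "{0, 1}"] by simp

lemma q_pos: "q > 0"
  using q_ge_2 by simp

lemma q_half: "q = 2 * 2 ^ (k - 1)"
  using q_ge_2 unfolding q_def by (cases k) simp_all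

lemma power_q: "(x :: 'a) ^ q = x"
  using power_card_eq [of x] by (simp only: card_q)

lemma frobenius: "(x + y :: 'a mpoly3) ^ q = x ^ q + y ^ q"
  unfolding q_def by (rule frobenius_two [OF two_eq_0_mpoly])

lemma Const_power_q: "Const (x :: 'a) ^ q = Const x"
  by (simp add: power_q flip: Const_power)

lemma prod_linear:
  fixes u v :: "'a mpoly3"
  shows "(\<Prod>s\<in>UNIV. u + Const s * v) = u ^ q + u * v ^ (q - 1)"
proof (cases "v = 0")
  case False
  have "(\<Prod>s\<in>UNIV. u + Const s * v) = poly (\<Prod>s\<in>UNIV. [:Const s * v, 1:]) u"
    by (simp add: poly_prod add.commute)
  also have "\<dots> = u ^ q + u * v ^ (q - 1)"
    unfolding prod_linear_poly [OF False two_eq_0_mpoly] card_q by (simp add: poly_monom mult.commute)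
  finally show ?thesis .
qed (use q_ge_2 in \<open>simp add: power_0_left card_q\<close>)

text \<open>The 2x2 minors, in characteristic 2, of the matrix with rows
  \<open>(x\<^sub>1, x\<^sub>2, x\<^sub>3)\<close> and their \<open>q\<close>-th powers. They are
  the coefficients of \<open>omega\<close>, and \<open>f2\<close> is one of them.\<close>

definition W :: "3 \<Rightarrow> 3 \<Rightarrow> 'a mpoly3" where
  "W i j = X i ^ q * X j + X i * X j ^ q"

lemma f1_eq: "f1 = (X 1 * X 3 + X 2 * X 2 :: 'a mpoly3)"
  by (simp only: f1_def c2 power2_eq_square)

lemma f2_eq: "f2 = W 1 3"
proof -
  have "(2 :: 'a mpoly3) = 0" using two_eq_0_mpoly by (simp only: one_add_one)
  then show ?thesis by (simp add: f2_def W_def card_q)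
qed

lemma f2_prod: "f2 = X 1 * (\<Prod>s\<in>UNIV. X 3 + Const (s::'a) * X 1)"
proof -
  have "X 1 ^ q = X 1 * X 1 ^ (q - 1)"
    by (metis Suc_diff_1 power_Suc q_pos)
  then show ?thesis
    unfolding prod_linear f2_eq W_def by (simp add: algebra_simps)
qed

lemma X3_add_neq_0 [simp]: "X 3 + Const (s::'a) * X 1 \<noteq> 0"
proof
  assume "X 3 + Const (s::'a) * X 1 = 0"
  then have "sub 0 0 (X 3) (X 3 + Const s * X 1) = 0" by simp
  then show False by (simp add: Const.poly_subst_simps)
qed

lemma f2_neq_0 [simp]: "f2 \<noteq> (0 :: 'a mpoly3)"
  by (simp add: f2_prod)

lemma act4_power_q:
  "act4 a b c (e::'a) (X 1 ^ q) = Const (a * a) * X 1 ^ q + Const (b * b) * X 3 ^ q"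
  "act4 a b c e (X 2 ^ q) = Const (a * c) * X 1 ^ q + X 2 ^ q + Const (b * e) * X 3 ^ q"
  "act4 a b c e (X 3 ^ q) = Const (c * c) * X 1 ^ q + Const (e * e) * X 3 ^ q"
  by (simp_all add: act4_simps act4_X frobenius power_mult_distrib Const_power_q)

lemma act4_f1:
  assumes "a * e + b * c = (1::'a)"
  shows "act4 a b c e f1 = f1"
proof -
  have "act4 a b c e f1 = (Const c * Const c * (Const b * Const b) + Const e * Const e * (Const a * Const a))
      * (X 1 * X 3) + X 2 * X 2"
    unfolding f1_eq act4_simps act4_X Const_mult by (simp only: c2_norm)
  then show ?thesis by (simp only: minors [OF assms] f1_eq mult_1_left)
qed

lemma act4_f2:
  assumes "a * e + b * c = (1::'a)"
  shows "act4 a b c e f2 = f2"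
proof -
  have "act4 a b c e f2 = (Const c * Const c * (Const b * Const b) + Const e * Const e * (Const a * Const a))
      * (X 1 ^ q * X 3 + X 1 * X 3 ^ q)"
    unfolding f2_eq W_def act4_simps(1,2) act4_power_q act4_X Const_mult by (simp only: c2_norm)
  then show ?thesis by (simp only: minors [OF assms] f2_eq W_def mult_1_left)
qed

lemma f1_invariant: "f1 \<in> (invariant_polys :: 'a mpoly3 set)"
  and f2_invariant: "f2 \<in> (invariant_polys :: 'a mpoly3 set)"
  by (simp_all add: invariant_polys_iff act4_f1 act4_f2)

lemma invariant_dvd_f2:
  fixes p :: "'a mpoly3"
  assumes inv: "p \<in> invariant_polys" and dvd: "X 1 dvd p"
  shows "f2 dvd p"
proof -
  have linear: "X 3 + Const s * X 1 dvd p" for s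
  proof -
    obtain r where r: "p = X 1 * r" using dvd by auto
    \<comment> \<open>The square root of \<open>s\<close>, since \<open>a * a = s ^ q = s\<close>.
      The element with parameters \<open>a, 1, 1, 0\<close> then carries \<open>X 1\<close> to
      \<open>Const s * X 1 + X 3\<close>.\<close>
    define a where "a = s ^ (2 ^ (k - 1))"
    have k: "2 ^ (k - 1) + 2 ^ (k - 1) = q"
      using q_half by simp
    have "a * a = s" by (simp only: a_def power_add [symmetric] k power_q)
    moreover have "act4 a 1 1 0 p = p" using inv by (simp add: invariant_polys_iff)
    ultimately show ?thesis
      by (metis r act4_simps(2) act4_X(1) dvd_triv_left Const_1 mult_1 add.commute)
  qed
  have "(\<Prod>s\<in>S. X 3 + Const s * X 1) dvd p" if "finite S" for S
    using that
  proof induction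
    case (insert t S)
    obtain r where r: "p = (\<Prod>s\<in>S. X 3 + Const s * X 1) * r" using insert.IH by auto
    \<comment> \<open>Coprimality by hand: putting \<open>x\<^sub>3 = t x\<^sub>1\<close> kills the
      new factor but none of the earlier ones, so it must kill the cofactor
      \<open>r\<close>.\<close>
    let ?h = "sub (X 1) (X 2) (Const t * X 1)"
    have "?h p = 0" using linear [of t] by (auto simp: Const.poly_subst_simps c2 dvd_def)
    moreover have "?h (\<Prod>s\<in>S. X 3 + Const s * X 1) \<noteq> 0"
    proof -
      have "?h (X 3 + Const s * X 1) \<noteq> 0" if "s \<in> S" for s
      proof -
        have "s \<noteq> t" using that insert.hyps by auto
        then have "t + s \<noteq> 0" by (metis c2a(2) add.right_neutral)
        then have "Const (t + s) * X 1 \<noteq> 0" by simp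
        then show ?thesis by (simp add: Const.poly_subst_simps Const_add distrib_right)
      qed
      then show ?thesis using insert.hyps by (simp add: Const.poly_subst_simps)
    qed
    ultimately have "?h r = 0" by (simp add: r Const.poly_subst_simps)
    moreover have "X 3 + Const t * X 1 dvd sub (X 1) (X 2) (X 3) r - ?h r"
      by (rule sub_dvd) (simp_all add: c2)
    ultimately have "X 3 + Const t * X 1 dvd r" by (simp add: sub_id)
    then show ?case using insert.hyps r by (simp add: mult_dvd_mono mult.commute)
  qed simp
  from this [of UNIV] obtain r where r: "p = (\<Prod>s\<in>UNIV. X 3 + Const (s::'a) * X 1) * r" by auto
  \<comment> \<open>At \<open>x\<^sub>1 = 0\<close> the product becomes a power of
    \<open>x\<^sub>3\<close>, which cancels; so the factor \<open>X 1\<close> sits in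
    \<open>r\<close>.\<close>
  have "sub 0 (X 2) (X 3) (\<Prod>s\<in>UNIV. X 3 + Const (s::'a) * X 1) * sub 0 (X 2) (X 3) r = 0"
    using dvd unfolding X1_dvd_iff r by (simp add: Const.poly_subst_simps)
  then have "X 1 dvd r" by (simp add: X1_dvd_iff Const.poly_subst_simps)
  then show ?thesis by (auto simp: r f2_prod dvd_def mult_ac)
qed

lemma invariant_f2_mult_iff:
  fixes p :: "'a mpoly3"
  shows "f2 * p \<in> invariant_polys \<longleftrightarrow> p \<in> invariant_polys"
  by (simp add: invariant_polys_iff act4_simps act4_f2)

lemma d_form8: "d p = form8 0 (partial 1 p) (partial 2 p) (partial 3 (p :: 'a mpoly3)) 0 0 0 0"
  by (simp add: d_def sum_3 scalar_form8 dx_form8 form8_mult form8_add)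

lemma even_of_nat: "even n \<Longrightarrow> of_nat n = (0::'a)"
  using two_eq_0 by (auto elim!: evenE simp: mult_2 simp flip: c2a)

lemma d_f1: "d f1 = form8 0 (X 3) 0 (X 1 :: 'a mpoly3) 0 0 0 0"
proof -
  have f1: "f1 = (Poly_Mapping.single (Poly_Mapping.single 1 1 + Poly_Mapping.single 3 1) 1
      + Poly_Mapping.single (Poly_Mapping.single 2 2) 1 :: 'a mpoly3)"
    using X_power_mult [of 1 1 3 1, where 'a = 'a] X_power [of 2 2, where 'a = 'a]
    by (simp add: f1_eq power2_eq_square)
  show ?thesis
    unfolding f1 d_form8 partial_add partial_single
    using even_of_nat [of 2]
    by (simp add: lookup_add lookup_single X_def)
qed

lemma d_f2: "d f2 = form8 0 (X 3 ^ q) 0 (X 1 ^ q :: 'a mpoly3) 0 0 0 0"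
proof -
  have f2: "f2 = (Poly_Mapping.single (Poly_Mapping.single 1 q + Poly_Mapping.single 3 1) 1
      + Poly_Mapping.single (Poly_Mapping.single 1 1 + Poly_Mapping.single 3 q) 1 :: 'a mpoly3)"
    using X_power_mult [of 1 q 3 1, where 'a = 'a] X_power_mult [of 1 1 3 q, where 'a = 'a]
    by (simp add: f2_eq W_def)
  have "of_nat q = (0::'a)" by (intro even_of_nat) (simp add: q_half)
  then show ?thesis
    unfolding f2 d_form8 partial_add partial_single X_power
    by (simp add: lookup_add lookup_single)
qed

lemma omega_form8: "omega = form8 0 (W 2 3) f2 (W 1 2) 0 0 0 0"
  by (simp add: omega_def card_q f2_eq W_def scalar_form8 dx_form8 form8_mult form8_add)

end

subsection \<open>Invariant forms\<close>

context even_q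
begin

lemma f2_W: "X 1 ^ q * X 3 + X 1 * X 3 ^ q = (f2 :: 'a mpoly3)"
  "X 3 * X 1 ^ q + X 1 * X 3 ^ q = (f2 :: 'a mpoly3)"
  by (simp_all add: f2_eq W_def mult.commute)

lemma act4_W:
  assumes "a * e + b * c = (1::'a)"
  shows "act4 a b c e (W 2 3) = Const (c * c) * W 1 2 + Const (e * e) * W 2 3 + Const (c * e) * f2"
    "act4 a b c e (W 1 2) = Const (a * a) * W 1 2 + Const (b * b) * W 2 3 + Const (a * b) * f2"
proof -
  have "act4 a b c e (W 2 3) = Const (c * c) * W 1 2 + Const (e * e) * W 2 3
      + (Const c * Const c * (Const b * Const e) + Const e * Const e * (Const a * Const c)) * f2"
    unfolding f2_eq W_def act4_simps(1,2) act4_power_q act4_X Const_mult by (simp only: c2_norm)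
  then show "act4 a b c e (W 2 3) = Const (c * c) * W 1 2 + Const (e * e) * W 2 3 + Const (c * e) * f2"
    by (simp only: minors [OF assms] Const_mult)
  have "act4 a b c e (W 1 2) = Const (a * a) * W 1 2 + Const (b * b) * W 2 3
      + (Const a * Const a * (Const b * Const e) + Const b * Const b * (Const a * Const c)) * f2"
    unfolding f2_eq W_def act4_simps(1,2) act4_power_q act4_X Const_mult by (simp only: c2_norm)
  then show "act4 a b c e (W 1 2) = Const (a * a) * W 1 2 + Const (b * b) * W 2 3 + Const (a * b) * f2"
    by (simp only: minors [OF assms] Const_mult)
qed

lemma form8_invariant_iff:
  "form8 a0 a1 a2 a3 a12 a13 a23 a123 \<in> (invariant_forms :: 'a dform set) \<longleftrightarrow>
    (\<forall>a b c e. a * e + b * c = 1 \<longrightarrow>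
      act4 a b c e a0 = a0 \<and>
      Const (a * a) * act4 a b c e a1 + Const (a * c) * act4 a b c e a2 + Const (c * c) * act4 a b c e a3 = a1 \<and>
      act4 a b c e a2 = a2 \<and>
      Const (b * b) * act4 a b c e a1 + Const (b * e) * act4 a b c e a2 + Const (e * e) * act4 a b c e a3 = a3 \<and>
      Const (a * a) * act4 a b c e a12 + Const (c * c) * act4 a b c e a23 = a12 \<and>
      Const (a * b) * act4 a b c e a12 + act4 a b c e a13 + Const (c * e) * act4 a b c e a23 = a13 \<and>
      Const (b * b) * act4 a b c e a12 + Const (e * e) * act4 a b c e a23 = a23 \<and>
      act4 a b c e a123 = a123)"
  by (simp add: invariant_forms_iff act8_form8)

text \<open>The action preserves degrees. The coefficient \<open>a2\<close> is itself invariant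
  because the span of \<open>dx 1\<close> and \<open>dx 3\<close> is stable and \<open>dx 2\<close>
  is fixed modulo this span.\<close>

lemma form8_invariant_components:
  assumes "form8 a0 a1 a2 a3 a12 a13 a23 a123 \<in> (invariant_forms :: 'a dform set)"
  shows "a0 \<in> invariant_polys" "a2 \<in> invariant_polys" "a123 \<in> invariant_polys"
    "form8 0 a1 a2 a3 0 0 0 0 \<in> invariant_forms" "form8 0 0 0 0 a12 a13 a23 0 \<in> invariant_forms"
  using assms unfolding form8_invariant_iff invariant_polys_iff act4_simps(5) mult_zero_right add_0_right
  by blast+

lemma scalar_invariant_iff: "scalar p \<in> invariant_forms \<longleftrightarrow> p \<in> (invariant_polys :: 'a mpoly3 set)"
  by (simp add: scalar_form8 form8_invariant_iff invariant_polys_iff act4_simps)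

lemma vol_form8: "dx 1 * dx 2 * dx 3 = (form8 0 0 0 0 0 0 0 1 :: 'a dform)"
  by (simp add: dx_form8 form8_mult)

lemma vol_invariant: "form8 0 0 0 0 0 0 0 1 \<in> (invariant_forms :: 'a dform set)"
  by (simp add: form8_invariant_iff act4_simps)

lemma invariant_forms_add: "\<eta> \<in> invariant_forms \<Longrightarrow> \<theta> \<in> invariant_forms \<Longrightarrow> \<eta> + \<theta> \<in> (invariant_forms :: 'a dform set)"
  by (simp add: invariant_forms_iff act8_add)

lemma invariant_forms_mult: "\<eta> \<in> invariant_forms \<Longrightarrow> \<theta> \<in> invariant_forms \<Longrightarrow> \<eta> * \<theta> \<in> (invariant_forms :: 'a dform set)"
  by (simp add: invariant_forms_iff act8_mult)

lemma invariant_polys_add: "p \<in> invariant_polys \<Longrightarrow> r \<in> invariant_polys \<Longrightarrow> p + r \<in> (invariant_polys :: 'a mpoly3 set)"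
  by (simp add: invariant_polys_iff act4_simps)

lemma invariant_polys_mult: "p \<in> invariant_polys \<Longrightarrow> r \<in> invariant_polys \<Longrightarrow> p * r \<in> (invariant_polys :: 'a mpoly3 set)"
  by (simp add: invariant_polys_iff act4_simps)

lemma Const_invariant: "Const c \<in> (invariant_polys :: 'a mpoly3 set)"
  by (simp add: invariant_polys_iff act4_simps)

lemma algebra_span_subset_invariant:
  assumes "S \<subseteq> invariant_forms" and "\<eta> \<in> algebra_span S"
  shows "\<eta> \<in> (invariant_forms :: 'a dform set)"
  using assms(2)
  by induction (use assms(1) in \<open>auto simp: scalar_invariant_iff Const_invariant
      intro: invariant_forms_add invariant_forms_mult\<close>)

lemma omega_invariant: "omega \<in> (invariant_forms :: 'a dform set)"
  unfolding omega_form8 form8_invariant_iff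
proof (intro allI impI conjI)
  fix a b c e :: 'a
  assume det: "a * e + b * c = 1"
  let ?D = "Const a * Const e + Const b * Const c :: 'a mpoly3"
  have "Const (a * a) * act4 a b c e (W 2 3) + Const (a * c) * act4 a b c e f2 + Const (c * c) * act4 a b c e (W 1 2)
      = (Const c * Const c * (Const b * Const b) + Const e * Const e * (Const a * Const a)) * W 2 3
        + Const a * Const c * (?D + 1) * f2"
    unfolding act4_W [OF det] act4_f2 [OF det] Const_mult by (simp only: c2_norm mult_1_left mult_1_right)
  then show "Const (a * a) * act4 a b c e (W 2 3) + Const (a * c) * act4 a b c e f2 + Const (c * c) * act4 a b c e (W 1 2) = W 2 3"
    by (simp only: minors [OF det] Const_det [OF det] c2 mult_zero_left mult_zero_right add_0_right mult_1_left)
  have "Const (b * b) * act4 a b c e (W 2 3) + Const (b * e) * act4 a b c e f2 + Const (e * e) * act4 a b c e (W 1 2)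
      = (Const c * Const c * (Const b * Const b) + Const e * Const e * (Const a * Const a)) * W 1 2
        + Const b * Const e * (?D + 1) * f2"
    unfolding act4_W [OF det] act4_f2 [OF det] Const_mult by (simp only: c2_norm mult_1_left mult_1_right)
  then show "Const (b * b) * act4 a b c e (W 2 3) + Const (b * e) * act4 a b c e f2 + Const (e * e) * act4 a b c e (W 1 2) = W 1 2"
    by (simp only: minors [OF det] Const_det [OF det] c2 mult_zero_left mult_zero_right add_0_right mult_1_left)
qed (simp_all add: act4_simps act4_f2)

lemma coordinate_forms_invariant:
  "form8 0 (X 3) 0 (X 1) 0 0 0 0 \<in> (invariant_forms :: 'a dform set)"
  "form8 0 (X 3 ^ q) 0 (X 1 ^ q) 0 0 0 0 \<in> (invariant_forms :: 'a dform set)"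
  unfolding form8_invariant_iff
proof (safe)
  fix a b c e :: 'a
  assume det: "a * e + b * c = 1"
  show "Const (a * a) * act4 a b c e (X 3) + Const (a * c) * act4 a b c e 0 + Const (c * c) * act4 a b c e (X 1) = X 3"
   "Const (b * b) * act4 a b c e (X 3) + Const (b * e) * act4 a b c e 0 + Const (e * e) * act4 a b c e (X 1) = X 1"
   "Const (a * a) * act4 a b c e (X 3 ^ q) + Const (a * c) * act4 a b c e 0 + Const (c * c) * act4 a b c e (X 1 ^ q) = X 3 ^ q"
   "Const (b * b) * act4 a b c e (X 3 ^ q) + Const (b * e) * act4 a b c e 0 + Const (e * e) * act4 a b c e (X 1 ^ q) = X 1 ^ q"
  proof -
    \<comment> \<open>The Frobenius map fixes the constants, so the pair
      \<open>X 1 ^ q, X 3 ^ q\<close> transforms like \<open>X 1, X 3\<close>; one identity in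
      \<open>u, v\<close> serves both forms.\<close>
    let ?T = "Const c * Const c * (Const b * Const b) + Const e * Const e * (Const a * Const a) :: 'a mpoly3"
    have *: "Const a * Const a * (Const c * Const c * u + Const e * Const e * v) + Const c * Const c * (Const a * Const a * u + Const b * Const b * v)
      = ?T * v" "Const b * Const b * (Const c * Const c * u + Const e * Const e * v) + Const e * Const e * (Const a * Const a * u + Const b * Const b * v)
      = ?T * u" for u v
      by (simp_all only: c2_norm)
    show "Const (a * a) * act4 a b c e (X 3) + Const (a * c) * act4 a b c e 0 + Const (c * c) * act4 a b c e (X 1) = X 3"
     "Const (b * b) * act4 a b c e (X 3) + Const (b * e) * act4 a b c e 0 + Const (e * e) * act4 a b c e (X 1) = X 1"
     "Const (a * a) * act4 a b c e (X 3 ^ q) + Const (a * c) * act4 a b c e 0 + Const (c * c) * act4 a b c e (X 1 ^ q) = X 3 ^ q"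
     "Const (b * b) * act4 a b c e (X 3 ^ q) + Const (b * e) * act4 a b c e 0 + Const (e * e) * act4 a b c e (X 1 ^ q) = X 1 ^ q"
      unfolding act4_power_q act4_X act4_simps(5) Const_mult mult_zero_right add_0_right *
      by (simp_all only: minors [OF det] mult_1_left)
  qed
qed (simp_all add: act4_simps)

lemma scalar_mult: "scalar p * form8 a0 a1 a2 a3 a12 a13 a23 a123
    = (form8 (p * a0) (p * a1) (p * a2) (p * a3) (p * a12) (p * a13) (p * a23) (p * a123) :: 'a dform)"
  by (simp add: scalar_form8 form8_mult)

lemma scalar_cancel:
  assumes "p \<noteq> (0 :: 'a mpoly3)"
  shows "scalar p * (\<xi> :: 'a dform) = scalar p * \<theta> \<longleftrightarrow> \<xi> = \<theta>"
  by (rule form8_cases [of \<xi>], rule form8_cases [of \<theta>]) (use assms in \<open>simp add: scalar_mult\<close>)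

lemma form_div_eqI:
  assumes "scalar f2 * \<xi> = (\<eta> :: 'a dform)"
  shows "form_div f2 \<eta> = \<xi>"
  unfolding form_div_def by (rule the_equality) (use assms in \<open>auto simp: scalar_cancel\<close>)

lemma form_div_df1_df2: "form_div f2 (d f1 * d f2) = (form8 0 0 0 0 0 1 0 0 :: 'a dform)"
  by (rule form_div_eqI) (simp add: scalar_mult d_f1 d_f2 form8_mult f2_W)

text \<open>Laplace expansions of 3x3 determinants with a repeated row: \<open>x\<close> or its
  \<open>q\<close>-th power above the two rows that define \<open>W\<close>.\<close>

lemma W_relations:
  "X 3 * W 1 2 + X 1 * W 2 3 = f2 * X 2"
  "X 3 ^ q * W 1 2 + X 1 ^ q * W 2 3 = f2 * X 2 ^ q"
  unfolding f2_eq W_def by (simp_all only: c2_norm)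

lemma form_div_df1_omega: "form_div f2 (d f1 * omega) = (form8 0 0 0 0 (X 3) (X 2) (X 1) 0 :: 'a dform)"
  by (rule form_div_eqI) (simp add: scalar_mult d_f1 omega_form8 form8_mult W_relations)

lemma form_div_df2_omega: "form_div f2 (d f2 * omega) = (form8 0 0 0 0 (X 3 ^ q) (X 2 ^ q) (X 1 ^ q) 0 :: 'a dform)"
  by (rule form_div_eqI) (simp add: scalar_mult d_f2 omega_form8 form8_mult W_relations)

lemma invariant_scalar_f2_mult:
  assumes "scalar f2 * \<xi> \<in> (invariant_forms :: 'a dform set)"
  shows "\<xi> \<in> invariant_forms"
  unfolding invariant_forms_iff
proof (intro allI impI)
  fix a b c e :: 'a
  assume det: "a * e + b * c = 1"
  have "act8 a b c e (scalar f2 * \<xi>) = scalar f2 * act8 a b c e \<xi>"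
    unfolding act8_mult [OF det] by (simp add: scalar_form8 act8_form8 act4_simps act4_f2 [OF det])
  then have "scalar f2 * act8 a b c e \<xi> = scalar f2 * \<xi>"
    using assms det by (simp add: invariant_forms_iff)
  then show "act8 a b c e \<xi> = \<xi>" by (simp add: scalar_cancel)
qed

lemma two_forms_invariant:
  "form8 0 0 0 0 0 1 0 0 \<in> (invariant_forms :: 'a dform set)"
  "form8 0 0 0 0 (X 3) (X 2) (X 1) 0 \<in> (invariant_forms :: 'a dform set)"
  "form8 0 0 0 0 (X 3 ^ q) (X 2 ^ q) (X 1 ^ q) 0 \<in> (invariant_forms :: 'a dform set)"
proof -
  note inv = invariant_forms_mult [OF coordinate_forms_invariant]
    invariant_forms_mult [OF coordinate_forms_invariant(1) omega_invariant]
    invariant_forms_mult [OF coordinate_forms_invariant(2) omega_invariant]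
  show "form8 0 0 0 0 0 1 0 0 \<in> (invariant_forms :: 'a dform set)"
    by (rule invariant_scalar_f2_mult)
     (use inv(1) in \<open>simp add: scalar_mult form8_mult f2_W\<close>)
  show "form8 0 0 0 0 (X 3) (X 2) (X 1) 0 \<in> (invariant_forms :: 'a dform set)"
    by (rule invariant_scalar_f2_mult)
     (use inv(2) in \<open>simp add: scalar_mult omega_form8 form8_mult W_relations mult.commute [of f2]\<close>)
  show "form8 0 0 0 0 (X 3 ^ q) (X 2 ^ q) (X 1 ^ q) 0 \<in> (invariant_forms :: 'a dform set)"
    by (rule invariant_scalar_f2_mult)
     (use inv(3) in \<open>simp add: scalar_mult omega_form8 form8_mult W_relations mult.commute [of f2]\<close>)
qed

text \<open>The product is a multiple of the invariant volume form, so its coefficient is invariant.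
  This pairing extracts all coefficients in the decompositions below.\<close>

lemma wedge_invariant:
  assumes "form8 0 a1 a2 a3 0 0 0 0 \<in> (invariant_forms :: 'a dform set)"
    and "form8 0 0 0 0 b12 b13 b23 0 \<in> (invariant_forms :: 'a dform set)"
  shows "a1 * b23 + a2 * b13 + a3 * b12 \<in> invariant_polys"
  using form8_invariant_components(3) [OF invariant_forms_mult [OF assms, unfolded form8_mult]] by simp

lemma transvection_dvd: "X 1 dvd act4 1 0 t 1 p + (p :: 'a mpoly3)"
proof -
  have "X 1 dvd act4 1 0 t 1 p - sub (X 1) (X 2) (X 3) p"
    unfolding act4_def by (rule sub_dvd) (simp_all add: c2 add_ac)
  then show ?thesis by (simp only: sub_id c2)
qed

text \<open>The transvection of parameter \<open>t\<close> fixes \<open>a2\<close> and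
  \<open>a3\<close>, while its condition at \<open>dx 1\<close> makes
  \<open>t a2 + t\<^sup>2 a3\<close> the change of \<open>a1\<close>, a multiple of
  \<open>X 1\<close>. Dividing by \<open>t\<close> gives the claim.\<close>

lemma one_form_dvd:
  assumes "form8 0 a1 a2 a3 0 0 0 0 \<in> (invariant_forms :: 'a dform set)" and "t \<noteq> 0"
  shows "X 1 dvd a2 + Const t * a3"
proof -
  let ?h = "act4 1 0 t 1"
  have "?h a1 + (Const t * a2 + Const (t * t) * a3) = a1"
    using assms(1) [unfolded form8_invariant_iff, rule_format, of 1 1 0 t] by (auto simp: add.assoc)
  then have "Const t * a2 + Const (t * t) * a3 = ?h a1 + a1"
    by (metis c2(2))
  then have "X 1 dvd Const t * a2 + Const (t * t) * a3"
    using transvection_dvd [of t a1] by simp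
  then have "X 1 dvd Const (1 / t) * (Const t * a2 + Const (t * t) * a3)" by (rule dvd_mult)
  also have "Const (1 / t) * (Const t * a2 + Const (t * t) * a3) = a2 + Const t * a3"
    using assms(2) by (simp add: distrib_left mult.assoc [symmetric] flip: Const_mult)
  finally show ?thesis .
qed

text \<open>Here the transvection fixes \<open>a23\<close>, and the change of \<open>a12\<close> is
  \<open>a23\<close> alone, so a single parameter suffices.\<close>

lemma two_form_dvd:
  assumes "form8 0 0 0 0 a12 a13 a23 0 \<in> (invariant_forms :: 'a dform set)"
  shows "X 1 dvd a23"
proof -
  let ?h = "act4 1 0 1 1"
  have "?h a12 + a23 = a12"
    using assms [unfolded form8_invariant_iff, rule_format, of 1 1 0 1] by auto
  then have "a23 = ?h a12 + a12" by (metis c2(2))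
  then show ?thesis using transvection_dvd [of 1 a12] by simp
qed

lemma invariant_f2_quotient:
  assumes "p \<in> (invariant_polys :: 'a mpoly3 set)" "X 1 dvd p"
  shows "\<exists>r\<in>invariant_polys. p = f2 * r"
  using invariant_dvd_f2 [OF assms] assms(1) invariant_f2_mult_iff by (auto simp: dvd_def)

lemma X1_dvd [simp]: "X 1 dvd (f2 :: 'a mpoly3)" "X 1 dvd W 1 2" "X 1 dvd (X 1 :: 'a mpoly3) ^ q"
  using q_pos by (auto simp: W_def f2_prod intro!: dvd_add dvd_power)

lemma f2_mult_cancel: "f2 * p = f2 * r \<Longrightarrow> p = (r :: 'a mpoly3)"
  by simp

lemma one_form_decomp:
  assumes inv: "form8 0 a1 a2 a3 0 0 0 0 \<in> (invariant_forms :: 'a dform set)" and "q > 2"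
  obtains A B C where "A \<in> invariant_polys" "B \<in> invariant_polys" "C \<in> invariant_polys"
    "form8 0 a1 a2 a3 0 0 0 0 = scalar A * d f1 + scalar B * d f2 + scalar C * omega"
proof -
  have "\<exists>t::'a. t \<noteq> 0 \<and> t \<noteq> 1"
  proof (rule ccontr)
    assume "\<not> (\<exists>t::'a. t \<noteq> 0 \<and> t \<noteq> 1)"
    then have "UNIV \<subseteq> {0, 1::'a}" by auto
    from card_mono [OF _ this] show False using \<open>q > 2\<close> by (simp add: card_q)
  qed
  then obtain t :: 'a where t: "t \<noteq> 0" "t \<noteq> 1" by blast
  have a23: "X 1 dvd a2 + a3" using one_form_dvd [OF inv, of 1] by simp
  moreover have "X 1 dvd a2 + Const t * a3" by (rule one_form_dvd [OF inv t(1)])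
  \<comment> \<open>The sum eliminates \<open>a2\<close> and leaves \<open>a3\<close> times the
    nonzero constant \<open>1 + t\<close>.\<close>
  ultimately have "X 1 dvd (a2 + a3) + (a2 + Const t * a3)" by (rule dvd_add)
  also have "(a2 + a3) + (a2 + Const t * a3) = a3 * Const (1 + t)"
    by (simp only: Const_add Const_1 c2_norm mult_1_right mult_1_left)
  finally have "X 1 dvd a3 * Const (1 + t)" .
  then have "X 1 dvd a3 * Const (1 + t) * Const (1 / (1 + t))" by (rule dvd_mult2)
  moreover have "1 + t \<noteq> 0" using t(2) by (metis add.right_neutral c2a(2))
  ultimately have a3: "X 1 dvd a3" by (simp add: mult.assoc flip: Const_mult)
  then have a2: "X 1 dvd a2" using a23 by (simp add: dvd_add_left_iff)
  \<comment> \<open>These two-forms are dual, up to \<open>f2\<close>, to \<open>omega\<close>,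
    \<open>d f2\<close> and \<open>d f1\<close> in this order; hence they yield \<open>C\<close>,
    \<open>B\<close> and \<open>A\<close>.\<close>
  note w = wedge_invariant [OF inv two_forms_invariant(1)] wedge_invariant [OF inv two_forms_invariant(2)]
    wedge_invariant [OF inv two_forms_invariant(3)]
  obtain C where C: "C \<in> invariant_polys" "a2 = f2 * C"
    using invariant_f2_quotient [OF w(1)] a2 by auto
  obtain B where B: "B \<in> invariant_polys" "a1 * X 1 + a2 * X 2 + a3 * X 3 = f2 * B"
    using invariant_f2_quotient [OF w(2)] a2 a3 by auto
  obtain A where A: "A \<in> invariant_polys" "a1 * X 1 ^ q + a2 * X 2 ^ q + a3 * X 3 ^ q = f2 * A"
    using invariant_f2_quotient [OF w(3)] a2 a3 by auto
  \<comment> \<open>The three pairings determine the form; as in Cramer's rule, recovering a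
    coefficient costs a factor \<open>f2\<close>, which is then cancelled.\<close>
  have "f2 * a1 = f2 * (A * X 3 + B * X 3 ^ q + C * W 2 3)"
  proof -
    have "f2 * (A * X 3 + B * X 3 ^ q + C * W 2 3) = (f2 * A) * X 3 + (f2 * B) * X 3 ^ q + (f2 * C) * W 2 3"
      by (simp add: algebra_simps)
    also have "\<dots> = (X 1 ^ q * X 3 + X 1 * X 3 ^ q) * a1"
      unfolding A(2) [symmetric] B(2) [symmetric] C(2) [symmetric] W_def by (simp only: c2_norm)
    finally show ?thesis by (simp add: f2_W)
  qed
  moreover have "f2 * a3 = f2 * (A * X 1 + B * X 1 ^ q + C * W 1 2)"
  proof -
    have "f2 * (A * X 1 + B * X 1 ^ q + C * W 1 2) = (f2 * A) * X 1 + (f2 * B) * X 1 ^ q + (f2 * C) * W 1 2"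
      by (simp add: algebra_simps)
    also have "\<dots> = (X 1 ^ q * X 3 + X 1 * X 3 ^ q) * a3"
      unfolding A(2) [symmetric] B(2) [symmetric] C(2) [symmetric] W_def by (simp only: c2_norm)
    finally show ?thesis by (simp add: f2_W)
  qed
  ultimately show ?thesis
    using A B C by (intro that [of A B C])
      (simp_all add: d_f1 d_f2 omega_form8 scalar_mult form8_add mult.commute)
qed

lemma two_form_decomp:
  assumes inv: "form8 0 0 0 0 a12 a13 a23 0 \<in> (invariant_forms :: 'a dform set)"
  obtains A B C where "A \<in> invariant_polys" "B \<in> invariant_polys" "C \<in> invariant_polys"
    "form8 0 0 0 0 a12 a13 a23 0 = scalar A * form_div f2 (d f2 * omega)
      + scalar B * form_div f2 (d f1 * omega) + scalar C * form_div f2 (d f1 * d f2)"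
proof -
  have dvd: "X 1 dvd a23" by (rule two_form_dvd [OF inv])
  \<comment> \<open>In each pairing the terms without \<open>a23\<close> carry \<open>X 1\<close>,
    \<open>X 1 ^ q\<close>, \<open>f2\<close> or \<open>W 1 2\<close>, all multiples of
    \<open>X 1\<close>; \<open>dvd\<close> handles the rest.\<close>
  note w = wedge_invariant [OF coordinate_forms_invariant(1) inv]
    wedge_invariant [OF coordinate_forms_invariant(2) inv]
    wedge_invariant [OF omega_invariant [unfolded omega_form8] inv]
  obtain A where A: "A \<in> invariant_polys" "X 3 * a23 + X 1 * a12 = f2 * A"
    using invariant_f2_quotient [OF w(1)] dvd by auto
  obtain B where B: "B \<in> invariant_polys" "X 3 ^ q * a23 + X 1 ^ q * a12 = f2 * B"
    using invariant_f2_quotient [OF w(2)] dvd by auto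
  obtain C where C: "C \<in> invariant_polys" "W 2 3 * a23 + f2 * a13 + W 1 2 * a12 = f2 * C"
    using invariant_f2_quotient [OF w(3)] dvd by auto
  have "f2 * a12 = f2 * (A * X 3 ^ q + B * X 3)"
  proof -
    have "f2 * (A * X 3 ^ q + B * X 3) = (f2 * A) * X 3 ^ q + (f2 * B) * X 3"
      by (simp add: algebra_simps)
    also have "\<dots> = (X 1 ^ q * X 3 + X 1 * X 3 ^ q) * a12"
      unfolding A(2) [symmetric] B(2) [symmetric] by (simp only: c2_norm)
    finally show ?thesis by (simp add: f2_W)
  qed
  moreover have "f2 * a23 = f2 * (A * X 1 ^ q + B * X 1)"
  proof -
    have "f2 * (A * X 1 ^ q + B * X 1) = (f2 * A) * X 1 ^ q + (f2 * B) * X 1"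
      by (simp add: algebra_simps)
    also have "\<dots> = (X 1 ^ q * X 3 + X 1 * X 3 ^ q) * a23"
      unfolding A(2) [symmetric] B(2) [symmetric] by (simp only: c2_norm)
    finally show ?thesis by (simp add: f2_W)
  qed
  moreover have "f2 * a13 = f2 * (A * X 2 ^ q + B * X 2 + C)"
  proof -
    have "f2 * (A * X 2 ^ q + B * X 2 + C) = (f2 * A) * X 2 ^ q + (f2 * B) * X 2 + f2 * C"
      by (simp add: algebra_simps)
    also have "\<dots> = f2 * a13"
      unfolding A(2) [symmetric] B(2) [symmetric] C(2) [symmetric] W_def by (simp only: c2_norm)
    finally show ?thesis by simp
  qed
  ultimately show ?thesis
    using A B C by (intro that [of A B C])
      (simp_all add: form_div_df1_df2 form_div_df1_omega form_div_df2_omega scalar_mult form8_add mult.commute)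
qed

end

subsection \<open>The polynomial f3\<close>

lemma square_eq_iff_char_two:
  assumes "(1::'b::idom) + 1 = 0"
  shows "x ^ 2 = (y::'b) ^ 2 \<longleftrightarrow> x = y"
proof
  assume "x ^ 2 = y ^ 2"
  then have "(x + y) * (x + y) = 0"
    by (simp only: power2_eq_square distrib_left distrib_right mult_ac add_ac
        add_0_left add_0_right char_two_simps [OF assms])
  then have "x + y = 0" by simp
  then show "x = y" by (metis char_two_simps(2) [OF assms] add_0_right)
qed simp

context even_q
begin

lemma no_root: "r * r + \<gamma> * r + \<delta> \<noteq> 0"
proof
  assume "r * r + \<gamma> * r + \<delta> = 0"
  then have "poly [:- \<delta>, - \<gamma>, 1:] r = 0" by (simp add: algebra_simps c2a)
  then have "[:- r, 1:] dvd [:- \<delta>, - \<gamma>, 1:]" by (simp only: poly_eq_0_iff_dvd)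
  then obtain p where p: "[:- \<delta>, - \<gamma>, 1:] = [:- r, 1:] * p" by (rule dvdE)
  have "degree [:- \<delta>, - \<gamma>, 1:] = 2" by simp
  moreover have "p \<noteq> 0" using p by auto
  ultimately have "degree p = 1" unfolding p by (subst (asm) degree_mult_eq) auto
  moreover have "[:- r, 1:] dvd 1 \<or> p dvd 1" using irreducibleD [OF irr p] .
  ultimately show False using \<open>p \<noteq> 0\<close> by (auto simp: is_unit_iff_degree)
qed

lemma gamma_neq_0 [simp]: "\<gamma> \<noteq> 0"
proof
  assume "\<gamma> = 0"
  \<comment> \<open>The square root of \<delta>, which would be a root of the quadratic if \<gamma>
    vanished.\<close>
  define r where "r = \<delta> ^ 2 ^ (k - 1)"
  have "r * r = \<delta>"
    using power_q [of \<delta>] q_half by (simp add: r_def flip: power_add mult_2)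
  then show False using no_root [of r] \<open>\<gamma> = 0\<close> by (simp add: c2a)
qed

text \<open>The constant of the Artin-Schreier form: substituting \<open>\<gamma> s\<close> turns
  the quadratic into \<open>\<gamma>\<^sup>2 (s\<^sup>2 + s + kappa)\<close>.\<close>

definition kappa :: 'a where "kappa = \<delta> / (\<gamma> * \<gamma>)"

lemma no_root_kappa: "s * s + s + kappa \<noteq> 0"
proof
  assume "s * s + s + kappa = 0"
  then have "\<gamma> * \<gamma> * (s * s + s + kappa) = 0" by simp
  then have "(\<gamma> * s) * (\<gamma> * s) + \<gamma> * (\<gamma> * s) + \<delta> = 0"
    by (simp add: kappa_def algebra_simps)
  then show False using no_root by blast
qed

text \<open>The pairs for which the binary quadratic form
  \<open>a Z\<^sup>2 + Z T + c T\<^sup>2\<close> is irreducible: \<open>a * c\<close> lies in the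
  class of \<open>kappa\<close> modulo the additive group of all \<open>s\<^sup>2 + s\<close>, and
  \<open>kappa\<close> is not in that group.\<close>

definition E :: "('a \<times> 'a) set" where "E = {(a, c). \<exists>s. a * c = s * s + s + kappa}"

definition linear_form :: "'a \<times> 'a \<Rightarrow> 'a mpoly3" where
  "linear_form = (\<lambda>(a, c). Const a * X 1 + X 2 + Const c * X 3)"

definition F3 :: "'a mpoly3" where "F3 = (\<Prod>x\<in>E. linear_form x)"

text \<open>The group permutes the linear factors. The map \<phi> is the substitution
  \<open>Z \<mapsto> a Z + b T\<close>, \<open>T \<mapsto> c Z + e T\<close> in the quadratic form
  with outer coefficients \<open>u, v\<close>; the middle coefficient stays
  \<open>a e + b c = 1\<close>.\<close>

lemma F3_invariant: "F3 \<in> invariant_polys"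
  unfolding invariant_polys_iff
proof (intro allI impI)
  fix a b c e :: 'a
  assume det: "a * e + b * c = 1"
  define \<phi> where "\<phi> = (\<lambda>(u, v). (u * (a * a) + a * c + v * (c * c), u * (b * b) + b * e + v * (e * e)))"
  have act: "act4 a b c e (linear_form x) = linear_form (\<phi> x)" for x
    unfolding linear_form_def \<phi>_def
    by (simp add: act4_simps act4_X Const_add Const_mult case_prod_beta) (simp only: c2_norm)
  have "\<phi> x \<in> E" if "x \<in> E" for x
  proof -
    obtain u v s where x: "x = (u, v)" "u * v = s * s + s + kappa"
      using \<open>x \<in> E\<close> by (auto simp: E_def)
    have bc: "b * c = 1 + a * e" using det by (metis c2a(2) add.commute)
    \<comment> \<open>The new product of outer coefficients differs from \<open>u * v\<close> by
      \<open>y\<^sup>2 + y\<close> for \<open>y = u a b\<close>, \<open>y = v c e\<close> and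
      \<open>y = a e\<close>, the last because \<open>(a e)(b c) = a e (1 + a e)\<close>. As
      \<open>y\<^sup>2 + y\<close> is additive, the witnesses add up.\<close>
    define t where "t = s + u * a * b + v * c * e + a * e"
    have "(u * (a * a) + a * c + v * (c * c)) * (u * (b * b) + b * e + v * (e * e))
      = u * v * ((a * e + b * c) * (a * e + b * c)) + (u * a * b) * (u * a * b) + u * a * b * (a * e + b * c)
        + (v * c * e) * (v * c * e) + v * c * e * (a * e + b * c) + (a * e) * (b * c)"
      by (simp only: distrib_left distrib_right mult_ac add_ac add_0_left add_0_right c2a)
    also have "\<dots> = (s * s + s + kappa) + (u * a * b) * (u * a * b) + u * a * b
        + (v * c * e) * (v * c * e) + v * c * e + (a * e) * (b * c)"
      by (simp only: det x mult_1_right)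
    also have "\<dots> = t * t + t + kappa"
      unfolding t_def bc
      by (simp only: distrib_left distrib_right mult_ac add_ac add_0_left add_0_right c2a mult_1_right mult_1_left)
    finally show ?thesis unfolding E_def \<phi>_def x(1) by auto
  qed
  moreover have "inj \<phi>"
  proof (rule injI)
    fix x y assume eq: "\<phi> x = \<phi> y"
    define u v where "u = fst x + fst y" and "v = snd x + snd y"
    have "u * (a * a) + v * (c * c) = (fst x * (a * a) + a * c + snd x * (c * c)) + (fst y * (a * a) + a * c + snd y * (c * c))"
      "u * (b * b) + v * (e * e) = (fst x * (b * b) + b * e + snd x * (e * e)) + (fst y * (b * b) + b * e + snd y * (e * e))"
      unfolding u_def v_def
      by (simp_all only: distrib_left distrib_right mult_ac add_ac add_0_left add_0_right c2a)
    moreover have "fst x * (a * a) + a * c + snd x * (c * c) = fst y * (a * a) + a * c + snd y * (c * c)"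
      "fst x * (b * b) + b * e + snd x * (e * e) = fst y * (b * b) + b * e + snd y * (e * e)"
      using eq by (simp_all only: \<phi>_def case_prod_beta prod.inject)
    ultimately have 1: "u * (a * a) + v * (c * c) = 0" and 2: "u * (b * b) + v * (e * e) = 0"
      by (simp_all only: c2a)
    \<comment> \<open>Eliminating \<open>v\<close>, then \<open>u\<close>, from the equations for
      the coordinate differences leaves the square of the determinant as factor.\<close>
    have "(u * (a * a) + v * (c * c)) * (e * e) + (u * (b * b) + v * (e * e)) * (c * c)
        = u * ((a * e + b * c) * (a * e + b * c))"
      "(u * (a * a) + v * (c * c)) * (b * b) + (u * (b * b) + v * (e * e)) * (a * a)
        = v * ((a * e + b * c) * (a * e + b * c))"
      by (simp_all only: distrib_left distrib_right mult_ac add_ac add_0_left add_0_right c2a)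
    then have "u = 0" "v = 0" unfolding 1 2 det by simp_all
    then have "fst x = fst y" "snd x = snd y"
      unfolding u_def v_def by (metis c2a(2) add.right_neutral)+
    then show "x = y" by (rule prod_eqI)
  qed
  ultimately have "\<phi> ` E \<subseteq> E" "inj_on \<phi> E" by (auto intro: inj_on_subset)
  then have "bij_betw \<phi> E E"
    by (intro bij_betw_imageI endo_inj_surj) simp_all
  from prod.reindex_bij_betw [OF this, of linear_form] show "act4 a b c e F3 = F3"
    by (simp add: F3_def act4_simps act)
qed

text \<open>The map \<open>\<beta> \<mapsto> \<gamma> / \<beta>\<close> permutes the units, so the
  product is that of all units; inversion shows that its square is \<open>1\<close>, and square
  roots are unique.\<close>

lemma prod_units: "(\<Prod>\<beta>\<in>UNIV - {0::'a}. \<gamma> / \<beta>) = 1"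
proof -
  have 1: "(\<Prod>\<beta>\<in>UNIV - {0::'a}. \<gamma> / \<beta>) = (\<Prod>\<beta>\<in>UNIV - {0}. \<beta>)" (is "_ = ?P")
    by (rule prod.reindex_bij_witness [where i = "\<lambda>\<beta>. \<gamma> / \<beta>" and j = "\<lambda>\<beta>. \<gamma> / \<beta>"]) auto
  have "?P = (\<Prod>\<beta>\<in>UNIV - {0}. inverse \<beta>)"
    by (rule prod.reindex_bij_witness [where i = inverse and j = inverse]) auto
  also have "\<dots> = inverse ?P" by (rule prod_inversef [unfolded comp_def])
  finally have "?P * ?P = inverse ?P * ?P" by simp
  also have "\<dots> = 1" by (rule left_inverse) simp
  finally have "?P ^ 2 = 1 ^ 2" by (simp add: power2_eq_square)
  then have "?P = 1" by (simp only: square_eq_iff_char_two [OF two_eq_0])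
  then show ?thesis by (simp only: 1)
qed

definition f3_factor :: "'a \<Rightarrow> 'a \<Rightarrow> 'a mpoly3" where
  "f3_factor \<alpha> \<beta> = X 1 - Const ((2 * \<alpha> - \<gamma>) / \<beta>) * X 2 + Const (poly [:- \<delta>, - \<gamma>, 1:] \<alpha> / \<beta>\<^sup>2) * X 3"

text \<open>In characteristic 2 the coefficient of \<open>x\<^sub>2\<close> is
  \<open>\<gamma> / \<beta>\<close>, free of \<alpha>; it is taken out to make the factor monic in
  \<open>x\<^sub>2\<close>.\<close>

lemma f3_factor_eq:
  assumes "\<beta> \<noteq> 0"
  shows "f3_factor \<alpha> \<beta> = Const (\<gamma> / \<beta>) * linear_form (\<beta> / \<gamma>, (\<alpha> * \<alpha> + \<gamma> * \<alpha> + \<delta>) / (\<gamma> * \<beta>))"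
proof -
  have two: "2 * \<alpha> = 0" using two_eq_0 by (simp only: one_add_one mult_zero_left)
  have "poly [:- \<delta>, - \<gamma>, 1:] \<alpha> = \<alpha> * \<alpha> + \<gamma> * \<alpha> + \<delta>" by (simp add: algebra_simps c2a)
  moreover have "(\<gamma> / \<beta>) * ((\<alpha> * \<alpha> + \<gamma> * \<alpha> + \<delta>) / (\<gamma> * \<beta>)) = (\<alpha> * \<alpha> + \<gamma> * \<alpha> + \<delta>) / \<beta>\<^sup>2"
    "(\<gamma> / \<beta>) * (\<beta> / \<gamma>) = 1"
    using assms by (simp_all add: power2_eq_square)
  ultimately show ?thesis
    unfolding f3_factor_def linear_form_def
    by (simp add: two c2 c2a distrib_left mult.assoc [symmetric] Const_mult [symmetric] del: Const_mult)
qed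

lemma prod_Const_units: "(\<Prod>\<beta>\<in>UNIV - {0::'a}. Const (\<gamma> / \<beta>)) = 1"
  by (simp add: prod_units flip: Const_prod)

text \<open>The parametrisation \<phi> of the factors is two-to-one onto \<open>E\<close>:
  \<open>a\<close> determines \<beta>, and \<open>\<alpha> / \<gamma>\<close> is one of the two
  solutions \<open>s\<close>, \<open>s + 1\<close> of
  \<open>r\<^sup>2 + r + kappa = a c\<close>.\<close>

lemma f3_tilde_eq: "f3_tilde \<gamma> \<delta> = F3\<^sup>2"
proof -
  let ?S = "UNIV \<times> (UNIV - {0::'a})"
  define \<phi> where "\<phi> = (\<lambda>(\<alpha>, \<beta>). (\<beta> / \<gamma>, (\<alpha> * \<alpha> + \<gamma> * \<alpha> + \<delta>) / (\<gamma> * \<beta>)))"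
  have "f3_tilde \<gamma> \<delta> = (\<Prod>\<alpha>\<in>UNIV. \<Prod>\<beta>\<in>UNIV - {0}. f3_factor \<alpha> \<beta>)"
    by (simp only: f3_tilde_def f3_factor_def)
  also have "\<dots> = (\<Prod>\<alpha>\<in>UNIV. \<Prod>\<beta>\<in>UNIV - {0}. Const (\<gamma> / \<beta>) * linear_form (\<phi> (\<alpha>, \<beta>)))"
    by (intro prod.cong refl) (simp add: f3_factor_eq \<phi>_def)
  also have "\<dots> = (\<Prod>x\<in>?S. linear_form (\<phi> x))"
    by (simp add: prod.distrib prod_Const_units prod.cartesian_product case_prod_beta)
  also have "\<dots> = (\<Prod>y\<in>E. \<Prod>x\<in>{x \<in> ?S. \<phi> x = y}. linear_form (\<phi> x))"
  proof (rule prod.group [symmetric])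
    show "\<phi> ` ?S \<subseteq> E"
    proof
      fix y assume "y \<in> \<phi> ` ?S"
      then obtain \<alpha> \<beta> where y: "y = \<phi> (\<alpha>, \<beta>)" "\<beta> \<noteq> 0" by auto
      have "(\<beta> / \<gamma>) * ((\<alpha> * \<alpha> + \<gamma> * \<alpha> + \<delta>) / (\<gamma> * \<beta>)) = (\<alpha> / \<gamma>) * (\<alpha> / \<gamma>) + \<alpha> / \<gamma> + kappa"
        using y(2) by (simp add: kappa_def field_simps)
      then show "y \<in> E"
        unfolding y \<phi>_def E_def mem_Collect_eq case_prod_conv by (rule exI)
    qed
  qed auto
  also have "\<dots> = (\<Prod>y\<in>E. (linear_form y)\<^sup>2)"
  proof (intro prod.cong refl)
    fix y assume "y \<in> E"
    then obtain a c s where y: "y = (a, c)" "a * c = s * s + s + kappa" by (auto simp: E_def)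
    then have a: "a \<noteq> 0" using no_root_kappa by auto
    have "{x \<in> ?S. \<phi> x = y} = {(\<gamma> * s, a * \<gamma>), (\<gamma> * s + \<gamma>, a * \<gamma>)}"
    proof (intro set_eqI iffI)
      fix x assume "x \<in> {x \<in> ?S. \<phi> x = y}"
      then obtain \<alpha> \<beta> where x: "x = (\<alpha>, \<beta>)" "\<beta> \<noteq> 0" "\<beta> / \<gamma> = a"
        "(\<alpha> * \<alpha> + \<gamma> * \<alpha> + \<delta>) / (\<gamma> * \<beta>) = c"
        by (auto simp: \<phi>_def y)
      define r where "r = \<alpha> / \<gamma>"
      have \<alpha>: "\<alpha> = \<gamma> * r" and \<beta>: "\<beta> = a * \<gamma>" using x by (auto simp: r_def)
      have "a * c = r * r + r + kappa"
        using x by (simp add: \<alpha> kappa_def field_simps)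
      then have "(r * r + r + kappa) + (s * s + s + kappa) = 0" by (simp only: y(2) c2a)
      also have "(r * r + r + kappa) + (s * s + s + kappa) = (r + s) * (r + (s + 1))"
        by (simp only: distrib_left distrib_right mult_ac add_ac add_0_left add_0_right c2a mult_1_right mult_1_left)
      finally have "r = s \<or> r = s + 1" by (metis mult_eq_0_iff c2a(2) add.right_neutral)
      then show "x \<in> {(\<gamma> * s, a * \<gamma>), (\<gamma> * s + \<gamma>, a * \<gamma>)}"
        by (auto simp: x(1) \<alpha> \<beta> distrib_left)
    next
      have c: "c = (s * s + s + kappa) / a" using y(2) a by (metis nonzero_mult_div_cancel_left)
      have kappa: "\<gamma> * (\<gamma> * kappa) = \<delta>" by (simp add: kappa_def)
      have "(\<gamma> * s) * (\<gamma> * s) + \<gamma> * (\<gamma> * s) + \<delta> = \<gamma> * (\<gamma> * (s * s + s + kappa))"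
        "(\<gamma> * s + \<gamma>) * (\<gamma> * s + \<gamma>) + \<gamma> * (\<gamma> * s + \<gamma>) + \<delta> = \<gamma> * (\<gamma> * (s * s + s + kappa))"
        by (simp_all only: distrib_left distrib_right kappa) (simp_all only: mult_ac add_ac add_0_left add_0_right c2a)
      moreover fix x assume "x \<in> {(\<gamma> * s, a * \<gamma>), (\<gamma> * s + \<gamma>, a * \<gamma>)}"
      ultimately show "x \<in> {x \<in> ?S. \<phi> x = y}"
        using a by (auto simp: \<phi>_def y(1) c)
    qed
    moreover have "card {(\<gamma> * s, a * \<gamma>), (\<gamma> * s + \<gamma>, a * \<gamma>)} = 2" by simp
    ultimately have "card {x \<in> ?S. \<phi> x = y} = 2" by (simp only:)
    moreover have "(\<Prod>x\<in>{x \<in> ?S. \<phi> x = y}. linear_form (\<phi> x)) = (\<Prod>x\<in>{x \<in> ?S. \<phi> x = y}. linear_form y)"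
      by (intro prod.cong) auto
    ultimately show "(\<Prod>x\<in>{x \<in> ?S. \<phi> x = y}. linear_form (\<phi> x)) = (linear_form y)\<^sup>2"
      by (simp only: prod_constant)
  qed
  finally show ?thesis by (simp add: F3_def prod_power_distrib)
qed

lemma f3_eq: "f3 \<gamma> \<delta> = F3"
  unfolding f3_def f3_tilde_eq
  by (rule the_equality)
    (simp_all add: F3_invariant square_eq_iff_char_two [OF two_eq_0_mpoly])

text \<open>Kept factored because \<open>restrict_power_half\<close> supplies the power of two and
  \<open>restrict_power_N\<close> the factor \<open>q - 1\<close>.\<close>

definition N :: nat where "N = (q - 1) * 2 ^ (k - 1)"

lemma N_pos: "N > 0"
  using q_ge_2 by (simp add: N_def)

text \<open>Computed on the square \<open>f3_tilde\<close>: for fixed \<alpha> the constant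
  \<open>g\<close> is nonzero, so \<open>g / (\<gamma> \<beta>)\<close> runs through all units and
  the product over \<beta> does not depend on \<alpha>.\<close>

lemma F3_restrict: "sub 0 (X 2) (X 3) F3 = X 2 ^ N + X 3 ^ N"
proof -
  let ?r = "sub 0 (X 2) (X 3)"
  have "X 2 * (\<Prod>s\<in>UNIV - {0}. X 2 + Const (s::'a) * X 3) = (\<Prod>s\<in>UNIV. X 2 + Const (s::'a) * X 3)"
    by (subst (2) prod.remove [of _ 0]) simp_all
  also have "\<dots> = X 2 * (X 2 ^ (q - 1) + X 3 ^ (q - 1))"
    unfolding prod_linear using q_pos by (simp add: distrib_left flip: power_Suc)
  finally have prod: "(\<Prod>s\<in>UNIV - {0}. X 2 + Const (s::'a) * X 3) = X 2 ^ (q - 1) + X 3 ^ (q - 1)"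
    by simp
  have "(\<Prod>\<beta>\<in>UNIV - {0}. ?r (f3_factor \<alpha> \<beta>)) = X 2 ^ (q - 1) + X 3 ^ (q - 1)" for \<alpha>
  proof -
    define g where "g = \<alpha> * \<alpha> + \<gamma> * \<alpha> + \<delta>"
    have g: "g \<noteq> 0" unfolding g_def by (rule no_root)
    have "(\<Prod>\<beta>\<in>UNIV - {0}. ?r (f3_factor \<alpha> \<beta>))
        = (\<Prod>\<beta>\<in>UNIV - {0}. Const (\<gamma> / \<beta>) * (X 2 + Const (g / (\<gamma> * \<beta>)) * X 3))"
      by (intro prod.cong refl)
        (simp add: f3_factor_eq linear_form_def Const.poly_subst_simps g_def)
    also have "\<dots> = (\<Prod>\<beta>\<in>UNIV - {0}. X 2 + Const (g / (\<gamma> * \<beta>)) * X 3)"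
      by (simp only: prod.distrib prod_Const_units mult_1_left)
    also have "\<dots> = (\<Prod>s\<in>UNIV - {0}. X 2 + Const (s::'a) * X 3)"
      by (rule prod.reindex_bij_witness [where i = "\<lambda>s. g / (\<gamma> * s)" and j = "\<lambda>s. g / (\<gamma> * s)"])
        (use g in auto)
    finally show ?thesis by (simp only: prod)
  qed
  then have "?r (f3_tilde \<gamma> \<delta>) = (X 2 ^ (q - 1) + X 3 ^ (q - 1)) ^ q"
    unfolding f3_tilde_def f3_factor_def [symmetric] Const.poly_subst_prod
    by (simp add: card_q)
  also have "\<dots> = X 2 ^ ((q - 1) * q) + X 3 ^ ((q - 1) * q)"
    by (simp only: frobenius power_mult)
  also have "(q - 1) * q = N * 2"
    by (subst (2) q_half) (simp add: N_def)
  also have "X 2 ^ (N * 2) + X 3 ^ (N * 2) = (X 2 ^ N + X 3 ^ N :: 'a mpoly3)\<^sup>2"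
    using frobenius_two [OF two_eq_0_mpoly, of "X 2 ^ N" "X 3 ^ N" 1] by (simp add: power_mult)
  finally show ?thesis
    by (simp add: f3_tilde_eq Const.poly_subst_simps square_eq_iff_char_two [OF two_eq_0_mpoly])
qed

end

subsection \<open>Homogeneous components and decompositions\<close>

inductive_set subalg :: "'a::comm_ring_1 mpoly3 set \<Rightarrow> 'a mpoly3 set" for S
  where
    const: "Const c \<in> subalg S"
  | gen: "p \<in> S \<Longrightarrow> p \<in> subalg S"
  | add: "p \<in> subalg S \<Longrightarrow> r \<in> subalg S \<Longrightarrow> p + r \<in> subalg S"
  | mult: "p \<in> subalg S \<Longrightarrow> r \<in> subalg S \<Longrightarrow> p * r \<in> subalg S"

lemma subalg_sum: "(\<And>i. i \<in> I \<Longrightarrow> h i \<in> subalg S) \<Longrightarrow> sum h I \<in> subalg S"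
  by (induction I rule: infinite_finite_induct) (use subalg.const [of 0 S] in \<open>auto intro: subalg.add\<close>)

lemma subalg_sub:
  assumes "u \<in> subalg S" "v \<in> subalg S" "w \<in> subalg S"
  shows "sub u v w p \<in> subalg S"
proof (induction p rule: mpoly_induct)
  case (X i)
  then show ?case using exhaust_3 [of i] assms by auto
qed (auto simp: Const.poly_subst_simps intro: subalg.intros)

lemma mpoly_X_induct [case_names const add X]:
  fixes p :: "'a::comm_ring_1 mpoly3"
  assumes const: "\<And>c. P (Const c)"
    and add: "\<And>p q. P p \<Longrightarrow> P q \<Longrightarrow> P (p + q)"
    and X: "\<And>i p. P p \<Longrightarrow> P (X i * p)"
  shows "P p"
proof -
  \<comment> \<open>Generalised over a further factor \<open>r\<close>, so that the product case
    only chains the two hypotheses.\<close>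
  have "\<forall>r. (\<forall>c. P (Const c * r)) \<longrightarrow> (\<forall>c. P (Const c * (p * r)))"
  proof (induction p rule: mpoly_induct)
    case (const c)
    then show ?case by (simp add: mult.assoc [symmetric] flip: Const_mult)
  next
    case (add p q)
    then show ?case using assms(2) by (simp add: distrib_right distrib_left)
  next
    case (mult p q)
    then show ?case by (simp add: mult.assoc)
  next
    case (X i)
    then show ?case using assms(3) [of "Const c * r" i for c r] by (simp add: mult.left_commute)
  qed
  from this [rule_format, of 1 1] show ?thesis using const by simp
qed

lemma map_poly_hom_mult:
  fixes h :: "'a::comm_ring_1 \<Rightarrow> 'b::comm_ring_1"
  assumes "h 0 = 0" "\<And>x y. h (x + y) = h x + h y" "\<And>x y. h (x * y) = h x * h y"
  shows "map_poly h (p * r) = map_poly h p * map_poly h r"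
proof -
  have "h (sum f I) = (\<Sum>i\<in>I. h (f i))" for f :: "nat \<Rightarrow> 'a" and I
    by (induction I rule: infinite_finite_induct) (simp_all add: assms)
  then show ?thesis
    by (intro poly_eqI) (simp add: coeff_mult coeff_map_poly assms)
qed

lemma prod_linear_factors_dvd:
  fixes p :: "'a::idom poly"
  assumes "finite A" "\<And>a. a \<in> A \<Longrightarrow> poly p a = 0"
  shows "(\<Prod>a\<in>A. [:- a, 1:]) dvd p"
  using assms
proof (induction A)
  case (insert a A)
  then obtain r where r: "p = (\<Prod>a\<in>A. [:- a, 1:]) * r" by (auto elim: dvdE)
  have "(\<Prod>b\<in>A. a - b) * poly r a = 0"
    using insert.prems [of a] by (simp add: r poly_prod)
  moreover have "(\<Prod>b\<in>A. a - b) \<noteq> 0" using insert.hyps by auto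
  ultimately have "[:- a, 1:] dvd r" by (simp add: poly_eq_0_iff_dvd)
  then show ?case
    unfolding prod.insert [OF insert.hyps] r mult.commute [of _ r] by (rule mult_dvd_mono) simp
qed simp

text \<open>The monomials are sorted by their exponent of \<open>x\<^sub>3\<close> modulo
  \<open>n\<close>; a polynomial in \<open>x\<^sub>2\<close> and the \<open>n\<close>-th power of
  \<open>x\<^sub>3\<close> is encoded as a value of \<open>sub\<close>.\<close>

lemma sub_0_decomp:
  fixes p :: "'a::comm_ring_1 mpoly3"
  assumes "n > 0"
  shows "\<exists>g. sub 0 (X 2) (X 3) p = (\<Sum>i<n. X 3 ^ i * sub 0 (X 2) (X 3 ^ n) (g i))"
proof (induction p rule: mpoly_X_induct)
  case (const c)
  have "(\<Sum>i<n. X 3 ^ i * sub 0 (X 2) (X 3 ^ n) (if i = 0 then Const c else 0))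
      = (\<Sum>i<n. if i = 0 then Const c else 0)"
    by (rule sum.cong) auto
  then show ?case using assms by (intro exI [of _ "\<lambda>i. if i = 0 then Const c else 0"]) simp
next
  case (add p r)
  then obtain g h where "sub 0 (X 2) (X 3) p = (\<Sum>i<n. X 3 ^ i * sub 0 (X 2) (X 3 ^ n) (g i))"
    "sub 0 (X 2) (X 3) r = (\<Sum>i<n. X 3 ^ i * sub 0 (X 2) (X 3 ^ n) (h i))" by blast
  then show ?case
    by (intro exI [of _ "\<lambda>i. g i + h i"])
      (simp add: Const.poly_subst_simps distrib_left sum.distrib)
next
  case (X i p)
  then obtain g where g: "sub 0 (X 2) (X 3) p = (\<Sum>i<n. X 3 ^ i * sub 0 (X 2) (X 3 ^ n) (g i))"
    by blast
  consider "i = 1" | "i = 2" | "i = 3" using exhaust_3 [of i] by blast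
  then show ?case
  proof cases
    case 1
    then show ?thesis by (intro exI [of _ "\<lambda>i. 0"]) (simp add: Const.poly_subst_simps)
  next
    case 2
    then show ?thesis
      by (intro exI [of _ "\<lambda>i. X 2 * g i"])
        (simp add: Const.poly_subst_simps g sum_distrib_left mult_ac)
  next
    case 3
    obtain m where n: "n = Suc m" using assms by (cases n) auto
    \<comment> \<open>Multiplication by \<open>X 3\<close> shifts the residues; the last one wraps
      to \<open>0\<close>, and its full power \<open>X 3 ^ n\<close> is recorded as a factor
      \<open>X 3\<close> before substitution.\<close>
    define h where "h = (\<lambda>i. case i of 0 \<Rightarrow> X 3 * g m | Suc j \<Rightarrow> g j)"
    have "sub 0 (X 2) (X 3) (X 3 * p) = (\<Sum>i<m. X 3 ^ Suc i * sub 0 (X 2) (X 3 ^ n) (g i))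
        + X 3 ^ n * sub 0 (X 2) (X 3 ^ n) (g m)"
      by (simp add: Const.poly_subst_simps g n sum_distrib_left distrib_left mult_ac)
    also have "\<dots> = (\<Sum>i<n. X 3 ^ i * sub 0 (X 2) (X 3 ^ n) (h i))"
      unfolding n sum.lessThan_Suc_shift by (simp add: h_def Const.poly_subst_simps add.commute)
    finally show ?thesis using 3 by blast
  qed
qed

text \<open>The case \<open>n = 2\<close> for \<open>x\<^sub>2\<close>, obtained by exchanging
  \<open>x\<^sub>2\<close> and \<open>x\<^sub>3\<close>.\<close>

lemma sub_0_decomp_square:
  fixes p :: "'a::comm_ring_1 mpoly3"
  obtains A B where "sub 0 (X 2) (X 3) p = sub 0 (X 2 ^ 2) (X 3) A + X 2 * sub 0 (X 2 ^ 2) (X 3) B"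
proof -
  let ?s = "sub (X 1) (X 3) (X 2) :: 'a mpoly3 \<Rightarrow> 'a mpoly3"
  obtain g where "sub 0 (X 2) (X 3) (?s p) = (\<Sum>i<2. X 3 ^ i * sub 0 (X 2) (X 3 ^ 2) (g i))"
    using sub_0_decomp [of 2 "?s p"] by auto
  then have "?s (sub 0 (X 2) (X 3) (?s p)) = ?s (sub 0 (X 2) (X 3 ^ 2) (g 0) + X 3 * sub 0 (X 2) (X 3 ^ 2) (g 1))"
    by (simp add: numeral_2_eq_2)
  then have "sub 0 (X 2) (X 3) p
      = sub 0 (X 2 ^ 2) (X 3) (?s (g 0)) + X 2 * sub 0 (X 2 ^ 2) (X 3) (?s (g 1))"
    by (simp add: sub_comp Const.poly_subst_simps)
  then show ?thesis by (rule that)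
qed

text \<open>The coefficients of \<open>p (T x)\<close> as a polynomial in \<open>T\<close> are the homogeneous components of \<open>p\<close>.\<close>

definition homog :: "'a::comm_ring_1 mpoly3 \<Rightarrow> 'a mpoly3 poly" where
  "homog = poly_subst (\<lambda>c. [:Const c:]) (\<lambda>i. [:0, X i:])"

lemma homog_simps:
  "homog (p + r) = homog p + homog r" "homog (p * r) = homog p * homog r" "homog (p - r) = homog p - homog r"
  "homog (Const c) = [:Const c:]" "homog 0 = 0"
  "homog (X i) = [:0, X i:]" "homog (prod h A) = (\<Prod>a\<in>A. homog (h a))" "homog (p ^ n) = homog p ^ n"
  "homog (sum h A) = (\<Sum>a\<in>A. homog (h a))"
  by (simp_all add: homog_def cpoly.poly_subst_simps)

lemma poly_homog_1: "poly (homog p) 1 = p"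
  by (induction p rule: mpoly_induct) (simp_all add: homog_simps)

lemma homog_coeff: "homog (coeff (homog p) i) = monom (coeff (homog p) i) i"
proof (induction p arbitrary: i rule: mpoly_induct)
  case (const c)
  then show ?case by (cases i) (auto simp: homog_simps monom_0)
next
  case (add p r)
  then show ?case by (simp add: homog_simps add_monom)
next
  case (mult p r)
  have "homog (coeff (homog (p * r)) i) = (\<Sum>j\<le>i. monom (coeff (homog p) j * coeff (homog r) (i - j)) i)"
    by (auto simp: homog_simps coeff_mult mult mult_monom intro!: sum.cong)
  also have "\<dots> = monom (coeff (homog (p * r)) i) i"
    by (simp add: homog_simps coeff_mult monom_sum)
  finally show ?case .
next
  case (X j)
  then show ?case by (auto simp: homog_simps coeff_pCons monom_Suc monom_0 split: nat.splits)
qed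

lemma homog_eq_0_iff [simp]: "homog p = 0 \<longleftrightarrow> p = 0"
  by (metis homog_simps(5) poly_0 poly_homog_1)

text \<open>Truncation supplies the degree bound for the induction in
  \<open>invariant_polys_eq\<close>, since the polynomials found by restriction come without
  one.\<close>

definition trunc :: "nat \<Rightarrow> 'a::comm_ring_1 mpoly3 \<Rightarrow> 'a mpoly3" where
  "trunc n p = (\<Sum>i\<le>n. coeff (homog p) i)"

lemma trunc_id: "degree (homog p) \<le> n \<Longrightarrow> trunc n p = p"
proof -
  assume "degree (homog p) \<le> n"
  then have "poly (\<Sum>i\<le>n. monom (coeff (homog p) i) i) 1 = poly (homog p) 1"
    by (simp only: poly_as_sum_of_monoms')
  then show ?thesis by (simp add: trunc_def poly_homog_1 poly_sum poly_monom)
qed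

lemma degree_homog_trunc: "degree (homog (trunc n p)) \<le> n"
  unfolding trunc_def homog_simps
  by (rule degree_sum_le) (auto simp: homog_coeff intro: order_trans [OF degree_monom_le])

lemma trunc_diff: "trunc n (p - r) = trunc n p - trunc n r"
  by (simp add: trunc_def homog_simps sum_subtractf)

lemma X_dvd_trunc: "X i dvd p \<Longrightarrow> X i dvd trunc n p"
  unfolding trunc_def
  by (intro dvd_sum, erule dvdE) (simp add: homog_simps coeff_pCons split: nat.split)

lemma trunc_subalg:
  assumes "p \<in> subalg S" and "\<And>r i. r \<in> S \<Longrightarrow> coeff (homog r) i \<in> subalg S"
  shows "trunc n p \<in> subalg S"
proof -
  have "coeff (homog p) i \<in> subalg S" for i
    using assms(1)
  proof (induction arbitrary: i)
    case (const c)
    then show ?case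
      using subalg.const [of 0 S] by (cases i) (auto simp: homog_simps intro: subalg.const)
  next
    case (mult p r)
    then show ?case by (auto simp: homog_simps coeff_mult intro!: subalg_sum subalg.mult)
  qed (auto simp: homog_simps intro: assms(2) subalg.add)
  then show ?thesis unfolding trunc_def by (intro subalg_sum)
qed

subsection \<open>The ring of invariants\<close>

context even_q
begin

text \<open>In \<open>f (s\<^sup>2, x\<^sub>2 + w s, x\<^sub>3 + w\<^sup>2) - f (s\<^sup>2, x\<^sub>2, x\<^sub>3)\<close>, where \<open>X 1\<close> plays the part of \<open>s\<close> and \<open>w\<close> is the polynomial
  variable, every \<open>w = t s\<close> with \<open>t \<in> F\<close> is a root by invariance. So \<open>\<Prod>\<^sub>t (w - t s)\<close> divides the difference;
  setting \<open>s = 0\<close> turns the product into \<open>w\<^sup>q\<close>.\<close>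

lemma invariant_shift_dvd:
  fixes f :: "'a mpoly3"
  assumes "f \<in> invariant_polys"
  shows "monom 1 q dvd poly_subst (\<lambda>c. [:Const c:]) (vec3 0 [:X 2:] [:X 3, 0, 1:]) f - [:sub 0 (X 2) (X 3) f:]"
proof -
  define P where "P = poly_subst (\<lambda>c. [:Const c:]) (vec3 [:X 1 ^ 2:] [:X 2, X 1:] [:X 3, 0, 1:]) f
    - [:sub (X 1 ^ 2) (X 2) (X 3) f:]"
  have "poly P (Const t * X 1) = 0" for t :: 'a
  proof -
    have poly: "poly (poly_subst (\<lambda>c. [:Const c:]) y p) z = sub (poly (y 1) z) (poly (y 2) z) (poly (y 3) z) p"
      for y z and p :: "'a mpoly3"
    proof (induction p rule: mpoly_induct)
      case (X i)
      then show ?case using exhaust_3 [of i] by auto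
    qed (simp_all add: cpoly.poly_subst_simps Const.poly_subst_simps)
    \<comment> \<open>With \<open>x\<^sub>1 = s\<^sup>2\<close> the transvection adds
      \<open>t s\<^sup>2 = w s\<close> to \<open>x\<^sub>2\<close> and
      \<open>t\<^sup>2 s\<^sup>2 = w\<^sup>2\<close> to \<open>x\<^sub>3\<close>. The square makes
      the second shift free of \<open>s\<close>, so it survives at \<open>s = 0\<close>.\<close>
    have "sub (X 1 ^ 2) (X 2) (X 3) f = sub (X 1 ^ 2) (X 2) (X 3) (act4 1 0 t 1 f)"
      using assms by (simp add: invariant_polys_iff)
    also have "\<dots> = sub (X 1 ^ 2) (X 2 + Const t * X 1 ^ 2) (X 3 + Const t * Const t * X 1 ^ 2) f"
      by (simp add: act4_def sub_comp Const.poly_subst_simps add.commute Const_mult)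
    finally show ?thesis
      by (simp add: P_def poly power2_eq_square mult_ac)
  qed
  then have "(\<Prod>a\<in>range (\<lambda>t::'a. Const t * X 1). [:- a, 1:]) dvd P"
    by (intro prod_linear_factors_dvd) auto
  also have "(\<Prod>a\<in>range (\<lambda>t::'a. Const t * X 1). [:- a, 1:]) = (\<Prod>t\<in>UNIV. [:Const t * X 1, 1:])"
    by (subst prod.reindex) (auto intro!: injI simp: c2)
  also have "\<dots> = monom 1 q + monom (X 1 ^ (q - 1)) 1"
    using prod_linear_poly [OF X_neq_0 two_eq_0_mpoly] by (simp add: card_q)
  finally obtain R where R: "P = (monom 1 q + monom (X 1 ^ (q - 1)) 1) * R" by (auto elim: dvdE)
  define h where "h = map_poly (sub 0 (X 2) (X 3) :: 'a mpoly3 \<Rightarrow> 'a mpoly3)"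
  have h_add: "h (p + r) = h p + h r" "h (p - r) = h p - h r" for p r
    unfolding h_def by (intro poly_eqI; simp add: coeff_map_poly Const.poly_subst_simps)+
  have h_mult: "h (p * r) = h p * h r" for p r
    unfolding h_def by (rule map_poly_hom_mult) (simp_all add: Const.poly_subst_simps)
  have h_const: "h [:p:] = [:sub 0 (X 2) (X 3) p:]" for p
    unfolding h_def by (simp add: map_poly_pCons)
  have h_subst: "h (poly_subst (\<lambda>c. [:Const c:]) y p) = poly_subst (\<lambda>c. [:Const c:]) (\<lambda>i. h (y i)) p"
    for y and p :: "'a mpoly3"
    by (induction p rule: mpoly_induct)
      (simp_all add: cpoly.poly_subst_simps h_add h_mult h_const)
  have "h (monom 1 q + monom (X 1 ^ (q - 1)) 1) = monom 1 q"
    using q_ge_2 unfolding h_add by (simp add: h_def map_poly_monom Const.poly_subst_simps power_0_left)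
  then have "monom 1 q dvd h P" by (simp add: R h_mult)
  also have "h P = poly_subst (\<lambda>c. [:Const c:]) (vec3 0 [:X 2:] [:X 3, 0, 1:]) f - [:sub 0 (X 2) (X 3) f:]"
  proof -
    have "(\<lambda>i. h (vec3 [:X 1 ^ 2:] [:X 2, X 1:] [:X 3, 0, 1:] i)) = vec3 0 [:X 2:] [:X 3, 0, 1:]"
      by (auto simp: fun_eq_iff vec3_def h_def map_poly_pCons Const.poly_subst_simps)
    then show ?thesis
      by (simp add: P_def h_add h_subst h_const sub_comp Const.poly_subst_simps)
  qed
  finally show ?thesis .
qed

lemma monom_q_dvd_imp_0:
  assumes "monom 1 q dvd (p :: 'a mpoly3 poly)" "degree p < q"
  shows "p = 0"
proof (rule ccontr)
  assume "p \<noteq> 0"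
  then have "degree (monom 1 q :: 'a mpoly3 poly) \<le> degree p" using assms(1) by (intro dvd_imp_degree_le)
  then show False using assms(2) by (simp add: degree_monom_eq)
qed

text \<open>Write the restriction as \<open>P(x\<^sub>3)\<close> with \<open>P(z) = \<Sum>\<^bsub>i < q/2\<^esub> A\<^sub>i z\<^sup>i\<close> and \<open>A\<^sub>i\<close> a polynomial in \<open>x\<^sub>2\<close> and \<open>x\<^sub>3\<^bsup>q/2\<^esup>\<close>. The
  substitution \<open>x\<^sub>3 + w\<^sup>2\<close> fixes every \<open>A\<^sub>i\<close> modulo \<open>w\<^sup>q\<close>, and \<open>P(x\<^sub>3 + w\<^sup>2) - P(x\<^sub>3)\<close> has degree below \<open>q\<close> in \<open>w\<close>, so
  it vanishes and \<open>P\<close> is constant.\<close>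

lemma restrict_power_half:
  fixes f :: "'a mpoly3"
  assumes "f \<in> invariant_polys"
  obtains g where "sub 0 (X 2) (X 3) f = sub 0 (X 2) (X 3 ^ 2 ^ (k - 1)) g"
proof -
  define n :: nat where "n = 2 ^ (k - 1)"
  have n: "n > 0" "q = 2 * n" by (simp_all add: n_def q_half)
  obtain g where g: "sub 0 (X 2) (X 3) f = (\<Sum>i<n. X 3 ^ i * sub 0 (X 2) (X 3 ^ n) (g i))"
    using sub_0_decomp [OF n(1), of f] by blast
  define A where "A i = sub 0 (X 2) (X 3 ^ n) (g i)" for i
  define P where "P = (\<Sum>i<n. monom (A i) i)"
  define W where "W = [:X 3, 0, 1:: 'a mpoly3:]"
  let ?\<Psi> = "\<lambda>w. poly_subst (\<lambda>c. [:Const c:]) (vec3 0 [:X 2:] w) :: 'a mpoly3 \<Rightarrow> 'a mpoly3 poly"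
  have "?\<Psi> W f = ?\<Psi> W (sub 0 (X 2) (X 3) f)"
    unfolding cpoly.poly_subst_comp by (rule poly_subst_cong) (simp add: vec3_def)
  also have "\<dots> = (\<Sum>i<n. W ^ i * ?\<Psi> (W ^ n) (g i))"
  proof -
    have "?\<Psi> W (sub 0 (X 2) (X 3 ^ n) p) = ?\<Psi> (W ^ n) p" for p
      unfolding cpoly.poly_subst_comp by (rule poly_subst_cong) (simp add: vec3_def cpoly.poly_subst_simps)
    then show ?thesis by (simp add: g cpoly.poly_subst_simps)
  qed
  finally have \<Psi>: "?\<Psi> W f = (\<Sum>i<n. W ^ i * ?\<Psi> (W ^ n) (g i))" .
  have dvd: "monom 1 q dvd ?\<Psi> (W ^ n) p - [:sub 0 (X 2) (X 3 ^ n) p:]" for p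
  proof -
    have "?\<Psi> [:X 3 ^ n:] p = [:sub 0 (X 2) (X 3 ^ n) p:]"
    proof (induction p rule: mpoly_induct)
      case (X i)
      then show ?case using exhaust_3 [of i] by auto
    qed (simp_all add: cpoly.poly_subst_simps Const.poly_subst_simps)
    \<comment> \<open>As \<open>n\<close> is a power of two and \<open>2 * n = q\<close>, the
      Frobenius map gives
      \<open>(x\<^sub>3 + w\<^sup>2) ^ n = x\<^sub>3 ^ n + w ^ q\<close>.\<close>
    moreover have "W ^ n - [:X 3 ^ n:] = monom 1 q"
    proof -
      have "W = [:X 3:] + monom 1 2" by (simp add: W_def numeral_2_eq_2 monom_Suc monom_0)
      then have "W ^ n = [:X 3 ^ n:] + monom 1 q"
        using frobenius_two [OF two_eq_0_poly, of "[:X 3:]" "monom 1 2" "k - 1", folded n_def]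
        by (simp add: n(2) monom_power poly_const_pow)
      then show ?thesis by simp
    qed
    ultimately show ?thesis
      using cpoly.dvd_poly_subst_diff [of "monom 1 q" "vec3 0 [:X 2:] (W ^ n)" "vec3 0 [:X 2:] [:X 3 ^ n:]" p]
      by (simp add: vec3_def)
  qed
  have "monom 1 q dvd (?\<Psi> W f - [:sub 0 (X 2) (X 3) f:])
      - (\<Sum>i<n. W ^ i * (?\<Psi> (W ^ n) (g i) - [:A i:]))"
    by (rule dvd_diff [OF invariant_shift_dvd [OF assms, folded W_def]], rule dvd_sum, rule dvd_mult)
      (simp only: A_def dvd)
  also have "(?\<Psi> W f - [:sub 0 (X 2) (X 3) f:]) - (\<Sum>i<n. W ^ i * (?\<Psi> (W ^ n) (g i) - [:A i:]))
      = (\<Sum>i<n. W ^ i * [:A i:]) - [:sub 0 (X 2) (X 3) f:]"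
    by (simp add: \<Psi> right_diff_distrib sum_subtractf)
  also have "\<dots> = pcompose P W - [:sub 0 (X 2) (X 3) f:]"
  proof -
    have "pcompose (monom a i) W = W ^ i * [:a:]" for a i
      by (induction i) (simp_all add: monom_0 monom_Suc pcompose_pCons mult_ac)
    then show ?thesis by (simp add: P_def pcompose_sum)
  qed
  finally have dvd: "monom 1 q dvd pcompose P W - [:sub 0 (X 2) (X 3) f:]" .
  have dW: "degree W = 2" by (simp add: W_def)
  have dP: "degree P \<le> n - 1"
    unfolding P_def by (rule degree_sum_le) (use n in \<open>auto intro: order_trans [OF degree_monom_le]\<close>)
  have "degree (pcompose P W - [:sub 0 (X 2) (X 3) f:]) \<le> max (degree (pcompose P W)) 0"
    by (rule order_trans [OF degree_diff_le_max]) simp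
  also have "\<dots> < q" using dP n by (simp add: degree_pcompose dW)
  finally have "pcompose P W = [:sub 0 (X 2) (X 3) f:]"
    using monom_q_dvd_imp_0 [OF dvd] by simp
  then have "degree (pcompose P W) = 0" by simp
  then have P0: "degree P = 0" by (simp add: degree_pcompose dW)
  have "A i = 0" if "i < n" "i \<noteq> 0" for i
  proof -
    have "coeff P i = A i" using that by (simp add: P_def coeff_sum)
    then show ?thesis using P0 that coeff_eq_0 [of P i] by simp
  qed
  then have "sub 0 (X 2) (X 3) f = (\<Sum>i<n. if i = 0 then A 0 else 0)"
    unfolding g A_def [symmetric] by (intro sum.cong) auto
  then have "sub 0 (X 2) (X 3) f = A 0" using n by simp
  then show ?thesis by (intro that [of "g 0"]) (simp add: A_def n_def)
qed


text \<open>Diagonal matrices scale \<open>x\<^sub>3\<close> by \<open>b\<^sup>2\<close>, hence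
  \<open>v = X 3 ^ n\<close> by \<open>b\<close>. With the exponents of \<open>v\<close> reduced
  modulo \<open>q - 1\<close>, this gives a polynomial in \<open>b\<close> of degree below
  \<open>q - 1\<close> with equal values at all \<open>q - 1\<close> units, so only the residue
  \<open>0\<close> survives.\<close>

lemma restrict_power_N:
  fixes f :: "'a mpoly3"
  assumes "f \<in> invariant_polys"
  obtains h where "sub 0 (X 2) (X 3) f = sub 0 (X 2) (X 3 ^ N) h"
proof -
  define n :: nat where "n = 2 ^ (k - 1)"
  define m where "m = q - 1"
  have m: "m > 0" "q = Suc m" using q_ge_2 by (simp_all add: m_def)
  define v where "v = (X 3 ^ n :: 'a mpoly3)"
  obtain g where g: "sub 0 (X 2) (X 3) f = sub 0 (X 2) v g"
    using restrict_power_half [OF assms] unfolding v_def n_def by metis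
  obtain h where h: "sub 0 (X 2) (X 3) g = (\<Sum>i<m. X 3 ^ i * sub 0 (X 2) (X 3 ^ m) (h i))"
    using sub_0_decomp [OF m(1), of g] by blast
  have sub_g: "sub 0 (X 2) z g = (\<Sum>i<m. z ^ i * sub 0 (X 2) (z ^ m) (h i))" for z
  proof -
    have "sub 0 (X 2) z (sub 0 (X 2) (X 3) g) = (\<Sum>i<m. z ^ i * sub 0 (X 2) z (sub 0 (X 2) (X 3 ^ m) (h i)))"
      unfolding h by (simp add: Const.poly_subst_simps)
    then show ?thesis by (simp add: sub_comp Const.poly_subst_simps)
  qed
  have scale: "sub 0 (X 2) (Const b * v) g = sub 0 (X 2) (X 3) f" if "b \<noteq> 0" for b :: 'a
  proof -
    have "f = act4 (1 / b) 0 0 b f" using assms that by (simp add: invariant_polys_iff)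
    then have "sub 0 (X 2) (X 3) f = sub 0 (X 2) (X 3) (act4 (1 / b) 0 0 b f)" by simp
    also have "\<dots> = sub 0 (X 2) (Const (b * b) * X 3) f"
      by (simp add: act4_def sub_comp Const.poly_subst_simps)
    also have "\<dots> = sub 0 (X 2) (Const (b * b) * X 3) (sub 0 (X 2) (X 3) f)"
      by (simp add: sub_comp Const.poly_subst_simps)
    also have "\<dots> = sub 0 (X 2) ((Const (b * b) * X 3) ^ n) g"
      by (simp add: g v_def sub_comp Const.poly_subst_simps)
    also have "(Const (b * b) * X 3) ^ n = Const b * v"
    proof -
      have "(b * b) ^ n = b ^ q" by (simp add: q_half n_def power_mult power2_eq_square)
      then show ?thesis by (simp add: power_mult_distrib v_def power_q flip: Const_power)
    qed
    finally show ?thesis by simp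
  qed
  \<comment> \<open>Its value at a unit \<open>b\<close> is the restriction with \<open>v\<close>
    replaced by \<open>b v\<close>, because \<open>b ^ m = 1\<close>.\<close>
  define P where "P = (\<Sum>i<m. monom (v ^ i * sub 0 (X 2) (v ^ m) (h i)) i)"
  have "P = [:sub 0 (X 2) (X 3) f:]"
  proof (rule poly_eqI_degree)
    let ?A = "Const ` (UNIV - {0::'a})"
    have "card ?A = m"
      using card_q by (subst card_image) (auto intro: inj_onI simp: m_def card_Diff_subset)
    moreover have "degree P \<le> m - 1"
      unfolding P_def by (rule degree_sum_le) (auto intro: order_trans [OF degree_monom_le])
    ultimately show "card ?A > degree P" "card ?A > degree [:sub 0 (X 2) (X 3) f:]"
      using m by simp_all
    fix x :: "'a mpoly3" assume "x \<in> ?A"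
    then obtain b where b: "x = Const b" "b \<noteq> 0" by auto
    have "b ^ m * b = 1 * b" using power_q [of b] by (simp add: m(2) mult.commute)
    then have "b ^ m = 1" using b(2) by simp
    then have "x ^ m = 1" by (simp add: b(1) flip: Const_power)
    then have "poly P x = sub 0 (X 2) (x * v) g"
      by (simp add: P_def sub_g poly_sum poly_monom power_mult_distrib mult_ac)
    then show "poly P x = poly [:sub 0 (X 2) (X 3) f:] x"
      using scale [OF b(2)] b(1) by simp
  qed
  then have "coeff P 0 = sub 0 (X 2) (X 3) f" by simp
  moreover have "coeff P 0 = (\<Sum>i<m. if i = 0 then sub 0 (X 2) (v ^ m) (h 0) else 0)"
    by (auto simp: P_def coeff_sum intro!: sum.cong)
  ultimately have "sub 0 (X 2) (X 3) f = sub 0 (X 2) (v ^ m) (h 0)" using m by simp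
  moreover have "v ^ m = X 3 ^ N"
    by (simp add: v_def N_def n_def m_def mult.commute flip: power_mult)
  ultimately show ?thesis by (intro that [of "h 0"]) simp
qed

abbreviation Y :: "'a mpoly3" where "Y \<equiv> X 2 ^ N + X 3 ^ N"

text \<open>For \<open>k = 1\<close> one has \<open>N = 1\<close> and the two shifts cancel.
  Otherwise \<open>N\<close> is even, and the expression is the square of a multiple of
  \<open>X 1\<close>.\<close>

lemma shift_Y_dvd: "X 1 ^ 2 dvd (X 1 + X 2) ^ N + (X 1 + X 3) ^ N - Y"
proof (cases "k = 1")
  case True
  have "N = (2 ^ k - 1) * 2 ^ (k - 1)" by (simp only: N_def q_def)
  also have "\<dots> = 1" by (simp add: True)
  finally have "N = 1" .
  then show ?thesis by (simp add: c2 add_ac)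
next
  case False
  have "k \<noteq> 0" using q_ge_2 by (metis One_nat_def not_less_eq_eq numeral_2_eq_2 power_0 q_def le_refl)
  then obtain j where j: "k - 1 = Suc j" using False by (cases "k - 1") auto
  define M where "M = (q - 1) * 2 ^ j"
  have N: "N = M * 2" by (simp only: N_def M_def j power_Suc mult_ac)
  define z where "z = ((X 1 + X 2) ^ M + X 2 ^ M) + ((X 1 + X 3) ^ M + X 3 ^ M :: 'a mpoly3)"
  have sq: "x ^ 2 + y ^ 2 = (x + y) ^ 2" for x y :: "'a mpoly3"
    using frobenius_two [OF two_eq_0_mpoly, of x y 1] by simp
  have "(X 1 + X 2) ^ N + (X 1 + X 3) ^ N - Y = z ^ 2"
    unfolding N power_mult z_def sq [symmetric] c2(4) by (simp only: add_ac)
  moreover have "X 1 dvd z"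
  proof -
    have "X 1 dvd (X 1 + X i) ^ M + (X i ^ M :: 'a mpoly3)" for i
    proof -
      have "X 1 dvd sub (X 1) (X 2) (X 1 + X i) (X 3 ^ M :: 'a mpoly3) - sub (X 1) (X 2) (X i) (X 3 ^ M)"
        by (rule sub_dvd) simp_all
      then show ?thesis by (simp add: Const.poly_subst_simps c2)
    qed
    from dvd_add [OF this [of 2] this [of 3]] show ?thesis unfolding z_def .
  qed
  ultimately show ?thesis by (simp add: dvd_power_same)
qed

text \<open>Write the restriction as \<open>A(x\<^sub>2\<^sup>2, Y) + x\<^sub>2 B(x\<^sub>2\<^sup>2, Y)\<close>. Adding \<open>x\<^sub>1\<close> to \<open>x\<^sub>2\<close> and \<open>x\<^sub>3\<close> changes it by \<open>x\<^sub>1 B(x\<^sub>2\<^sup>2, Y)\<close>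
  modulo \<open>x\<^sub>1\<^sup>2\<close>, but invariance makes the change a multiple of \<open>x\<^sub>1\<^sup>2\<close>.\<close>

lemma restrict_square_Y:
  fixes f :: "'a mpoly3"
  assumes inv: "f \<in> invariant_polys"
  obtains A where "sub 0 (X 2) (X 3) f = sub 0 (X 2 ^ 2) Y A"
proof -
  define f0 where "f0 = sub 0 (X 2) (X 3) f"
  obtain h where h: "f0 = sub 0 (X 2) (X 3 ^ N) h"
    using restrict_power_N [OF inv] unfolding f0_def by blast
  \<comment> \<open>Change of variable: \<open>X 3 ^ N = Y + X 2 ^ N\<close> trades the power of
    \<open>x\<^sub>3\<close> for \<open>Y\<close>, the restriction of \<open>F3\<close>.\<close>
  define h' where "h' = sub 0 (X 2) (X 3 + X 2 ^ N) h"
  have f0: "f0 = sub 0 (X 2) Y h'"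
  proof -
    have "Y + X 2 ^ N = X 3 ^ N" by (simp only: c2_norm)
    then have "f0 = sub 0 (X 2) (Y + X 2 ^ N) h" by (simp only: h)
    also have "\<dots> = sub 0 (X 2) Y h'"
      unfolding h'_def sub_comp by (simp add: Const.poly_subst_simps)
    finally show ?thesis .
  qed
  obtain A B where AB: "sub 0 (X 2) (X 3) h' = sub 0 (X 2 ^ 2) (X 3) A + X 2 * sub 0 (X 2 ^ 2) (X 3) B"
    by (rule sub_0_decomp_square)
  have "sub 0 (X 2) Y (sub 0 (X 2) (X 3) h') = f0"
    by (simp add: f0 sub_comp Const.poly_subst_simps)
  then have f0_AB: "f0 = sub 0 (X 2 ^ 2) Y A + X 2 * sub 0 (X 2 ^ 2) Y B"
    unfolding AB by (simp add: sub_comp Const.poly_subst_simps)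
  let ?\<theta> = "sub (X 1) (X 1 + X 2) (X 1 + X 3) :: 'a mpoly3 \<Rightarrow> 'a mpoly3"
  let ?Y = "(X 1 + X 2) ^ N + (X 1 + X 3) ^ N :: 'a mpoly3"
  have \<theta>f: "?\<theta> f = f"
  proof -
    have "act4 1 0 1 1 f = f" using inv by (simp add: invariant_polys_iff)
    then show ?thesis by (simp add: act4_def)
  qed
  have \<theta>_dvd: "X 1 dvd ?\<theta> p - p" for p
  proof -
    have "X 1 dvd ?\<theta> p - sub (X 1) (X 2) (X 3) p" by (rule sub_dvd) simp_all
    then show ?thesis by (simp only: sub_id)
  qed
  have "X 1 dvd sub (X 1) (X 2) (X 3) f - f0"
    unfolding f0_def by (rule sub_dvd) simp_all
  then obtain r where r: "f - f0 = X 1 * r" unfolding sub_id by (auto elim: dvdE)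
  have "?\<theta> (f - f0) = X 1 * ?\<theta> r" unfolding r by (simp add: Const.poly_subst_simps)
  then have \<theta>r: "f - ?\<theta> f0 = X 1 * ?\<theta> r" by (simp only: Const.poly_subst_diff \<theta>f)
  \<comment> \<open>Since \<open>f\<close> is fixed, the change of \<open>f0\<close> is that of
    \<open>X 1 * r\<close>; the factor \<open>X 1\<close> is fixed and \<open>r\<close> changes by a
    multiple of \<open>X 1\<close>, which gives the square.\<close>
  have "?\<theta> f0 - f0 = (f - f0) - (f - ?\<theta> f0)" by simp
  also have "\<dots> = X 1 * (r - ?\<theta> r)" by (simp only: r \<theta>r right_diff_distrib)
  also have "X 1 * (r - ?\<theta> r) = X 1 * (?\<theta> r - r)" by (simp only: c2 add.commute)
  finally have 1: "X 1 ^ 2 dvd ?\<theta> f0 - f0"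
    using \<theta>_dvd [of r] by (simp add: power2_eq_square)
  have "?\<theta> f0 = sub 0 ((X 1 + X 2) ^ 2) ?Y A + (X 1 + X 2) * sub 0 ((X 1 + X 2) ^ 2) ?Y B"
    unfolding f0_AB by (simp add: sub_comp Const.poly_subst_simps)
  moreover have 2: "X 1 ^ 2 dvd sub 0 ((X 1 + X 2) ^ 2) ?Y p - sub 0 (X 2 ^ 2) Y p" for p
  proof (rule sub_dvd)
    show "X 1 ^ 2 dvd (X 1 + X 2) ^ 2 - (X 2 ^ 2 :: 'a mpoly3)"
      using frobenius_two [OF two_eq_0_mpoly, of "X 1" "X 2" 1] by simp
  qed (use shift_Y_dvd in simp_all)
  have "X 1 ^ 2 dvd (sub 0 ((X 1 + X 2) ^ 2) ?Y A - sub 0 (X 2 ^ 2) Y A)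
      + (X 1 + X 2) * (sub 0 ((X 1 + X 2) ^ 2) ?Y B - sub 0 (X 2 ^ 2) Y B)"
    by (rule dvd_add [OF 2 dvd_mult [OF 2]])
  ultimately have 3: "X 1 ^ 2 dvd ?\<theta> f0 - (sub 0 (X 2 ^ 2) Y A + (X 1 + X 2) * sub 0 (X 2 ^ 2) Y B)"
    by (simp add: algebra_simps)
  have "X 1 ^ 2 dvd (?\<theta> f0 - f0) - (?\<theta> f0 - (sub 0 (X 2 ^ 2) Y A + (X 1 + X 2) * sub 0 (X 2 ^ 2) Y B))"
    by (rule dvd_diff [OF 1 3])
  also have "(?\<theta> f0 - f0) - (?\<theta> f0 - (sub 0 (X 2 ^ 2) Y A + (X 1 + X 2) * sub 0 (X 2 ^ 2) Y B))
      = X 1 * sub 0 (X 2 ^ 2) Y B"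
    by (subst (2) f0_AB) (simp add: distrib_right)
  finally have "X 1 dvd sub 0 (X 2 ^ 2) Y B" by (simp add: power2_eq_square)
  then have "sub 0 (X 2) (X 3) (sub 0 (X 2 ^ 2) Y B) = 0" by (simp only: X1_dvd_iff)
  then have "sub 0 (X 2 ^ 2) Y B = 0" by (simp add: sub_comp Const.poly_subst_simps)
  then have "f0 = sub 0 (X 2 ^ 2) Y A" using f0_AB by simp
  then show ?thesis using that by (simp add: f0_def)
qed

lemma homog_f1: "homog f1 = monom (f1 :: 'a mpoly3) 2"
  by (simp add: f1_eq homog_simps monom_Suc monom_0 numeral_2_eq_2)

lemma homog_linear_form: "homog (linear_form x) = monom (linear_form x) 1"
  by (cases x) (simp add: linear_form_def homog_simps monom_Suc monom_0)

lemma homog_F3: "homog F3 = monom F3 (card E)"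
proof -
  have "(\<Prod>x\<in>S. monom (linear_form x) 1) = monom (\<Prod>x\<in>S. linear_form x) (card S)" if "finite S" for S
    using that by induction (simp_all add: mult_monom)
  then show ?thesis by (simp add: F3_def homog_simps homog_linear_form)
qed

lemma degree_homog_f2: "degree (homog (f2 :: 'a mpoly3)) = Suc q"
proof -
  have "homog f2 = monom (f2 :: 'a mpoly3) (Suc q)"
  proof -
    have X: "homog (X i) = monom (X i :: 'a mpoly3) 1" for i
      by (simp add: homog_simps monom_Suc monom_0)
    show ?thesis
      unfolding f2_eq W_def homog_simps(1,2,8) X by (simp add: monom_power mult_monom add_monom)
  qed
  then show ?thesis by (simp add: degree_monom_eq)
qed

theorem invariant_polys_eq: "invariant_polys = subalg {f1, f2, F3}"
proof (rule equalityI)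
  show "subalg {f1, f2, F3} \<subseteq> invariant_polys"
  proof
    fix p assume "p \<in> subalg {f1, f2, F3}"
    then show "p \<in> invariant_polys"
      by induction (auto intro: Const_invariant f1_invariant f2_invariant F3_invariant
          invariant_polys_add invariant_polys_mult)
  qed
  have "f \<in> subalg {f1, f2, F3}" if "f \<in> invariant_polys" for f
    using that
  proof (induction "degree (homog f)" arbitrary: f rule: less_induct)
    case (less f)
    define n where "n = degree (homog f)"
    obtain A where A: "sub 0 (X 2) (X 3) f = sub 0 (X 2 ^ 2) Y A"
      by (rule restrict_square_Y [OF less.prems])
    \<comment> \<open>A lift of the restriction, as \<open>f1\<close> and \<open>F3\<close> restrict
      to \<open>X 2 ^ 2\<close> and \<open>Y\<close>. Truncating \<open>g\<close> at the degree of
      \<open>f\<close> stays in the algebra, since \<open>f1\<close> and \<open>F3\<close> are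
      homogeneous, and forces the quotient by \<open>f2\<close> to have smaller degree.\<close>
    define g where "g = sub 0 f1 F3 A"
    have g: "g \<in> subalg {f1, F3}"
      unfolding g_def using subalg.const [of 0 "{f1, F3}"]
      by (intro subalg_sub) (auto intro: subalg.gen)
    have "trunc n g \<in> subalg {f1, F3}"
      using subalg.const [of 0 "{f1, F3}"]
      by (intro trunc_subalg [OF g]) (auto simp: homog_f1 homog_F3 intro: subalg.gen)
    then have tg: "trunc n g \<in> subalg {f1, f2, F3}"
      by induction (auto intro: subalg.intros)
    have "trunc n g \<in> invariant_polys"
      using \<open>trunc n g \<in> subalg {f1, F3}\<close>
      by induction (auto intro: Const_invariant f1_invariant F3_invariant
          invariant_polys_add invariant_polys_mult)
    have "sub 0 (X 2) (X 3) (f - g) = 0"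
      by (simp add: A g_def sub_comp Const.poly_subst_simps F3_restrict f1_eq power2_eq_square)
    then have "X 1 dvd trunc n (f - g)" by (intro X_dvd_trunc) (simp only: X1_dvd_iff)
    then have "X 1 dvd trunc n f - trunc n g" by (simp only: trunc_diff)
    moreover have "trunc n f = f" by (simp add: n_def trunc_id)
    ultimately have dvd: "X 1 dvd f + trunc n g" by (simp only: c2)
    have "f + trunc n g \<in> invariant_polys"
      by (intro invariant_polys_add less.prems \<open>trunc n g \<in> invariant_polys\<close>)
    from invariant_f2_quotient [OF this dvd] obtain r where
      r: "r \<in> invariant_polys" "f + trunc n g = f2 * r" by blast
    have "r \<in> subalg {f1, f2, F3}"
    proof (cases "r = 0")
      case True
      then show ?thesis using subalg.const [of 0 "{f1, f2, F3}"] by simp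
    next
      case False
      have "degree (homog (f2 * r)) = Suc q + degree (homog r)"
        unfolding homog_simps using False by (subst degree_mult_eq) (simp_all add: degree_homog_f2)
      moreover have "degree (homog (f2 * r)) \<le> n"
        unfolding r(2) [symmetric] homog_simps
        by (rule degree_add_le) (simp_all add: n_def degree_homog_trunc)
      ultimately have "degree (homog r) < n" by simp
      then show ?thesis using less.hyps r(1) by (simp add: n_def)
    qed
    then have "f2 * r + trunc n g \<in> subalg {f1, f2, F3}"
      by (intro subalg.add subalg.mult tg) (auto intro: subalg.gen)
    also have "f2 * r + trunc n g = f" by (simp only: r(2) [symmetric] add_ac add_0_left add_0_right c2)
    finally show ?case .
  qed
  then show "invariant_polys \<subseteq> subalg {f1, f2, F3}" by blast
qed

end

subsection \<open>Generating sets\<close>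

text \<open>\<open>P\<close> describes a subalgebra that contains the other generators but not
  \<open>\<eta>\<close>.\<close>

lemma not_generating:
  assumes "\<eta> \<in> A" "\<not> P \<eta>"
    and "\<And>c. P (scalar (Const c))" "\<And>\<theta>. \<theta> \<in> S - {\<eta>} \<Longrightarrow> P \<theta>"
    and "\<And>\<theta> \<theta>'. P \<theta> \<Longrightarrow> P \<theta>' \<Longrightarrow> P (\<theta> + \<theta>')" "\<And>\<theta> \<theta>'. P \<theta> \<Longrightarrow> P \<theta>' \<Longrightarrow> P (\<theta> * \<theta>')"
  shows "algebra_span (S - {\<eta>}) \<noteq> A"
proof
  assume "algebra_span (S - {\<eta>}) = A"
  then have "\<eta> \<in> algebra_span (S - {\<eta>})" using assms(1) by simp
  then have "P \<eta>" by induction (use assms in auto)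
  then show False using assms(2) by simp
qed

text \<open>Determinants with rows among \<open>(x3, 0, x1)\<close>, \<open>(y3, 0, y1)\<close>,
  \<open>(u, f, v)\<close>: one of these is wedged with two combinations of all three. Terms with a
  repeated row vanish, leaving the full determinant times a minor of the coefficients.\<close>

lemma det_repeated:
  fixes a b c a' b' c' :: "'b::comm_ring_1"
  assumes c2: "\<And>x::'b. x + x = 0" "\<And>x y::'b. x + (x + y) = y"
  shows "x3 * ((c * f) * (a' * x1 + b' * y1 + c' * v) + (a * x1 + b * y1 + c * v) * (c' * f))
      + x1 * ((a * x3 + b * y3 + c * u) * (c' * f) + (c * f) * (a' * x3 + b' * y3 + c' * u))
    = (x3 * y1 + x1 * y3) * f * (b * c' + b' * c)"
   and "y3 * ((c * f) * (a' * x1 + b' * y1 + c' * v) + (a * x1 + b * y1 + c * v) * (c' * f))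
      + y1 * ((a * x3 + b * y3 + c * u) * (c' * f) + (c * f) * (a' * x3 + b' * y3 + c' * u))
    = (x3 * y1 + x1 * y3) * f * (a * c' + a' * c)"
   and "u * ((c * f) * (a' * x1 + b' * y1 + c' * v) + (a * x1 + b * y1 + c * v) * (c' * f))
      + f * ((a * x3 + b * y3 + c * u) * (a' * x1 + b' * y1 + c' * v) + (a * x1 + b * y1 + c * v) * (a' * x3 + b' * y3 + c' * u))
      + v * ((a * x3 + b * y3 + c * u) * (c' * f) + (c * f) * (a' * x3 + b' * y3 + c' * u))
    = (x3 * y1 + x1 * y3) * f * (a * b' + a' * b)"
  by (simp_all only: distrib_left distrib_right mult_ac add_ac add_0_left add_0_right c2)

context even_q
begin

lemma form_coeff_add: "form_coeff (\<eta> + \<theta>) S = form_coeff \<eta> S + form_coeff (\<theta> :: 'a dform) S"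
  by (simp add: plus_form.rep_eq)

lemma form_coeff_mult:
  fixes \<eta> \<theta> :: "'a dform"
  shows "form_coeff (\<eta> * \<theta>) {} = form_coeff \<eta> {} * form_coeff \<theta> {}"
    "form_coeff (\<eta> * \<theta>) {1} = form_coeff \<eta> {} * form_coeff \<theta> {1} + form_coeff \<eta> {1} * form_coeff \<theta> {}"
    "form_coeff (\<eta> * \<theta>) {2} = form_coeff \<eta> {} * form_coeff \<theta> {2} + form_coeff \<eta> {2} * form_coeff \<theta> {}"
    "form_coeff (\<eta> * \<theta>) {3} = form_coeff \<eta> {} * form_coeff \<theta> {3} + form_coeff \<eta> {3} * form_coeff \<theta> {}"
    "form_coeff (\<eta> * \<theta>) {1,2} = form_coeff \<eta> {} * form_coeff \<theta> {1,2} + form_coeff \<eta> {1} * form_coeff \<theta> {2}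
      + form_coeff \<eta> {2} * form_coeff \<theta> {1} + form_coeff \<eta> {1,2} * form_coeff \<theta> {}"
    "form_coeff (\<eta> * \<theta>) {1,3} = form_coeff \<eta> {} * form_coeff \<theta> {1,3} + form_coeff \<eta> {1} * form_coeff \<theta> {3}
      + form_coeff \<eta> {3} * form_coeff \<theta> {1} + form_coeff \<eta> {1,3} * form_coeff \<theta> {}"
    "form_coeff (\<eta> * \<theta>) {2,3} = form_coeff \<eta> {} * form_coeff \<theta> {2,3} + form_coeff \<eta> {2} * form_coeff \<theta> {3}
      + form_coeff \<eta> {3} * form_coeff \<theta> {2} + form_coeff \<eta> {2,3} * form_coeff \<theta> {}"
    "form_coeff (\<eta> * \<theta>) {1,2,3} = form_coeff \<eta> {} * form_coeff \<theta> {1,2,3} + form_coeff \<eta> {1} * form_coeff \<theta> {2,3}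
      + form_coeff \<eta> {2} * form_coeff \<theta> {1,3} + form_coeff \<eta> {3} * form_coeff \<theta> {1,2}
      + form_coeff \<eta> {1,2} * form_coeff \<theta> {3} + form_coeff \<eta> {1,3} * form_coeff \<theta> {2}
      + form_coeff \<eta> {2,3} * form_coeff \<theta> {1} + form_coeff \<eta> {1,2,3} * form_coeff \<theta> {}"
  by (rule form8_cases [of \<eta>], rule form8_cases [of \<theta>], simp add: form8_mult)+

lemma scalar_algebra_span:
  assumes "p \<in> subalg T" "scalar ` T \<subseteq> S"
  shows "scalar p \<in> (algebra_span S :: 'a dform set)"
  using assms(1)
proof induction
  case (add p r)
  have "scalar (p + r) = (scalar p + scalar r :: 'a dform)" by (simp add: scalar_form8 form8_add)
  then show ?case using add by (simp add: algebra_span.add)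
next
  case (mult p r)
  have "scalar (p * r) = (scalar p * scalar r :: 'a dform)" by (simp add: scalar_form8 form8_mult)
  then show ?case using mult by (simp add: algebra_span.mult)
qed (use assms(2) in \<open>auto intro: algebra_span.intros\<close>)

text \<open>On the line \<open>(0, z, z)\<close> both \<open>f2\<close> and \<open>F3\<close> vanish
  but \<open>f1\<close> is not constant. The \<open>0\<close> stands for the degree zero coefficient
  of the generators of positive degree.\<close>

lemma f1_not_subalg: "f1 \<notin> subalg {f2, F3, 0}"
proof
  let ?h = "sub 0 (X 3) (X 3) :: 'a mpoly3 \<Rightarrow> 'a mpoly3"
  assume "f1 \<in> subalg {f2, F3, 0}"
  then have "\<exists>c. ?h f1 = Const c"
  proof induction
    case (gen p)
    have "?h F3 = ?h (sub 0 (X 2) (X 3) F3)" by (simp add: sub_comp Const.poly_subst_simps)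
    also have "\<dots> = 0" unfolding F3_restrict by (simp add: Const.poly_subst_simps c2)
    finally have "?h F3 = 0" .
    moreover have "?h f2 = 0" using q_pos by (simp add: f2_eq W_def Const.poly_subst_simps power_0_left)
    ultimately show ?case using gen by (auto intro: exI [of _ 0])
  next
    case (add p r)
    then show ?case by (metis Const.poly_subst_add Const_add)
  next
    case (mult p r)
    then show ?case by (metis Const.poly_subst_mult Const_mult)
  qed auto
  moreover have "?h f1 = X 3 ^ 2"
    by (simp add: f1_eq Const.poly_subst_simps power2_eq_square)
  ultimately obtain c :: 'a where c: "X 3 ^ 2 = Const c" by metis
  have "Const c = sub 0 0 0 (X 3 ^ 2)" by (simp only: c Const.poly_subst_Const)
  also have "\<dots> = 0" by (simp add: Const.poly_subst_simps)
  finally show False using c by simp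
qed

text \<open>On the line \<open>(0, 0, z)\<close> both \<open>f1\<close> and \<open>f2\<close>
  vanish, whereas \<open>F3\<close> becomes \<open>z ^ N\<close>.\<close>

lemma F3_not_subalg: "F3 \<notin> subalg {f1, f2, 0}"
proof
  let ?h = "sub 0 0 (X 3) :: 'a mpoly3 \<Rightarrow> 'a mpoly3"
  assume "F3 \<in> subalg {f1, f2, 0}"
  then have "\<exists>c. ?h F3 = Const c"
  proof induction
    case (gen p)
    have "?h f1 = 0" "?h f2 = 0"
      using q_pos by (simp_all add: f1_eq f2_eq W_def Const.poly_subst_simps power_0_left)
    then show ?case using gen by (auto intro: exI [of _ 0])
  next
    case (add p r)
    then show ?case by (metis Const.poly_subst_add Const_add)
  next
    case (mult p r)
    then show ?case by (metis Const.poly_subst_mult Const_mult)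
  qed auto
  moreover have "?h F3 = X 3 ^ N"
  proof -
    have "?h F3 = ?h (sub 0 (X 2) (X 3) F3)" by (simp add: sub_comp Const.poly_subst_simps)
    then show ?thesis unfolding F3_restrict using N_pos by (simp add: Const.poly_subst_simps power_0_left)
  qed
  ultimately obtain c :: 'a where c: "X 3 ^ N = Const c" by metis
  have "Const c = sub 0 0 0 (X 3 ^ N)" by (simp only: c Const.poly_subst_Const)
  also have "\<dots> = 0" using N_pos by (simp add: Const.poly_subst_simps power_0_left)
  finally show False using c by simp
qed

text \<open>On the curve \<open>(1, v, v\<^sup>2)\<close>, where \<open>f1\<close> vanishes, and on the line \<open>(0, 0, v)\<close>, where \<open>f1\<close> and \<open>f2\<close> vanish, elements
  of the algebra are given by the same polynomial in \<open>f3\<close>.\<close>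

lemma f2_not_subalg: "f2 \<notin> subalg {f1, F3, 0}"
proof
  define \<phi> where "\<phi> = poly_subst (\<lambda>c::'a. [:c:]) (vec3 1 [:0, 1:] [:0, 0, 1:])"
  define \<psi> where "\<psi> = poly_subst (\<lambda>c::'a. [:c:]) (vec3 0 0 [:0, 1:])"
  have \<psi>_F3: "\<psi> F3 = [:0, 1:] ^ N"
  proof -
    have "\<psi> F3 = \<psi> (sub 0 (X 2) (X 3) F3)"
      unfolding \<psi>_def upoly.poly_subst_comp by (rule poly_subst_cong) (simp add: vec3_def)
    then show ?thesis
      unfolding F3_restrict \<psi>_def using N_pos by (simp add: upoly.poly_subst_simps power_0_left)
  qed
  assume "f2 \<in> subalg {f1, F3, 0}"
  then have "\<exists>P. \<phi> f2 = pcompose P (\<phi> F3) \<and> \<psi> f2 = pcompose P (\<psi> F3)"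
  proof induction
    case (const c)
    then show ?case by (intro exI [of _ "[:c:]"]) (simp add: \<phi>_def \<psi>_def)
  next
    case (gen p)
    have "(1 :: 'a poly) + 1 = 0"
      by (simp only: one_pCons add_pCons two_eq_0 add_0_left pCons_0_0)
    moreover have "\<phi> f1 = [:0, 0, 1:] + [:0, 0, 1:]"
      by (simp add: \<phi>_def f1_eq upoly.poly_subst_simps)
    ultimately have "\<phi> f1 = 0" by (simp only: char_two_simps)
    moreover have "\<psi> f1 = 0" by (simp add: \<psi>_def f1_eq upoly.poly_subst_simps)
    moreover have "\<phi> 0 = 0" "\<psi> 0 = 0" by (simp_all add: \<phi>_def \<psi>_def)
    moreover have "\<phi> F3 = pcompose [:0, 1:] (\<phi> F3)" "\<psi> F3 = pcompose [:0, 1:] (\<psi> F3)"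
      by (simp_all add: pcompose_pCons pcompose_1)
    ultimately show ?case
      using gen by (metis insertE emptyE pcompose_0)
  next
    case (add p r)
    then show ?case by (metis \<phi>_def \<psi>_def pcompose_add upoly.poly_subst_add)
  next
    case (mult p r)
    then show ?case by (metis \<phi>_def \<psi>_def pcompose_mult upoly.poly_subst_mult)
  qed
  then obtain P where P: "\<phi> f2 = pcompose P (\<phi> F3)" "\<psi> f2 = pcompose P (\<psi> F3)" by blast
  \<comment> \<open>On the line \<open>f2\<close> vanishes while \<open>F3\<close> is not constant,
    so \<open>P = 0\<close>; on the curve this would make \<open>f2\<close> vanish as well.\<close>
  have "\<psi> f2 = 0" using q_pos by (simp add: \<psi>_def f2_eq W_def upoly.poly_subst_simps power_0_left)
  then have "pcompose P ([:0, 1:] ^ N) = 0" using P(2) unfolding \<psi>_F3 by simp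
  moreover have "degree ([:0, 1:] ^ N :: 'a poly) > 0" using N_pos by (simp add: degree_power_eq)
  ultimately have "P = 0" by (rule pcompose_eq_0)
  then have "\<phi> f2 = 0" using P(1) by simp
  moreover have "\<phi> f2 = monom 1 2 + monom 1 (2 * q)"
  proof -
    have "[:0, 0, 1::'a:] = monom 1 2" by (simp add: numeral_2_eq_2 monom_Suc monom_0)
    then show ?thesis
      by (simp add: \<phi>_def f2_eq W_def upoly.poly_subst_simps monom_power)
  qed
  moreover have "coeff (monom 1 2 + monom 1 (2 * q) :: 'a poly) 2 = 1" using q_ge_2 by simp
  ultimately show False by simp
qed

lemma scalar_not_generating:
  assumes "scalar p \<in> A" "p \<notin> subalg T" "\<And>\<theta>. \<theta> \<in> S - {scalar p} \<Longrightarrow> form_coeff \<theta> {} \<in> subalg T"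
  shows "algebra_span (S - {scalar p}) \<noteq> (A :: 'a dform set)"
  by (rule not_generating [where P = "\<lambda>\<theta>. form_coeff \<theta> {} \<in> subalg T"])
    (use assms in \<open>auto simp: form_coeff_add form_coeff_mult scalar_form8 intro: subalg.intros\<close>)

text \<open>The functional given by \<open>m1, m2, m3\<close> obeys a Leibniz rule with the degree
  zero parts as weights, so its kernel is closed under products.\<close>

lemma one_form_not_generating:
  assumes "\<eta> \<in> A" "form_coeff \<eta> {1} * m1 + form_coeff \<eta> {2} * m2 + form_coeff \<eta> {3} * m3 \<noteq> 0"
    "\<And>\<theta>. \<theta> \<in> S - {\<eta>} \<Longrightarrow> form_coeff \<theta> {1} * m1 + form_coeff \<theta> {2} * m2 + form_coeff \<theta> {3} * m3 = 0"
  shows "algebra_span (S - {\<eta>}) \<noteq> (A :: 'a dform set)"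
proof (rule not_generating [where P = "\<lambda>\<theta>. form_coeff \<theta> {1} * m1 + form_coeff \<theta> {2} * m2 + form_coeff \<theta> {3} * m3 = 0"])
  fix \<theta> \<theta>' :: "'a dform"
  let ?L = "\<lambda>\<theta>. form_coeff \<theta> {1} * m1 + form_coeff \<theta> {2} * m2 + form_coeff \<theta> {3} * m3"
  assume 0: "?L \<theta> = 0" "?L \<theta>' = 0"
  have "?L (\<theta> + \<theta>') = ?L \<theta> + ?L \<theta>'" by (simp add: form_coeff_add algebra_simps)
  then show "?L (\<theta> + \<theta>') = 0" by (simp only: 0 add_0_left)
  have "?L (\<theta> * \<theta>') = form_coeff \<theta> {} * ?L \<theta>' + form_coeff \<theta>' {} * ?L \<theta>"
    by (simp add: form_coeff_mult algebra_simps)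
  then show "?L (\<theta> * \<theta>') = 0" by (simp only: 0 add_0_left mult_zero_right)
qed (use assms in \<open>simp_all add: scalar_form8\<close>)

abbreviation e1 :: "'a dform" where "e1 \<equiv> form8 0 (X 3) 0 (X 1) 0 0 0 0"
abbreviation e2 :: "'a dform" where "e2 \<equiv> form8 0 (X 3 ^ q) 0 (X 1 ^ q) 0 0 0 0"
abbreviation e3 :: "'a dform" where "e3 \<equiv> form8 0 (W 2 3) f2 (W 1 2) 0 0 0 0"

text \<open>The degree one part lies in the span of \<open>e1, e2, e3\<close> over all polynomials.
  Invariance of the coefficients is not asked for; divisibility by \<open>f2\<close> is what
  counts.\<close>

definition one_form_span :: "'a dform \<Rightarrow> bool" where
  "one_form_span \<eta> \<longleftrightarrow> (\<exists>a b c. form_coeff \<eta> {1} = a * X 3 + b * X 3 ^ q + c * W 2 3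
    \<and> form_coeff \<eta> {2} = c * f2 \<and> form_coeff \<eta> {3} = a * X 1 + b * X 1 ^ q + c * W 1 2)"

lemma one_form_span_add:
  assumes "one_form_span \<eta>" "one_form_span \<theta>"
  shows "one_form_span (\<eta> + \<theta>)"
proof -
  obtain a b c a' b' c' where
    "form_coeff \<eta> {1} = a * X 3 + b * X 3 ^ q + c * W 2 3"
    "form_coeff \<eta> {2} = c * f2" "form_coeff \<eta> {3} = a * X 1 + b * X 1 ^ q + c * W 1 2"
    "form_coeff \<theta> {1} = a' * X 3 + b' * X 3 ^ q + c' * W 2 3"
    "form_coeff \<theta> {2} = c' * f2" "form_coeff \<theta> {3} = a' * X 1 + b' * X 1 ^ q + c' * W 1 2"
    using assms unfolding one_form_span_def by blast
  then show ?thesis unfolding one_form_span_def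
    by (intro exI [of _ "a + a'"] exI [of _ "b + b'"] exI [of _ "c + c'"])
      (simp add: form_coeff_add algebra_simps)
qed

lemma one_form_span_mult:
  assumes "one_form_span \<eta>" "one_form_span \<theta>"
  shows "one_form_span (\<eta> * \<theta>)"
proof -
  obtain a b c a' b' c' where *:
    "form_coeff \<eta> {1} = a * X 3 + b * X 3 ^ q + c * W 2 3"
    "form_coeff \<eta> {2} = c * f2" "form_coeff \<eta> {3} = a * X 1 + b * X 1 ^ q + c * W 1 2"
    "form_coeff \<theta> {1} = a' * X 3 + b' * X 3 ^ q + c' * W 2 3"
    "form_coeff \<theta> {2} = c' * f2" "form_coeff \<theta> {3} = a' * X 1 + b' * X 1 ^ q + c' * W 1 2"
    using assms unfolding one_form_span_def by blast
  let ?x = "form_coeff \<eta> {}" and ?y = "form_coeff \<theta> {}"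
  show ?thesis unfolding one_form_span_def
    by (intro exI [of _ "?x * a' + ?y * a"] exI [of _ "?x * b' + ?y * b"] exI [of _ "?x * c' + ?y * c"])
      (simp add: form_coeff_mult * algebra_simps)
qed

text \<open>The determinant of \<open>e1, e2, e3\<close> is \<open>f2 * f2\<close>, so products of
  one-forms in their span pair to multiples of it. The quotients by \<open>f2\<close> pair to
  \<open>f2\<close> only.\<close>

lemma det_repeated_dvd:
  assumes "one_form_span \<eta>" "one_form_span \<theta>" "(u1, u2, u3) \<in>
      {(X 3, 0, X 1), (X 3 ^ q, 0, X 1 ^ q), (W 2 3, f2, W 1 2)}"
  shows "f2 * f2 dvd u1 * (form_coeff \<eta> {2} * form_coeff \<theta> {3} + form_coeff \<eta> {3} * form_coeff \<theta> {2})
    + u2 * (form_coeff \<eta> {1} * form_coeff \<theta> {3} + form_coeff \<eta> {3} * form_coeff \<theta> {1})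
    + u3 * (form_coeff \<eta> {1} * form_coeff \<theta> {2} + form_coeff \<eta> {2} * form_coeff \<theta> {1})"
proof -
  obtain a b c a' b' c' where *:
    "form_coeff \<eta> {1} = a * X 3 + b * X 3 ^ q + c * W 2 3"
    "form_coeff \<eta> {2} = c * f2" "form_coeff \<eta> {3} = a * X 1 + b * X 1 ^ q + c * W 1 2"
    "form_coeff \<theta> {1} = a' * X 3 + b' * X 3 ^ q + c' * W 2 3"
    "form_coeff \<theta> {2} = c' * f2" "form_coeff \<theta> {3} = a' * X 1 + b' * X 1 ^ q + c' * W 1 2"
    using assms unfolding one_form_span_def by blast
  show ?thesis
    using assms(3) unfolding *
  proof (elim insertE emptyE, goal_cases)
    case 1
    then show ?case by (simp add: det_repeated(1) [OF c2(1,2)] f2_W)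
  next
    case 2
    then show ?case by (simp add: det_repeated(2) [OF c2(1,2)] f2_W)
  next
    case 3
    then show ?case by (simp add: det_repeated(3) [OF c2(1,2)] f2_W)
  qed
qed

lemma f2_square_not_dvd: "\<not> f2 * f2 dvd (f2 :: 'a mpoly3)"
proof
  assume "f2 * f2 dvd (f2 :: 'a mpoly3)"
  then obtain r where "f2 * 1 = f2 * (f2 * r :: 'a mpoly3)" by (auto simp: mult.assoc elim: dvdE)
  then have "1 = f2 * (r :: 'a mpoly3)" by (rule f2_mult_cancel)
  then have "sub 0 0 0 1 = sub 0 0 0 (f2 * (r :: 'a mpoly3))" by simp
  then show False using q_pos by (simp add: Const.poly_subst_simps f2_eq W_def)
qed

text \<open>The one-form \<open>u\<close> annihilates the other two-forms, and products of one-forms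
  pair with it to multiples of \<open>f2 * f2\<close>. The span condition is carried along because
  it controls these products.\<close>

lemma two_form_not_generating:
  assumes "\<eta> \<in> A" and u: "(u1, u2, u3) \<in> {(X 3, 0, X 1), (X 3 ^ q, 0, X 1 ^ q), (W 2 3, f2, W 1 2)}"
    and \<eta>: "\<not> f2 * f2 dvd u1 * form_coeff \<eta> {2,3} + u2 * form_coeff \<eta> {1,3} + u3 * form_coeff \<eta> {1,2}"
    and S: "\<And>\<theta>. \<theta> \<in> S - {\<eta>} \<Longrightarrow> one_form_span \<theta>"
      "\<And>\<theta>. \<theta> \<in> S - {\<eta>} \<Longrightarrow> u1 * form_coeff \<theta> {2,3} + u2 * form_coeff \<theta> {1,3} + u3 * form_coeff \<theta> {1,2} = 0"
  shows "algebra_span (S - {\<eta>}) \<noteq> (A :: 'a dform set)"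
proof (rule not_generating [where P = "\<lambda>\<theta>. one_form_span \<theta> \<and>
    f2 * f2 dvd u1 * form_coeff \<theta> {2,3} + u2 * form_coeff \<theta> {1,3} + u3 * form_coeff \<theta> {1,2}"])
  fix \<theta> \<theta>' :: "'a dform"
  let ?L = "\<lambda>\<theta>. u1 * form_coeff \<theta> {2,3} + u2 * form_coeff \<theta> {1,3} + u3 * form_coeff \<theta> {1,2}"
  assume 1: "one_form_span \<theta> \<and> f2 * f2 dvd ?L \<theta>" and 2: "one_form_span \<theta>' \<and> f2 * f2 dvd ?L \<theta>'"
  have "?L (\<theta> + \<theta>') = ?L \<theta> + ?L \<theta>'" by (simp add: form_coeff_add algebra_simps)
  then show "one_form_span (\<theta> + \<theta>') \<and> f2 * f2 dvd ?L (\<theta> + \<theta>')"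
    using 1 2 one_form_span_add by (simp only: dvd_add simp_thms)
  have "?L (\<theta> * \<theta>') = form_coeff \<theta> {} * ?L \<theta>' + form_coeff \<theta>' {} * ?L \<theta>
    + (u1 * (form_coeff \<theta> {2} * form_coeff \<theta>' {3} + form_coeff \<theta> {3} * form_coeff \<theta>' {2})
    + u2 * (form_coeff \<theta> {1} * form_coeff \<theta>' {3} + form_coeff \<theta> {3} * form_coeff \<theta>' {1})
    + u3 * (form_coeff \<theta> {1} * form_coeff \<theta>' {2} + form_coeff \<theta> {2} * form_coeff \<theta>' {1}))"
    by (simp add: form_coeff_mult algebra_simps)
  also have "f2 * f2 dvd \<dots>"
    by (rule dvd_add [OF dvd_add [OF dvd_mult [OF conjunct2 [OF 2]] dvd_mult [OF conjunct2 [OF 1]]]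
      det_repeated_dvd [OF conjunct1 [OF 1] conjunct1 [OF 2] u]])
  finally show "one_form_span (\<theta> * \<theta>') \<and> f2 * f2 dvd ?L (\<theta> * \<theta>')"
    using 1 2 one_form_span_mult by blast
qed (use assms(1) \<eta> S in \<open>simp_all add: scalar_form8 one_form_span_def exI [of _ 0]\<close>)

text \<open>If all one-form coefficients vanish at the origin, so does the top coefficient of every
  product; that of the volume form is \<open>1\<close>.\<close>

lemma vol_not_generating:
  assumes "form8 0 0 0 0 0 0 0 1 \<in> A"
    and S: "\<And>\<theta> i. \<theta> \<in> S - {form8 0 0 0 0 0 0 0 1} \<Longrightarrow> sub 0 0 0 (form_coeff \<theta> {i}) = 0"
      "\<And>\<theta>. \<theta> \<in> S - {form8 0 0 0 0 0 0 0 1} \<Longrightarrow> form_coeff \<theta> {1,2,3} = 0"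
  shows "algebra_span (S - {form8 0 0 0 0 0 0 0 1}) \<noteq> (A :: 'a dform set)"
  by (rule not_generating [where P = "\<lambda>\<theta>. sub 0 0 0 (form_coeff \<theta> {1}) = 0 \<and> sub 0 0 0 (form_coeff \<theta> {2}) = 0
      \<and> sub 0 0 0 (form_coeff \<theta> {3}) = 0 \<and> sub 0 0 0 (form_coeff \<theta> {1,2,3}) = 0"])
    (use assms in \<open>auto simp: form_coeff_add form_coeff_mult scalar_form8 Const.poly_subst_simps\<close>)


lemma form8_split: "form8 a0 a1 a2 a3 a12 a13 a23 a123 = (scalar a0 + form8 0 a1 a2 a3 0 0 0 0
    + form8 0 0 0 0 a12 a13 a23 0 + scalar a123 * form8 0 0 0 0 0 0 0 1 :: 'a dform)"
  by (simp add: scalar_form8 form8_mult form8_add)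

lemma algebra_span_scalar_mult:
  assumes "p \<in> invariant_polys" "{scalar f1, scalar f2, scalar F3} \<subseteq> S" "\<eta> \<in> S"
  shows "scalar p * \<eta> \<in> (algebra_span S :: 'a dform set)"
  using scalar_algebra_span [of p "{f1, f2, F3}" S] assms invariant_polys_eq
  by (auto intro: algebra_span.mult algebra_span.gen)

section \<open>Generation and minimality for q > 2\<close>

lemma generates_q_gt_2:
  assumes q: "q > 2"
  shows "algebra_span {scalar f1, scalar f2, scalar F3, d f1, d f2, omega,
      form_div f2 (d f1 * d f2), form_div f2 (d f1 * omega), form_div f2 (d f2 * omega),
      dx 1 * dx 2 * dx 3} = (invariant_forms :: 'a dform set)" (is "algebra_span ?S = _")
proof (rule equalityI)
  have "?S \<subseteq> invariant_forms"
    unfolding form_div_df1_df2 form_div_df1_omega form_div_df2_omega vol_form8 unfolding d_f1 d_f2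
    by (simp add: scalar_invariant_iff f1_invariant f2_invariant F3_invariant
        omega_invariant coordinate_forms_invariant two_forms_invariant vol_invariant)
  then show "algebra_span ?S \<subseteq> invariant_forms" using algebra_span_subset_invariant by blast
  show "invariant_forms \<subseteq> algebra_span ?S"
  proof
    fix \<eta> :: "'a dform" assume inv: "\<eta> \<in> invariant_forms"
    obtain a0 a1 a2 a3 a12 a13 a23 a123 where \<eta>: "\<eta> = form8 a0 a1 a2 a3 a12 a13 a23 a123"
      by (rule form8_cases)
    note comp = form8_invariant_components [OF inv [unfolded \<eta>]]
    note gen = algebra_span_scalar_mult [where S = ?S]
    have p0: "scalar a0 \<in> algebra_span ?S"
      using scalar_algebra_span [of a0 "{f1, f2, F3}" ?S] comp(1) invariant_polys_eq by auto
    have p1: "form8 0 a1 a2 a3 0 0 0 0 \<in> algebra_span ?S"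
      by (rule one_form_decomp [OF comp(4) q]) (simp add: algebra_span.add gen)
    have p2: "form8 0 0 0 0 a12 a13 a23 0 \<in> algebra_span ?S"
      by (rule two_form_decomp [OF comp(5)]) (simp add: algebra_span.add gen)
    have p3: "scalar a123 * form8 0 0 0 0 0 0 0 1 \<in> algebra_span ?S"
      by (rule gen [OF comp(3)]) (simp_all add: vol_form8)
    show "\<eta> \<in> algebra_span ?S"
      unfolding \<eta> by (subst form8_split) (intro algebra_span.add p0 p1 p2 p3)
  qed
qed

lemma scalar_invariants: "scalar f1 \<in> (invariant_forms :: 'a dform set)"
  "scalar f2 \<in> (invariant_forms :: 'a dform set)" "scalar F3 \<in> (invariant_forms :: 'a dform set)"
  by (simp_all add: scalar_invariant_iff f1_invariant f2_invariant F3_invariant)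

lemma pairings:
  "W 2 3 * X 1 + f2 * X 2 + W 1 2 * X 3 = 0" "W 2 3 * X 1 ^ q + f2 * X 2 ^ q + W 1 2 * X 3 ^ q = 0"
  "X 3 * X 1 + X 1 * X 3 = (0 :: 'a mpoly3)" "X 3 ^ n * X 1 ^ n + X 1 ^ n * X 3 ^ n = (0 :: 'a mpoly3)"
  "X 3 ^ q * X 1 + X 1 ^ q * X 3 = (f2 :: 'a mpoly3)"
  unfolding f2_eq W_def by (simp_all only: c2_norm)

lemma one_form_spanI:
  "one_form_span (form8 a0 0 0 0 a12 a13 a23 a123)" "one_form_span e1" "one_form_span e2" "one_form_span e3"
proof -
  show "one_form_span (form8 a0 0 0 0 a12 a13 a23 a123)"
    unfolding one_form_span_def by (intro exI [of _ 0]) simp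
  show "one_form_span e1"
    unfolding one_form_span_def by (intro exI [of _ 1] exI [of _ 0]) simp
  show "one_form_span e2"
    unfolding one_form_span_def by (rule exI [of _ 0], rule exI [of _ 1], rule exI [of _ 0]) simp
  show "one_form_span e3"
    unfolding one_form_span_def by (rule exI [of _ 0], rule exI [of _ 0], rule exI [of _ 1]) simp
qed

lemma minimal_q_gt_2:
  assumes q: "q > 2"
  shows "minimal_generating_set {scalar f1, scalar f2, scalar F3, d f1, d f2, omega,
      form_div f2 (d f1 * d f2), form_div f2 (d f1 * omega), form_div f2 (d f2 * omega),
      dx 1 * dx 2 * dx 3} (invariant_forms :: 'a dform set)"
proof -
  define S :: "'a dform set" where "S = {scalar f1, scalar f2, scalar F3, e1, e2, e3, form8 0 0 0 0 0 1 0 0,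
    form8 0 0 0 0 (X 3) (X 2) (X 1) 0, form8 0 0 0 0 (X 3 ^ q) (X 2 ^ q) (X 1 ^ q) 0, form8 0 0 0 0 0 0 0 1}"
  have S: "{scalar f1, scalar f2, scalar F3, d f1, d f2, omega,
      form_div f2 (d f1 * d f2), form_div f2 (d f1 * omega), form_div f2 (d f2 * omega),
      dx 1 * dx 2 * dx 3} = S"
    unfolding S_def form_div_df1_df2 form_div_df1_omega form_div_df2_omega vol_form8
    unfolding d_f1 d_f2 omega_form8 by (rule refl)
  have gen: "algebra_span S = invariant_forms" using generates_q_gt_2 [OF q] unfolding S .
  have 1: "algebra_span (S - {scalar f1}) \<noteq> invariant_forms"
    by (rule scalar_not_generating [OF scalar_invariants(1) f1_not_subalg])
      (auto simp: S_def scalar_form8 intro: subalg.gen)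
  have 2: "algebra_span (S - {scalar f2}) \<noteq> invariant_forms"
    by (rule scalar_not_generating [OF scalar_invariants(2) f2_not_subalg])
      (auto simp: S_def scalar_form8 intro: subalg.gen)
  have 3: "algebra_span (S - {scalar F3}) \<noteq> invariant_forms"
    by (rule scalar_not_generating [OF scalar_invariants(3) F3_not_subalg])
      (auto simp: S_def scalar_form8 intro: subalg.gen)
  \<comment> \<open>The functional is the wedge product with the dual two-form: it kills
    \<open>e2\<close> and \<open>e3\<close> and has value \<open>f2\<close> at \<open>e1\<close>.
    The next two cases use the other dual forms.\<close>
  have 4: "algebra_span (S - {e1}) \<noteq> invariant_forms"
    by (rule one_form_not_generating [OF coordinate_forms_invariant(1),
          where ?m1.0 = "X 1 ^ q" and ?m2.0 = "X 2 ^ q" and ?m3.0 = "X 3 ^ q"])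
      (auto simp: S_def scalar_form8 pairings f2_W)
  have 5: "algebra_span (S - {e2}) \<noteq> invariant_forms"
    by (rule one_form_not_generating [OF coordinate_forms_invariant(2),
          where ?m1.0 = "X 1" and ?m2.0 = "X 2" and ?m3.0 = "X 3"])
      (auto simp: S_def scalar_form8 pairings f2_W)
  have 6: "algebra_span (S - {e3}) \<noteq> invariant_forms"
    by (rule one_form_not_generating [OF omega_invariant [unfolded omega_form8],
          where ?m1.0 = 0 and ?m2.0 = 1 and ?m3.0 = 0])
      (auto simp: S_def scalar_form8)
  \<comment> \<open>Dually, each two-form is tested by the one-form that annihilates the other two
    and gives \<open>f2\<close> on it.\<close>
  have 7: "algebra_span (S - {form8 0 0 0 0 0 1 0 0}) \<noteq> invariant_forms"
    by (rule two_form_not_generating [OF two_forms_invariant(1), of "W 2 3" f2 "W 1 2"])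
      (auto simp: S_def scalar_form8 pairings one_form_spanI f2_square_not_dvd)
  have 8: "algebra_span (S - {form8 0 0 0 0 (X 3) (X 2) (X 1) 0}) \<noteq> invariant_forms"
    by (rule two_form_not_generating [OF two_forms_invariant(2), of "X 3 ^ q" 0 "X 1 ^ q"])
      (auto simp: S_def scalar_form8 pairings one_form_spanI f2_square_not_dvd)
  have 9: "algebra_span (S - {form8 0 0 0 0 (X 3 ^ q) (X 2 ^ q) (X 1 ^ q) 0}) \<noteq> invariant_forms"
    by (rule two_form_not_generating [OF two_forms_invariant(3), of "X 3" 0 "X 1"])
      (auto simp: S_def scalar_form8 pairings f2_W one_form_spanI f2_square_not_dvd)
  have 10: "algebra_span (S - {form8 0 0 0 0 0 0 0 1}) \<noteq> invariant_forms"
  proof (rule vol_not_generating [OF vol_invariant])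
    fix \<theta> :: "'a dform" and i :: 3
    assume "\<theta> \<in> S - {form8 0 0 0 0 0 0 0 1}"
    then show "sub 0 0 0 (form_coeff \<theta> {i}) = 0"
      using exhaust_3 [of i] q_pos
      by (auto simp: S_def scalar_form8 W_def f2_eq Const.poly_subst_simps power_0_left)
  qed (auto simp: S_def scalar_form8)
  have "algebra_span (S - {\<eta>}) \<noteq> invariant_forms" if "\<eta> \<in> S" for \<eta>
    using that [unfolded S_def]
    by (elim insertE emptyE) (simp_all only: 1 2 3 4 5 6 7 8 9 10 not_False_eq_True)
  then show ?thesis unfolding minimal_generating_set_def S using gen by blast
qed

section \<open>Generation and minimality for q = 2\<close>

context
  assumes q2: "q = 2"
begin

lemma UNIV_2: "(UNIV :: 'a set) = {0, 1}"
  by (rule sym, rule card_subset_eq) (simp_all add: card_q q2)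

lemma F3_q2: "F3 = X 1 + X 2 + X 3"
proof -
  have two: "x = 0 \<or> x = 1" for x :: 'a using UNIV_2 by blast
  have "kappa = 1" using two [of kappa] no_root_kappa [of 0] by auto
  moreover have "s * s + s = 0" for s :: 'a using two [of s] by (auto simp: c2a)
  moreover have "a * b = 1 \<longleftrightarrow> a = 1 \<and> b = 1" for a b :: 'a
    using two [of a] two [of b] by auto
  ultimately have "E = {(1, 1)}"
    by (auto simp: E_def)
  then show ?thesis by (simp add: F3_def linear_form_def)
qed

lemma d_F3_q2: "d F3 = form8 0 1 1 1 0 0 0 0"
proof -
  have X: "X i = (Poly_Mapping.single (Poly_Mapping.single i 1) 1 :: 'a mpoly3)" for i by (simp add: X_def)
  show ?thesis
    unfolding F3_q2 d_form8 X partial_add partial_single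
    by (simp add: lookup_single)
qed

lemma d_F3_invariant_q2: "form8 0 1 1 1 0 0 0 0 \<in> (invariant_forms :: 'a dform set)"
  unfolding form8_invariant_iff
proof (intro allI impI)
  fix a b c e :: 'a
  have two: "x = 0 \<or> x = 1" for x :: 'a using UNIV_2 by blast
  assume "a * e + b * c = 1"
  then show "act4 a b c e 0 = 0 \<and>
       Const (a * a) * act4 a b c e 1 + Const (a * c) * act4 a b c e 1 + Const (c * c) * act4 a b c e 1 = 1 \<and>
       act4 a b c e 1 = 1 \<and>
       Const (b * b) * act4 a b c e 1 + Const (b * e) * act4 a b c e 1 + Const (e * e) * act4 a b c e 1 = 1 \<and>
       Const (a * a) * act4 a b c e 0 + Const (c * c) * act4 a b c e 0 = 0 \<and>
       Const (a * b) * act4 a b c e 0 + act4 a b c e 0 + Const (c * e) * act4 a b c e 0 = 0 \<and>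
       Const (b * b) * act4 a b c e 0 + Const (e * e) * act4 a b c e 0 = 0 \<and> act4 a b c e 0 = 0"
    using two [of a] two [of b] two [of c] two [of e]
    by (elim disjE) (simp_all add: act4_simps c2 c2a)
qed

lemma two_forms_q2:
  "form8 0 (X 3) 0 (X 1) 0 0 0 0 * form8 0 1 1 1 0 0 0 0 = (form8 0 0 0 0 (X 3) (X 1 + X 3) (X 1) 0 :: 'a dform)"
  "form8 0 (X 3 ^ 2) 0 (X 1 ^ 2) 0 0 0 0 * form8 0 1 1 1 0 0 0 0 = (form8 0 0 0 0 (X 3 ^ 2) (X 1 ^ 2 + X 3 ^ 2) (X 1 ^ 2) 0 :: 'a dform)"
  by (simp_all add: form8_mult add.commute)

text \<open>The wedge product of \<open>d f1, d f2, d F3\<close> is \<open>f2\<close> times the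
  volume form, so \<open>a2\<close> itself is the coefficient of \<open>d F3\<close>, and the other
  two coefficients come from pairing with \<open>d f1 * d F3\<close> and
  \<open>d f2 * d F3\<close>.\<close>

lemma one_form_decomp_q2:
  assumes inv: "form8 0 a1 a2 a3 0 0 0 0 \<in> (invariant_forms :: 'a dform set)"
  obtains A B C where "A \<in> invariant_polys" "B \<in> invariant_polys" "C \<in> invariant_polys"
    "form8 0 a1 a2 a3 0 0 0 0 = scalar A * d f1 + scalar B * d f2 + scalar C * d F3"
proof -
  have a23: "X 1 dvd a2 + a3" using one_form_dvd [OF inv, of 1] by simp
  have inv2: "form8 0 0 0 0 (X 3) (X 1 + X 3) (X 1) 0 \<in> (invariant_forms :: 'a dform set)"
    "form8 0 0 0 0 (X 3 ^ 2) (X 1 ^ 2 + X 3 ^ 2) (X 1 ^ 2) 0 \<in> (invariant_forms :: 'a dform set)"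
    using invariant_forms_mult [OF coordinate_forms_invariant(1) d_F3_invariant_q2]
      invariant_forms_mult [OF coordinate_forms_invariant(2) d_F3_invariant_q2]
    by (simp_all only: q2 two_forms_q2)
  have C: "a2 \<in> invariant_polys"
    by (rule form8_invariant_components(2) [OF inv])
  \<comment> \<open>Regrouped so that only \<open>a2 + a3\<close> meets \<open>X 3\<close>: its
    divisibility by \<open>X 1\<close> is all that the single parameter \<open>t = 1\<close>
    provides.\<close>
  have eq: "a1 * X 1 + a2 * (X 1 + X 3) + a3 * X 3 = (a1 + a2) * X 1 + (a2 + a3) * X 3"
    "a1 * X 1 ^ 2 + a2 * (X 1 ^ 2 + X 3 ^ 2) + a3 * X 3 ^ 2 = (a1 + a2) * X 1 ^ 2 + (a2 + a3) * X 3 ^ 2"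
    by (simp_all add: algebra_simps)
  have "X 1 dvd (a1 + a2) * X 1 + (a2 + a3) * X 3" "X 1 dvd (a1 + a2) * X 1 ^ 2 + (a2 + a3) * X 3 ^ 2"
    using a23 by (auto intro!: dvd_add dvd_mult2 intro: dvd_mult dvd_power)
  then obtain A B where AB: "A \<in> invariant_polys" "(a1 + a2) * X 1 ^ 2 + (a2 + a3) * X 3 ^ 2 = f2 * A"
    "B \<in> invariant_polys" "(a1 + a2) * X 1 + (a2 + a3) * X 3 = f2 * B"
    using invariant_f2_quotient [OF wedge_invariant [OF inv inv2(1)]]
      invariant_f2_quotient [OF wedge_invariant [OF inv inv2(2)]]
    unfolding eq by blast
  note f2 = f2_W(1) [unfolded q2]
  have "f2 * a1 = f2 * (A * X 3 + B * X 3 ^ 2 + a2)"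
  proof -
    have "f2 * (A * X 3 + B * X 3 ^ 2 + a2) = (f2 * A) * X 3 + (f2 * B) * X 3 ^ 2 + f2 * a2"
      by (simp add: algebra_simps)
    also have "\<dots> = f2 * a1"
      unfolding AB(2) [symmetric] AB(4) [symmetric] unfolding f2 [symmetric] by (simp only: c2_norm)
    finally show ?thesis by simp
  qed
  moreover have "f2 * a3 = f2 * (A * X 1 + B * X 1 ^ 2 + a2)"
  proof -
    have "f2 * (A * X 1 + B * X 1 ^ 2 + a2) = (f2 * A) * X 1 + (f2 * B) * X 1 ^ 2 + f2 * a2"
      by (simp add: algebra_simps)
    also have "\<dots> = f2 * a3"
      unfolding AB(2) [symmetric] AB(4) [symmetric] unfolding f2 [symmetric] by (simp only: c2_norm)
    finally show ?thesis by simp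
  qed
  ultimately show ?thesis
    using AB C by (intro that [of A B a2])
      (simp_all add: d_f1 d_f2 d_F3_q2 scalar_mult form8_add q2 mult.commute)
qed

lemma two_form_decomp_q2:
  assumes inv: "form8 0 0 0 0 a12 a13 a23 0 \<in> (invariant_forms :: 'a dform set)"
  obtains A B C where "A \<in> invariant_polys" "B \<in> invariant_polys" "C \<in> invariant_polys"
    "form8 0 0 0 0 a12 a13 a23 0 = scalar A * (d f2 * d F3)
      + scalar B * (d f1 * d F3) + scalar C * form_div f2 (d f1 * d f2)"
proof -
  have dvd: "X 1 dvd a23" by (rule two_form_dvd [OF inv])
  note w = wedge_invariant [OF coordinate_forms_invariant(1) inv]
    wedge_invariant [OF coordinate_forms_invariant(2) inv]
    wedge_invariant [OF d_F3_invariant_q2 inv]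
  obtain A where A: "A \<in> invariant_polys" "X 3 * a23 + X 1 * a12 = f2 * A"
    using invariant_f2_quotient [OF w(1)] dvd by auto
  obtain B where B: "B \<in> invariant_polys" "X 3 ^ 2 * a23 + X 1 ^ 2 * a12 = f2 * B"
    using invariant_f2_quotient [OF w(2)] dvd by (auto simp: q2)
  \<comment> \<open>The pairing with \<open>d F3\<close>, used undivided because \<open>d F3\<close>
    pairs to \<open>1\<close> with the quotient of \<open>d f1 * d f2\<close> by
    \<open>f2\<close>.\<close>
  define C where "C = a23 + a13 + a12"
  have C: "C \<in> invariant_polys" using w(3) by (simp add: C_def)
  note f2 = f2_W(1) [unfolded q2]
  have "f2 * a12 = f2 * (A * X 3 ^ 2 + B * X 3)"
  proof -
    have "f2 * (A * X 3 ^ 2 + B * X 3) = (f2 * A) * X 3 ^ 2 + (f2 * B) * X 3"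
      by (simp add: algebra_simps)
    also have "\<dots> = f2 * a12"
      unfolding A(2) [symmetric] B(2) [symmetric] unfolding f2 [symmetric] by (simp only: c2_norm)
    finally show ?thesis by simp
  qed
  then have a12: "a12 = A * X 3 ^ 2 + B * X 3" by (rule f2_mult_cancel)
  have "f2 * a23 = f2 * (A * X 1 ^ 2 + B * X 1)"
  proof -
    have "f2 * (A * X 1 ^ 2 + B * X 1) = (f2 * A) * X 1 ^ 2 + (f2 * B) * X 1"
      by (simp add: algebra_simps)
    also have "\<dots> = f2 * a23"
      unfolding A(2) [symmetric] B(2) [symmetric] unfolding f2 [symmetric] by (simp only: c2_norm)
    finally show ?thesis by simp
  qed
  then have a23: "a23 = A * X 1 ^ 2 + B * X 1" by (rule f2_mult_cancel)
  have a13: "a13 = A * (X 1 ^ 2 + X 3 ^ 2) + B * (X 1 + X 3) + C"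
    unfolding C_def a12 a23 by (simp only: c2_norm)
  show ?thesis
    by (rule that [OF A(1) B(1) C])
      (simp add: d_f1 d_f2 d_F3_q2 form_div_df1_df2 [unfolded d_f1 d_f2 q2] q2 two_forms_q2
        scalar_mult form8_add a12 a23 a13)
qed

lemma generates_q2:
  "algebra_span {scalar f1, scalar f2, scalar F3, d f1, d f2, d F3, form_div f2 (d f1 * d f2)}
    = (invariant_forms :: 'a dform set)" (is "algebra_span ?S = _")
proof (rule equalityI)
  have "?S \<subseteq> invariant_forms"
    unfolding form_div_df1_df2 unfolding d_f1 d_f2 d_F3_q2
    by (simp add: scalar_invariants d_F3_invariant_q2 coordinate_forms_invariant two_forms_invariant)
  then show "algebra_span ?S \<subseteq> invariant_forms" using algebra_span_subset_invariant by blast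
  show "invariant_forms \<subseteq> algebra_span ?S"
  proof
    fix \<eta> :: "'a dform" assume inv: "\<eta> \<in> invariant_forms"
    obtain a0 a1 a2 a3 a12 a13 a23 a123 where \<eta>: "\<eta> = form8 a0 a1 a2 a3 a12 a13 a23 a123"
      by (rule form8_cases)
    note comp = form8_invariant_components [OF inv [unfolded \<eta>]]
    have scalar: "scalar p \<in> algebra_span ?S" if "p \<in> invariant_polys" for p
      using scalar_algebra_span [of p "{f1, f2, F3}" ?S] that invariant_polys_eq by auto
    have gens: "d f1 \<in> algebra_span ?S" "d f2 \<in> algebra_span ?S" "d F3 \<in> algebra_span ?S"
      "form_div f2 (d f1 * d f2) \<in> algebra_span ?S"
      by (auto intro: algebra_span.gen)
    have p1: "form8 0 a1 a2 a3 0 0 0 0 \<in> algebra_span ?S"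
      by (rule one_form_decomp_q2 [OF comp(4)]) (simp only: algebra_span.add algebra_span.mult scalar gens)
    have p2: "form8 0 0 0 0 a12 a13 a23 0 \<in> algebra_span ?S"
      by (rule two_form_decomp_q2 [OF comp(5)]) (simp only: algebra_span.add algebra_span.mult scalar gens)
    \<comment> \<open>Since \<open>d F3\<close> has constant coefficients, the volume form is a
      product of generators, unlike for \<open>q > 2\<close>.\<close>
    have "form8 0 0 0 0 0 0 0 1 = d F3 * form_div f2 (d f1 * d f2)"
      unfolding form_div_df1_df2 unfolding d_F3_q2 by (simp add: form8_mult)
    then have p3: "form8 0 0 0 0 0 0 0 1 \<in> algebra_span ?S"
      by (simp only: algebra_span.mult gens)
    show "\<eta> \<in> algebra_span ?S"
      unfolding \<eta> by (subst form8_split)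
        (intro algebra_span.add algebra_span.mult scalar comp(1) comp(3) p1 p2 p3)
  qed
qed

lemma minimal_q2:
  "minimal_generating_set {scalar f1, scalar f2, scalar F3, d f1, d f2, d F3, form_div f2 (d f1 * d f2)}
    (invariant_forms :: 'a dform set)"
proof -
  let ?e2 = "form8 0 (X 3 ^ 2) 0 (X 1 ^ 2) 0 0 0 0 :: 'a dform"
  define S :: "'a dform set" where "S = {scalar f1, scalar f2, scalar F3, e1, ?e2,
    form8 0 1 1 1 0 0 0 0, form8 0 0 0 0 0 1 0 0}"
  have S: "{scalar f1, scalar f2, scalar F3, d f1, d f2, d F3, form_div f2 (d f1 * d f2)} = S"
    unfolding S_def form_div_df1_df2 unfolding d_f1 d_f2 d_F3_q2 q2 by (rule refl)
  have gen: "algebra_span S = invariant_forms" using generates_q2 unfolding S .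
  have f2: "X 3 * X 1 ^ 2 + X 1 * X 3 ^ 2 = (f2 :: 'a mpoly3)" "X 3 ^ 2 * X 1 + X 1 ^ 2 * X 3 = (f2 :: 'a mpoly3)"
    using f2_W(2) [unfolded q2] by (simp_all only: mult.commute add.commute)
  have 1: "algebra_span (S - {scalar f1}) \<noteq> invariant_forms"
    by (rule scalar_not_generating [OF scalar_invariants(1) f1_not_subalg])
      (auto simp: S_def scalar_form8 intro: subalg.gen)
  have 2: "algebra_span (S - {scalar f2}) \<noteq> invariant_forms"
    by (rule scalar_not_generating [OF scalar_invariants(2) f2_not_subalg])
      (auto simp: S_def scalar_form8 intro: subalg.gen)
  have 3: "algebra_span (S - {scalar F3}) \<noteq> invariant_forms"
    by (rule scalar_not_generating [OF scalar_invariants(3) F3_not_subalg])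
      (auto simp: S_def scalar_form8 intro: subalg.gen)
  have two: "2 * p = 0" for p :: "'a mpoly3"
    by (simp only: mult_2 c2)
  have 4: "algebra_span (S - {e1}) \<noteq> invariant_forms"
    by (rule one_form_not_generating [OF coordinate_forms_invariant(1),
          where ?m1.0 = "X 1 ^ 2" and ?m2.0 = "X 1 ^ 2 + X 3 ^ 2" and ?m3.0 = "X 3 ^ 2"])
      (auto simp: S_def scalar_form8 pairings f2 two)
  have 5: "algebra_span (S - {?e2}) \<noteq> invariant_forms"
    by (rule one_form_not_generating [OF coordinate_forms_invariant(2) [unfolded q2],
          where ?m1.0 = "X 1" and ?m2.0 = "X 1 + X 3" and ?m3.0 = "X 3"])
      (auto simp: S_def scalar_form8 pairings f2 two)
  have 6: "algebra_span (S - {form8 0 1 1 1 0 0 0 0}) \<noteq> invariant_forms"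
    by (rule one_form_not_generating [OF d_F3_invariant_q2,
          where ?m1.0 = 0 and ?m2.0 = 1 and ?m3.0 = 0])
      (auto simp: S_def scalar_form8)
  \<comment> \<open>At the origin \<open>d f1\<close> and \<open>d f2\<close> vanish and
    \<open>d F3\<close> has equal coefficients at \<open>dx 1\<close> and \<open>dx 3\<close>.
    Equality of these makes the \<open>{1,3}\<close> contribution of a product of one-forms vanish
    there, being twice one term.\<close>
  have 7: "algebra_span (S - {form8 0 0 0 0 0 1 0 0}) \<noteq> invariant_forms"
    by (rule not_generating [OF two_forms_invariant(1), where
          P = "\<lambda>\<theta>. sub 0 0 0 (form_coeff \<theta> {1}) = sub 0 0 0 (form_coeff \<theta> {3}) \<and> sub 0 0 0 (form_coeff \<theta> {1,3}) = 0"])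
      (auto simp: S_def scalar_form8 form_coeff_add form_coeff_mult Const.poly_subst_simps c2 mult.commute)
  have "algebra_span (S - {\<eta>}) \<noteq> invariant_forms" if "\<eta> \<in> S" for \<eta>
    using that [unfolded S_def]
    by (elim insertE emptyE) (simp_all only: 1 2 3 4 5 6 7 not_False_eq_True)
  then show ?thesis unfolding minimal_generating_set_def S using gen by blast
qed

end

end

theorem corollary1p4:
  fixes \<gamma> \<delta> :: "'a::{field,finite}" and k :: nat
  assumes "CARD('a) = 2 ^ k"
    and "irreducible [:- \<delta>, - \<gamma>, 1:]"
  shows
    "(CARD('a) > 2 \<longrightarrow>
       minimal_generating_set
         {scalar f1, scalar f2, scalar (f3 \<gamma> \<delta>), d f1, d f2, omega,
          form_div f2 (d f1 * d f2), form_div f2 (d f1 * omega), form_div f2 (d f2 * omega),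
          dx 1 * dx 2 * dx 3}
         invariant_forms) \<and>
     (CARD('a) = 2 \<longrightarrow>
       minimal_generating_set
         {scalar f1, scalar f2, scalar (f3 \<gamma> \<delta>), d f1, d f2, d (f3 \<gamma> \<delta>),
          form_div f2 (d f1 * d f2)}
         invariant_forms)"
proof -
  interpret even_q \<gamma> \<delta> k by unfold_locales (rule assms)+
  show ?thesis
    unfolding f3_eq card_q using minimal_q_gt_2 minimal_q2 by blast
qed

end
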